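(* Let $\mathbb{G}$ be a Carnot group of homogeneous dimension $Q$ and $|\cdot|_{\mathbb{G}}$ a homogeneous norm on it. Let $s\in(0,1)$, put $p^*=\frac{Q}{Q-s}$, and let $1\le p<p^*$. Then there is a constant $C$, independent of $f$ and of the ball, such that $$\left(\frac1{|B_X|}\int_{B_X}|f(x)-f_{B_X}|^p\,dx\right)^{1/p}\le C(1-s)\,R^{Q+s}\,\frac{1}{|B_X|^2}\int_{B_X}\int_{B_X}\frac{|f(x)-f(y)|}{|y^{-1}\cdot x|_{\mathbb{G}}^{Q+s}}\,dy\,dx$$ for all Carnot–Carathéodory balls $B_X$ of radius $R>0$ and all $f\in L^1_{loc}(\mathbb{G})$.
   Context: Carnot group: a simply connected Lie group $\mathbb{G}$ whose Lie algebra $\mathfrak{g}$ (left-invariant vector fields) is stratified: $\mathfrak g=\bigoplus_{j=1}^kW_j$, $W_{j+1}=[W_1,W_j]$ for $j<k$, $[W_1,W_k]=0$. Put $m_j=\dim W_j$, $N=\sum_j m_j$, $Q=\sum_j j\,m_j$ (homogeneous dimension). Fix a basis $X_1,\dots,X_N$ of $\mathfrak g$ adapted to the layers in increasing order, so $X_1,\dots,X_{m_1}$ is a basis of $W_1$. Via canonical coordinates $x=\exp(x_1X_1+\dots+x_NX_N)$, $\mathbb{G}$ is identified with $\mathbb{R}^N$ with the induced group law $\cdot$ and identity $0$; the Haar measure $dx$ is Lebesgue measure, $|E|$ denotes the measure of $E$. The group dilations $\delta_\lambda$, $\lambda>0$, multiply coordinates of the $j$-th layer by $\lambda^j$. Homogeneous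 norm: a continuous $|\cdot|_{\mathbb{G}}:\mathbb{G}\to[0,\infty)$ with $|x|_{\mathbb{G}}=0\iff x=0$, $|x^{-1}|_{\mathbb{G}}=|x|_{\mathbb{G}}$, $|\delta_\lambda(x)|_{\mathbb{G}}=\lambda|x|_{\mathbb{G}}$. Carnot–Carathéodory (CC) distance: $d_X(x,y)=\inf\int_0^1|\dot\gamma(t)|_X\,dt$ over horizontal $C^1$ curves $\gamma$ joining $x$ to $y$ (that is, $\dot\gamma(t)\in\mathrm{span}\{X_1(\gamma(t)),\dots,X_{m_1}(\gamma(t))\}$), where $|\cdot|_X$ is the norm making $X_1,\dots,X_{m_1}$ orthonormal. CC balls are the metric balls of $d_X$. $f_{B_X}$ is the average of $f$ on $B_X$. The right-hand side may be $+\infty$. *)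

theory Defs
  imports "HOL-Analysis.Analysis" "HOL-Algebra.Group"
begin

section \<open>Smooth maps\<close>

text \<open>
  \<open>C_diff n f\<close> says that \<open>f\<close> is of class C^n on the whole space: differentiable, with all
  directional derivatives of class C^(n-1).
\<close>

primrec C_diff :: "nat \<Rightarrow> ('a::euclidean_space \<Rightarrow> 'b::real_normed_vector) \<Rightarrow> bool" where
  "C_diff 0 f \<longleftrightarrow> continuous_on UNIV f"
| "C_diff (Suc n) f \<longleftrightarrow>
     (\<forall>x. f differentiable (at x)) \<and> (\<forall>v. C_diff n (\<lambda>x. frechet_derivative f (at x) v))"

definition smooth_map :: "('a::euclidean_space \<Rightarrow> 'b::real_normed_vector) \<Rightarrow> bool" where
  "smooth_map f \<longleftrightarrow> (\<forall>n. C_diff n f)"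

section \<open>Vector fields on \<open>real^'n\<close>\<close>

type_synonym 'n vfield = "real^'n \<Rightarrow> real^'n"

text \<open>
  Linear span of a set of vector fields. It is written out because functions do not carry an
  instance of class \<open>real_vector\<close>.
\<close>

definition vf_span :: "('n::finite) vfield set \<Rightarrow> 'n vfield set" where
  "vf_span S = {\<lambda>x. \<Sum>l<m. c l *\<^sub>R F l x | (m::nat) (c :: nat \<Rightarrow> real) F. \<forall>l<m. F l \<in> S}"

definition lie_bracket :: "('n::finite) vfield \<Rightarrow> 'n vfield \<Rightarrow> 'n vfield" where
  "lie_bracket U V =
     (\<lambda>x. frechet_derivative V (at x) (U x) - frechet_derivative U (at x) (V x))"

definition bracket_space :: "('n::finite) vfield set \<Rightarrow> 'n vfield set \<Rightarrow> 'n vfield set" where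
  "bracket_space A B = vf_span {lie_bracket U V | U V. U \<in> A \<and> V \<in> B}"

text \<open>
  The Lie algebra of \<open>G\<close>: vector fields \<open>V\<close> with \<open>dL_x(y) (V y) = V (x \<otimes> y)\<close>, where
  \<open>L_x\<close> is left translation. Such fields are automatically smooth when the product is.
\<close>

definition left_invariant_fields :: "(real^'n::finite) monoid \<Rightarrow> 'n vfield set" where
  "left_invariant_fields G =
     {V. \<forall>x y. frechet_derivative (\<lambda>z. x \<otimes>\<^bsub>G\<^esub> z) (at y) (V y) = V (x \<otimes>\<^bsub>G\<^esub> y)}"

text \<open>
  \<open>is_exp V p\<close> says \<open>p = exp V\<close>: the integral curve of \<open>V\<close> starting at the identity \<open>0\<close>
  reaches \<open>p\<close> at time 1.
\<close>

definition is_exp :: "('n::finite) vfield \<Rightarrow> real^'n \<Rightarrow> bool" where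
  "is_exp V p \<longleftrightarrow>
     (\<exists>\<gamma>. \<gamma> 0 = 0 \<and> \<gamma> 1 = p \<and>
       (\<forall>t\<in>{0..1}. (\<gamma> has_vector_derivative V (\<gamma> t)) (at t within {0..1})))"

section \<open>Carnot groups in canonical coordinates\<close>

text \<open>
  \<open>X i\<close> are the basis fields and \<open>wt i\<close> is the number of the layer containing \<open>X i\<close>. The
  index type is not ordered: the position of a basis field inside the enumeration
  \<open>X_1, ..., X_N\<close> plays no role beyond determining its layer, which \<open>wt\<close> records.
\<close>

definition layer :: "('n::finite \<Rightarrow> 'n vfield) \<Rightarrow> ('n \<Rightarrow> nat) \<Rightarrow> nat \<Rightarrow> 'n vfield set" where
  "layer X wt j = vf_span (X ` {i. wt i = j})"

text \<open>
  A simply connected nilpotent Lie group is identified with \<open>real^'n\<close> through its exponential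
  map, so that simple connectedness holds automatically. The assumptions \<open>X_independent\<close>,
  \<open>X_spans\<close> and \<open>wt_range\<close> say that \<open>X\<close> is a basis of the Lie algebra and hence that the Lie
  algebra is the direct sum of the layers 1 to \<open>k\<close>; \<open>canonical_coordinates\<close> says
  \<open>x = exp (x_1 X_1 + ... + x_N X_N)\<close>.
\<close>

locale carnot_group = group G for G :: "(real^'n::finite) monoid" (structure) +
  fixes X :: "'n \<Rightarrow> 'n vfield" and wt :: "'n \<Rightarrow> nat" and k :: nat
  assumes carrier_UNIV: "carrier G = UNIV"
    and one_zero: "\<one> = 0"
    and smooth_mult: "smooth_map (\<lambda>z :: (real^'n) \<times> (real^'n). fst z \<otimes> snd z)"
    and smooth_inv: "smooth_map (\<lambda>x. inv x)"
    and X_independent: "\<And>c. (\<lambda>x. \<Sum>i\<in>UNIV. c i *\<^sub>R X i x) = (\<lambda>x. 0) \<Longrightarrow> c = (\<lambda>i. 0)"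
    and X_spans: "vf_span (range X) = left_invariant_fields G"
    and wt_range: "\<And>i. 1 \<le> wt i \<and> wt i \<le> k"
    and stratified: "\<And>j. 1 \<le> j \<Longrightarrow> j < k \<Longrightarrow>
          layer X wt (j + 1) = bracket_space (layer X wt 1) (layer X wt j)"
    and stratified_top: "bracket_space (layer X wt 1) (layer X wt k) = {\<lambda>x. 0}"
    and canonical_coordinates: "\<And>x. is_exp (\<lambda>y. \<Sum>i\<in>UNIV. (x $ i) *\<^sub>R X i y) x"

definition homogeneous_dim :: "('n::finite \<Rightarrow> nat) \<Rightarrow> nat \<Rightarrow> nat" where
  "homogeneous_dim wt k = (\<Sum>j=1..k. j * card {i. wt i = j})"

definition dilation :: "('n::finite \<Rightarrow> nat) \<Rightarrow> real \<Rightarrow> real^'n \<Rightarrow> real^'n" where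
  "dilation wt r x = (\<chi> i. r ^ wt i * x $ i)"

definition homogeneous_norm ::
  "(real^'n::finite) monoid \<Rightarrow> ('n \<Rightarrow> nat) \<Rightarrow> (real^'n \<Rightarrow> real) \<Rightarrow> bool" where
  "homogeneous_norm G wt nrm \<longleftrightarrow>
     continuous_on UNIV nrm \<and>
     (\<forall>x. 0 \<le> nrm x) \<and>
     (\<forall>x. nrm x = 0 \<longleftrightarrow> x = 0) \<and>
     (\<forall>x. nrm (inv\<^bsub>G\<^esub> x) = nrm x) \<and>
     (\<forall>r>0. \<forall>x. nrm (dilation wt r x) = r * nrm x)"

section \<open>Carnot-Caratheodory distance\<close>

definition horizontal_space ::
  "('n::finite \<Rightarrow> 'n vfield) \<Rightarrow> ('n \<Rightarrow> nat) \<Rightarrow> real^'n \<Rightarrow> (real^'n) set" where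
  "horizontal_space X wt x = span ((\<lambda>i. X i x) ` {i. wt i = 1})"

text \<open>
  Norm of a horizontal vector \<open>v\<close> at \<open>x\<close> for which the first-layer fields are orthonormal; the
  coefficients of \<open>v\<close> are unique since the fields are linearly independent at each point.
\<close>

definition horizontal_norm ::
  "('n::finite \<Rightarrow> 'n vfield) \<Rightarrow> ('n \<Rightarrow> nat) \<Rightarrow> real^'n \<Rightarrow> real^'n \<Rightarrow> real" where
  "horizontal_norm X wt x v =
     (THE r. \<exists>c. v = (\<Sum>i | wt i = 1. c i *\<^sub>R X i x) \<and> r = sqrt (\<Sum>i | wt i = 1. (c i)\<^sup>2))"

text \<open>
  \<open>C1_differentiable_on {0..1}\<close> refers to two-sided derivatives also at the endpoints. This
  is no restriction, since a \<open>C^1\<close> curve on the closed interval extends to the line.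
\<close>

definition horizontal_curve ::
  "('n::finite \<Rightarrow> 'n vfield) \<Rightarrow> ('n \<Rightarrow> nat) \<Rightarrow> (real \<Rightarrow> real^'n) \<Rightarrow> bool" where
  "horizontal_curve X wt \<gamma> \<longleftrightarrow>
     \<gamma> C1_differentiable_on {0..1} \<and>
     (\<forall>t\<in>{0..1}. vector_derivative \<gamma> (at t) \<in> horizontal_space X wt (\<gamma> t))"

definition cc_length ::
  "('n::finite \<Rightarrow> 'n vfield) \<Rightarrow> ('n \<Rightarrow> nat) \<Rightarrow> (real \<Rightarrow> real^'n) \<Rightarrow> ennreal" where
  "cc_length X wt \<gamma> =
     (\<integral>\<^sup>+t\<in>{0..1}. ennreal (horizontal_norm X wt (\<gamma> t) (vector_derivative \<gamma> (at t))) \<partial>lborel)"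

definition cc_dist ::
  "('n::finite \<Rightarrow> 'n vfield) \<Rightarrow> ('n \<Rightarrow> nat) \<Rightarrow> real^'n \<Rightarrow> real^'n \<Rightarrow> ennreal" where
  "cc_dist X wt x y =
     (INF \<gamma> \<in> {\<gamma>. horizontal_curve X wt \<gamma> \<and> \<gamma> 0 = x \<and> \<gamma> 1 = y}. cc_length X wt \<gamma>)"

definition cc_ball ::
  "('n::finite \<Rightarrow> 'n vfield) \<Rightarrow> ('n \<Rightarrow> nat) \<Rightarrow> real^'n \<Rightarrow> real \<Rightarrow> (real^'n) set" where
  "cc_ball X wt x R = {y. cc_dist X wt x y < ennreal R}"

section \<open>Integrals\<close>

definition L1_loc :: "(real^'n::finite \<Rightarrow> real) \<Rightarrow> bool" where
  "L1_loc f \<longleftrightarrow> (\<forall>K. compact K \<longrightarrow> set_integrable lebesgue K f)"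

definition average :: "(real^'n::finite) set \<Rightarrow> (real^'n \<Rightarrow> real) \<Rightarrow> real" where
  "average B f = set_lebesgue_integral lebesgue B f / measure lebesgue B"

text \<open>Real powers on \<open>ennreal\<close>, meant for exponents \<open>a > 0\<close>.\<close>

definition ennpowr :: "ennreal \<Rightarrow> real \<Rightarrow> ennreal" where
  "ennpowr u a = (if u = \<infinity> then \<infinity> else ennreal (enn2real u powr a))"

end

theory Submission
  imports Defs
begin

text \<open>
  Rays \<open>t x\<close> are one-parameter subgroups, so conjugation by a group element is linear in canonical
  coordinates. Differentiating conjugations yields the Lie bracket and the Jacobi identity, whence the
  bracket respects the layers. The left-invariant frame is governed by a linear ODE whose
  coefficients are brackets; by uniqueness it is equivariant under the dilations. Letting the
  dilation factor tend to 0 shows that left translations have Jacobian 1.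
  Chow's argument makes CC balls open, and then all of them are translated and dilated copies of one
  bounded open set.

  For \<open>x\<close> in a ball \<open>B\<close> of radius \<open>R\<close>, points on a horizontal curve of length below \<open>R\<close> from the centre to \<open>x\<close> are
  centres of balls \<open>D_j\<close> inside \<open>B\<close> with radius \<open>r_j = R / 2^j\<close>, \<open>D_0 = B\<close>, shrinking to \<open>x\<close>. With \<open>g\<close> the
  inner integral on the right-hand side, the means of \<open>f\<close> over \<open>D_j\<close> converge to \<open>f x\<close> wherever \<open>g\<close> is finite,
  and consecutive means differ by at most \<open>r_j powr (s - Q)\<close> times the integral of \<open>g\<close> over a ball of
  radius comparable to \<open>r_j\<close> about \<open>x\<close>. Taking \<open>p\<close>-th powers and integrating in \<open>x\<close>, one gets a geometric
  series that converges because \<open>(Q - s) p < Q\<close>.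
\<close>

section \<open>Change of variables for arbitrary finite index types\<close>

text \<open>The same ball stands on both sides, so all auxiliary balls must stay inside
  \<open>B\<close>. Here the length structure of the distance enters: a point that lies a length
  \<open>r_j\<close> before the end of a curve of length below \<open>R\<close> leaves room for a
  ball of radius \<open>r_j\<close>. These balls are chosen separately for each \<open>x\<close>,
  with no control on measurability in \<open>x\<close>. They are therefore replaced by the sets
  \<open>{y. q x y \<le> K * r_j}\<close> before integrating in \<open>x\<close>, which makes Fubini
  available. To take the power \<open>p\<close>, no infinite sum of increments is raised to it:
  weights of total at most 1/2 single out one increment that is large compared with its weight. The
  geometric decay at rate \<open>\<theta> = Q - (Q - s) * p\<close> is halved, one half paying for
  the weights. On the group side no formula for the product is at hand, only smoothness and the
  straight one-parameter subgroups. Dilations act through the frame \<open>V\<close>, which is all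
  that horizontal curves and Jacobians see. In Chow's argument commutators would be parametrised by
  roots of the parameter; the conjugates \<open>h \<otimes> s v \<otimes> - h\<close> are linear in
  \<open>s\<close>, so products of them are differentiable at 0.\<close>

text \<open>
  The library's change of variables formula requires a well-ordered index type. A copy of the
  index type is well-ordered here, and maps are transported to it.
\<close>

typedef ('a::finite) wo = "UNIV :: 'a set" by auto

definition wo_index :: "'a::finite wo \<Rightarrow> nat" where
  "wo_index = (SOME f. inj f)"

lemma inj_wo_index: "inj wo_index"
proof -
  have "finite (UNIV :: 'a wo set)"
  proof (rule finite_surj)
    show "(UNIV :: 'a wo set) \<subseteq> range Abs_wo"
      by (metis Rep_wo_inverse rangeI subsetI)
  qed simp
  then obtain f :: "'a wo \<Rightarrow> nat" where "inj f"
    using finite_imp_inj_to_nat_seg by metis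
  then show ?thesis unfolding wo_index_def by (rule someI[of inj])
qed

instantiation wo :: (finite) "{finite, wellorder}"
begin

definition "a \<le> b \<longleftrightarrow> wo_index a \<le> wo_index b"
definition "a < b \<longleftrightarrow> wo_index a < wo_index b"

instance
proof
  show "finite (UNIV :: 'a wo set)"
  proof (rule finite_surj)
    show "(UNIV :: 'a wo set) \<subseteq> range Abs_wo"
      by (metis Rep_wo_inverse rangeI subsetI)
  qed simp
  fix P and a :: "'a wo"
  assume step: "\<And>x :: 'a wo. (\<And>y. y < x \<Longrightarrow> P y) \<Longrightarrow> P x"
  show "P a"
  proof (induction a rule: measure_induct_rule[of wo_index])
    case (less x)
    show ?case by (rule step, rule less.IH, simp add: less_wo_def)
  qed
qed (auto simp: less_eq_wo_def less_wo_def dest: injD[OF inj_wo_index])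

end

definition to_wo :: "real^'n \<Rightarrow> real^('n::finite wo)" where
  "to_wo x = (\<chi> i. x $ Rep_wo i)"

definition of_wo :: "real^('n wo) \<Rightarrow> real^('n::finite)" where
  "of_wo x = (\<chi> i. x $ Abs_wo i)"

lemma to_of_wo [simp]: "to_wo (of_wo x) = x" "of_wo (to_wo y) = y"
  by (simp_all add: to_wo_def of_wo_def Rep_wo_inverse Abs_wo_inverse)

lemma linear_to_wo: "linear to_wo" and linear_of_wo: "linear of_wo"
  by (auto intro!: linearI simp: to_wo_def of_wo_def vec_eq_iff)

text \<open>Relabelling coordinates carries boxes to boxes with the same side lengths, and
  \<open>lborel\<close> is determined by its values on boxes.\<close>

lemma emeasure_to_wo_vimage:
  assumes "S \<in> sets borel"
  shows "emeasure lborel (to_wo -` S) = emeasure lborel S"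
proof -
  have m: "to_wo \<in> borel_measurable (borel :: (real^'a::finite) measure)"
    by (intro borel_measurable_continuous_onI linear_continuous_on linear_conv_bounded_linear[THEN iffD1] linear_to_wo)
  have "lborel = distr lborel borel (to_wo :: real^'a \<Rightarrow> _)"
  proof (rule lborel_eqI)
    fix l u :: "real^('a wo)"
    assume lu: "\<And>b. b \<in> Basis \<Longrightarrow> l \<bullet> b \<le> u \<bullet> b"
    then have lu': "l $ i \<le> u $ i" for i
      by (metis axis_in_Basis_iff cart_eq_inner_axis Basis_real_def insertI1 one_neq_zero)
    have v: "to_wo -` box l u = box (of_wo l) (of_wo u)"
      by (auto simp: mem_box_cart to_wo_def of_wo_def) (metis Rep_wo_inverse Abs_wo_inverse UNIV_I)+
    have b: "Basis = range (\<lambda>i::'k::finite. axis i (1::real))"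
      by (auto simp: Basis_vec_def)
    have "emeasure (distr lborel borel (to_wo :: real^'a \<Rightarrow> _)) (box l u) = emeasure lborel (box (of_wo l) (of_wo u))"
      using m by (subst emeasure_distr) (auto simp: v)
    also have "\<dots> = (\<Prod>b\<in>Basis. (of_wo u - of_wo l) \<bullet> b)"
      using lu' by (subst emeasure_lborel_box) (auto simp: b inner_axis of_wo_def)
    also have "(\<Prod>b\<in>Basis. (of_wo u - of_wo l) \<bullet> b) = (\<Prod>i\<in>UNIV. u $ Abs_wo i - l $ Abs_wo i)"
      unfolding b by (subst prod.reindex) (auto simp: inj_on_def axis_eq_axis inner_axis of_wo_def)
    also have "\<dots> = (\<Prod>i\<in>UNIV. u $ i - l $ i)"
      by (rule prod.reindex_bij_witness[of _ Rep_wo Abs_wo]) (auto simp: Rep_wo_inverse Abs_wo_inverse)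
    also have "\<dots> = (\<Prod>b\<in>Basis. (u - l) \<bullet> b)"
      unfolding b by (subst prod.reindex) (auto simp: inj_on_def axis_eq_axis inner_axis)
    finally show "emeasure (distr lborel borel to_wo) (box l u) = (\<Prod>b\<in>Basis. (u - l) \<bullet> b)" .
  qed simp
  then have "emeasure lborel S = emeasure (distr lborel borel (to_wo :: real^'a \<Rightarrow> _)) S"
    by simp
  then show ?thesis using m assms by (simp add: emeasure_distr)
qed

text \<open>Taking the determinant in the well-ordered copy makes this literally the Jacobian that
  occurs once a map has been transported by \<open>to_wo\<close> and \<open>of_wo\<close>.\<close>

definition cdet :: "(real^'n \<Rightarrow> real^('n::finite)) \<Rightarrow> real" where
  "cdet L = det (matrix (\<lambda>x. to_wo (L (of_wo x))))"

lemma cdet_compose: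
  assumes "linear L" "linear M"
  shows "cdet (\<lambda>x. L (M x)) = cdet L * cdet M"
proof -
  have "matrix (\<lambda>x. to_wo (L (M (of_wo x)))) =
     matrix (\<lambda>x. to_wo (L (of_wo x))) ** matrix (\<lambda>x. to_wo (M (of_wo x)))"
    using matrix_compose[of "\<lambda>x. to_wo (M (of_wo x))" "\<lambda>x. to_wo (L (of_wo x))"]
      linear_compose[OF linear_of_wo linear_compose[OF assms(1) linear_to_wo]]
      linear_compose[OF linear_of_wo linear_compose[OF assms(2) linear_to_wo]]
    by (simp add: o_def)
  then show ?thesis by (simp add: cdet_def det_mul)
qed

lemma cdet_id [simp]: "cdet (\<lambda>x. x) = 1"
  by (simp add: cdet_def matrix_id_mat_1[unfolded id_def])

lemma cdet_diagonal: "cdet (\<lambda>x. \<chi> i. d i * x $ i) = prod d (UNIV :: 'n::finite set)"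
proof -
  have "cdet (\<lambda>x. \<chi> i. d i * x $ i) = prod (\<lambda>i. d (Rep_wo i)) (UNIV :: 'n wo set)"
    unfolding cdet_def
    by (subst det_diagonal)
       (auto simp: matrix_def to_wo_def of_wo_def axis_def Rep_wo_inverse)
  also have "\<dots> = prod d UNIV"
    by (rule prod.reindex_bij_witness[of _ Abs_wo Rep_wo]) (auto simp: Rep_wo_inverse Abs_wo_inverse)
  finally show ?thesis .
qed

lemma continuous_on_cdet:
  fixes L :: "'a::topological_space \<Rightarrow> real^'n \<Rightarrow> real^('n::finite)"
  assumes "\<And>i. continuous_on S (\<lambda>x. L x (axis i 1))"
  shows "continuous_on S (\<lambda>x. cdet (L x))"
proof -
  have [simp]: "of_wo (axis j 1) = axis (Rep_wo j) 1" for j :: "'n wo"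
    by (auto simp: of_wo_def axis_def vec_eq_iff Abs_wo_inverse Rep_wo_inverse)
  show ?thesis
    by (simp add: cdet_def det_def matrix_def to_wo_def)
       (intro continuous_on_sum continuous_on_mult continuous_on_const continuous_on_prod
          continuous_on_component assms)
qed

text \<open>In the well-ordered copy the Jacobian has constant modulus \<open>c\<close>, so its
  integral over the domain is \<open>c\<close> times the measure. Openness of the set and of its
  image makes both Borel, as the transport of measures requires.\<close>

lemma emeasure_image_cdet:
  fixes f :: "real^'n \<Rightarrow> real^('n::finite)"
  assumes "open S" "bounded S" "open (f ` S)" "inj_on f S"
    and der: "\<And>x. x \<in> S \<Longrightarrow> (f has_derivative f' x) (at x)"
    and det: "\<And>x. x \<in> S \<Longrightarrow> \<bar>cdet (f' x)\<bar> = c"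
  shows "emeasure lebesgue (f ` S) = ennreal c * emeasure lebesgue S"
proof -
  define F where "F = (\<lambda>x. to_wo (f (of_wo x)))"
  define U where "U = of_wo -` S"
  have bl: "bounded_linear to_wo" "bounded_linear of_wo"
    using linear_to_wo linear_of_wo by (auto simp: linear_conv_bounded_linear)
  have img: "F ` U = of_wo -` (f ` S)"
  proof (intro subset_antisym subsetI)
    fix x assume "x \<in> of_wo -` (f ` S)"
    then obtain y where "y \<in> S" "of_wo x = f y" by auto
    then have "x = F (to_wo y)" "to_wo y \<in> U"
      unfolding F_def U_def by (metis to_of_wo(1) to_of_wo(2), simp)
    then show "x \<in> F ` U" by blast
  qed (auto simp: F_def U_def)
  have U: "U = to_wo ` S"
    by (force simp: U_def image_iff)
  have oU: "open U" "open (F ` U)"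
    unfolding img unfolding U_def
    by (intro open_vimage linear_continuous_on bl assms)+
  have bU: "bounded U"
    unfolding U by (intro bounded_linear_image assms bl)
  have lU: "U \<in> lmeasurable"
    using oU bU by (simp add: lmeasurable_open)
  have d: "(F has_derivative (\<lambda>x. to_wo (f' (of_wo u) (of_wo x)))) (at u within U)" if "u \<in> U" for u
  proof -
    have "(f has_derivative f' (of_wo u)) (at (of_wo u))"
      using der that by (simp add: U_def)
    from has_derivative_compose[OF bounded_linear_imp_has_derivative[OF bl(2)] this]
    have "((\<lambda>x. f (of_wo x)) has_derivative (\<lambda>x. f' (of_wo u) (of_wo x))) (at u)" .
    from bounded_linear.has_derivative[OF bl(1) this] show ?thesis
      unfolding F_def by (rule has_derivative_at_withinI)
  qed
  have inj: "inj_on F U"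
  proof (rule inj_onI)
    fix x y assume *: "x \<in> U" "y \<in> U" "F x = F y"
    then have "f (of_wo x) = f (of_wo y)"
      unfolding F_def by (metis to_of_wo(2))
    with * assms(4) have "of_wo x = of_wo y"
      by (auto simp: U_def dest: inj_onD)
    then show "x = y" by (metis to_of_wo(1))
  qed
  have int: "((\<lambda>x. c) has_integral (c * measure lebesgue U)) U"
    using has_integral_mult_right[OF lU[unfolded lmeasurable_iff_has_integral], of c]
    by (subst has_integral_restrict_UNIV[symmetric])
       (simp add: indicator_def of_bool_def if_distrib cong: if_cong)
  have int': "((\<lambda>u. \<bar>det (matrix (\<lambda>x. to_wo (f' (of_wo u) (of_wo x))))\<bar>) has_integral (c * measure lebesgue U)) U"
    by (rule has_integral_eq[OF _ int]) (use det in \<open>auto simp: U_def cdet_def\<close>)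
  have m: "measure lebesgue (F ` U) = c * measure lebesgue U" "F ` U \<in> lmeasurable"
  proof -
    have U: "U \<in> sets lebesgue" using lU by (rule fmeasurableD)
    have ig: "(\<lambda>u. \<bar>det (matrix (\<lambda>x. to_wo (f' (of_wo u) (of_wo x))))\<bar>) integrable_on U"
      using int' by (rule has_integral_integrable)
    show "F ` U \<in> lmeasurable"
      by (rule measurable_differentiable_image_eq[OF U d inj, THEN iffD2, OF _ ig])
    show "measure lebesgue (F ` U) = c * measure lebesgue U"
      by (subst measure_differentiable_image_eq[OF U d inj ig]) (use integral_unique[OF int'] in auto)
  qed
  have *: "emeasure lebesgue V = emeasure lebesgue (of_wo -` V)" if "open V" for V :: "(real^'n) set"
  proof -
    have "of_wo -` V \<in> sets borel"
      by (intro borel_open open_vimage linear_continuous_on bl that)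
    moreover have "to_wo -` (of_wo -` V) = V" by auto
    ultimately show ?thesis
      using emeasure_to_wo_vimage[of "of_wo -` V"] that by simp
  qed
  show ?thesis
  \<comment> \<open>Only a point of \<open>S\<close> forces \<open>c\<close> to be nonnegative, so
    the empty set is treated apart.\<close>
  proof (cases "S = {}")
    case False
    then have "c \<ge> 0" using det by force
    then show ?thesis
      using * [OF assms(1), folded U_def] * [OF assms(3), folded img] m lU
      by (simp add: emeasure_eq_measure2 ennreal_mult)
  qed simp
qed

section \<open>Left-invariant fields and one-parameter subgroups\<close>

lemma C_diff_1: "C_diff (Suc 0) f \<Longrightarrow> f differentiable (at x)"
  by simp

lemma vector_derivative_unique_unit_interval:
  assumes "t \<in> {0..1::real}" "(f has_vector_derivative f') (at t within {0..1})"
    "(f has_vector_derivative f'') (at t within {0..1})"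
  shows "f' = f''"
  using vector_derivative_unique_within_closed_interval[of 0 1 t f f' f''] assms
  by (simp add: cbox_interval)

context carnot_group
begin

lemma mult_assoc': "x \<otimes> y \<otimes> z = x \<otimes> (y \<otimes> z)"
  using m_assoc carrier_UNIV by simp

lemma zero_mult [simp]: "0 \<otimes> x = x" "x \<otimes> 0 = x"
  using l_one[of x] r_one[of x] carrier_UNIV one_zero by simp_all

lemma inv_mult [simp]: "inv x \<otimes> x = 0" "x \<otimes> inv x = 0"
  using l_inv[of x] r_inv[of x] carrier_UNIV one_zero by simp_all

lemma inv_mult_left [simp]: "inv x \<otimes> (x \<otimes> y) = y" "x \<otimes> (inv x \<otimes> y) = y"
  by (simp_all flip: mult_assoc')

lemma mult_left_cancel [simp]: "x \<otimes> y = x \<otimes> z \<longleftrightarrow> y = z"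
  by (metis inv_mult_left(1))

definition D :: "(real^'n) \<times> (real^'n) \<Rightarrow> (real^'n) \<times> (real^'n) \<Rightarrow> real^'n" where
  "D z = frechet_derivative (\<lambda>z. fst z \<otimes> snd z) (at z)"

text \<open>The left-invariant frame, indexed by the value at the identity: \<open>V v x\<close> is
  the differential at 0 of left translation by \<open>x\<close>, applied to
  \<open>v\<close>.\<close>

definition V :: "real^'n \<Rightarrow> real^'n \<Rightarrow> real^'n" where
  "V v x = D (x, 0) (0, v)"

lemma has_derivative_D: "((\<lambda>z. fst z \<otimes> snd z) has_derivative D z) (at z)"
  unfolding D_def by (rule frechet_derivative_works[THEN iffD1, OF C_diff_1])
    (rule smooth_mult[unfolded smooth_map_def, rule_format])

lemma differentiable_D: "(\<lambda>z. D z v) differentiable (at z)"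
  unfolding D_def
  using smooth_mult[unfolded smooth_map_def, rule_format, of "Suc (Suc 0)"] by (simp del: split_paired_All)

lemma bounded_linear_D: "bounded_linear (D z)"
  using has_derivative_D by (rule has_derivative_bounded_linear)

lemma linear_D: "linear (D z)"
  using bounded_linear_D by (rule bounded_linear.linear)

lemma mult_has_derivative:
  assumes "(a has_derivative a') (at t within S)" "(b has_derivative b') (at t within S)"
  shows "((\<lambda>t. a t \<otimes> b t) has_derivative (\<lambda>h. D (a t, b t) (a' h, b' h))) (at t within S)"
  using has_derivative_compose[OF has_derivative_Pair[OF assms] has_derivative_D]
  by simp

lemma mult_has_vector_derivative:
  assumes "(a has_vector_derivative a') (at t within S)" "(b has_vector_derivative b') (at t within S)"
  shows "((\<lambda>t. a t \<otimes> b t) has_vector_derivative D (a t, b t) (a', b')) (at t within S)"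
proof -
  have "D (a t, b t) (h *\<^sub>R a', h *\<^sub>R b') = h *\<^sub>R D (a t, b t) (a', b')" for h
    using linear_scale[OF linear_D, of "(a t, b t)" h "(a', b')"] by simp
  with mult_has_derivative[OF assms[unfolded has_vector_derivative_def]] show ?thesis
    by (simp add: has_vector_derivative_def)
qed

lemma left_mult_has_derivative: "((\<lambda>y. x \<otimes> y) has_derivative (\<lambda>w. D (x, y) (0, w))) (at y)"
  using mult_has_derivative[OF has_derivative_const has_derivative_ident] by simp

lemma left_mult_has_vector_derivative:
  assumes "(b has_vector_derivative b') (at t within S)"
  shows "((\<lambda>t. x \<otimes> b t) has_vector_derivative D (x, b t) (0, b')) (at t within S)"
  using mult_has_vector_derivative[OF has_vector_derivative_const assms] by simp

lemma continuous_on_mult_group [continuous_intros]: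
  assumes "continuous_on S f" "continuous_on S g"
  shows "continuous_on S (\<lambda>x. f x \<otimes> g x)"
proof -
  have "continuous_on UNIV (\<lambda>z. fst z \<otimes> snd z)"
    using smooth_mult unfolding smooth_map_def by (metis C_diff.simps(1))
  from continuous_on_compose2[OF this continuous_on_Pair[OF assms]] show ?thesis
    by simp
qed

lemma linear_V: "linear (\<lambda>v. V v x)"
  unfolding V_def
  by (rule linear_compose[OF _ linear_D, unfolded o_def]) (auto intro!: linearI)

lemmas V_linear = linear_add[OF linear_V] linear_scale[OF linear_V] linear_0[OF linear_V]
  linear_diff[OF linear_V] linear_neg[OF linear_V] linear_sum[OF linear_V]

lemma left_mult_has_derivative_0: "((\<lambda>y. x \<otimes> y) has_derivative (\<lambda>w. V w x)) (at 0)"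
  unfolding V_def by (rule left_mult_has_derivative)

lemma V_at_0 [simp]: "V v 0 = v"
  using has_derivative_unique[OF left_mult_has_derivative_0[of 0, simplified] has_derivative_ident]
  by metis

lemma V_left_invariant: "D (x, y) (0, V v y) = V v (x \<otimes> y)"
proof -
  have "((\<lambda>z. x \<otimes> (y \<otimes> z)) has_derivative (\<lambda>w. D (x, y) (0, V w y))) (at 0)"
    using has_derivative_compose[OF left_mult_has_derivative_0[of y], of "\<lambda>z. x \<otimes> z"]
      left_mult_has_derivative[of x y] by simp
  from has_derivative_unique[OF this left_mult_has_derivative_0[of "x \<otimes> y", unfolded mult_assoc']]
  show ?thesis by metis
qed

text \<open>The quotient \<open>a t \<otimes> inv (b t)\<close> is constant. At a time
  \<open>\<tau>\<close>, left translation by \<open>inv c\<close> moves \<open>a\<close> so that it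
  meets \<open>b\<close> with the same velocity, by left invariance; hence the translated quotient
  has the same derivative as \<open>b t \<otimes> inv (b t)\<close>, which is 0.\<close>

lemma integral_curve_unique:
  assumes a: "\<And>t. t \<in> {0..1} \<Longrightarrow> (a has_vector_derivative V v (a t)) (at t within {0..1})"
    and b: "\<And>t. t \<in> {0..1} \<Longrightarrow> (b has_vector_derivative V v (b t)) (at t within {0..1})"
    and ab: "a 0 = b 0"
  shows "a 1 = b 1"
proof -
  have z: "((\<lambda>t. a t \<otimes> inv (b t)) has_vector_derivative 0) (at \<tau> within {0..1})"
    if \<tau>: "\<tau> \<in> {0..1}" for \<tau> :: real
  proof -
    define c where "c = a \<tau> \<otimes> inv (b \<tau>)"
    have c: "inv c \<otimes> a \<tau> = b \<tau>"
    proof -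
      have "c \<otimes> b \<tau> = a \<tau>" by (simp add: c_def mult_assoc')
      then show ?thesis by (metis inv_mult_left(1))
    qed
    have a': "((\<lambda>t. inv c \<otimes> a t) has_vector_derivative V v (b \<tau>)) (at \<tau> within {0..1})"
      using left_mult_has_vector_derivative[OF a[OF \<tau>], of "inv c"]
      by (simp add: V_left_invariant c)
    have "(\<lambda>x. inv x) differentiable (at (b \<tau>))"
      using smooth_inv unfolding smooth_map_def by (metis C_diff_1)
    then obtain d where d: "((\<lambda>x. inv x) has_derivative d) (at (b \<tau>))"
      by (auto simp: differentiable_def)
    have i: "((\<lambda>t. inv (b t)) has_vector_derivative d (V v (b \<tau>))) (at \<tau> within {0..1})"
      using vector_derivative_diff_chain_within[OF b[OF \<tau>] has_derivative_at_withinI[OF d]]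
      by (simp add: o_def)
    have "((\<lambda>t. b t \<otimes> inv (b t)) has_vector_derivative
        D (b \<tau>, inv (b \<tau>)) (V v (b \<tau>), d (V v (b \<tau>)))) (at \<tau> within {0..1})"
      by (rule mult_has_vector_derivative[OF b[OF \<tau>] i])
    moreover have "((\<lambda>t. b t \<otimes> inv (b t)) has_vector_derivative 0) (at \<tau> within {0..1})"
      by simp
    ultimately have 0: "D (b \<tau>, inv (b \<tau>)) (V v (b \<tau>), d (V v (b \<tau>))) = 0"
      by (rule vector_derivative_unique_unit_interval[OF \<tau>])
    have "((\<lambda>t. inv c \<otimes> a t \<otimes> inv (b t)) has_vector_derivative 0) (at \<tau> within {0..1})"
      using mult_has_vector_derivative[OF a' i] by (simp add: c 0)
    from left_mult_has_vector_derivative[OF this, of c]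
    show ?thesis using linear_0[OF linear_D] by (simp add: mult_assoc' zero_prod_def)
  qed
  obtain e where e: "\<And>t. t \<in> {0..1} \<Longrightarrow> a t \<otimes> inv (b t) = e"
    using has_vector_derivative_zero_constant[OF _ z] by auto
  have "a 1 \<otimes> inv (b 1) = a 0 \<otimes> inv (b 0)"
    using e[of 0] e[of 1] by simp
  also have "\<dots> = 0" by (simp add: ab)
  finally have "a 1 \<otimes> inv (b 1) \<otimes> b 1 = b 1" by simp
  then show ?thesis by (simp add: mult_assoc')
qed

lemma X_eq_V_X0: "X i x = V (X i 0) x"
proof -
  have "X i \<in> vf_span (range X)"
    unfolding vf_span_def by (rule CollectI, rule exI[of _ 1], rule exI[of _ "\<lambda>_. 1"], rule exI[of _ "\<lambda>_. X i"]) auto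
  then have "frechet_derivative (\<lambda>z. x \<otimes> z) (at 0) (X i 0) = X i (x \<otimes> 0)"
    unfolding X_spans left_invariant_fields_def by blast
  then show ?thesis
    using fun_cong[OF frechet_derivative_at[OF left_mult_has_derivative_0[of x]], of "X i 0"] by simp
qed

text \<open>If \<open>\<gamma> x\<close> is the integral curve ending at \<open>x\<close>, then
  slowing it down by the factor \<open>t\<close> gives the integral curve for
  \<open>t *\<^sub>R x\<close>; comparing end points, \<open>\<gamma> x t = t *\<^sub>R x\<close>.
  So the curves are straight, and their velocity at time 0 shows that \<open>E\<close> is the
  identity.\<close>

lemma V_ray_aux:
  fixes x :: "real^'n"
  defines "E \<equiv> \<lambda>x. \<Sum>i\<in>UNIV. x $ i *\<^sub>R X i 0"
  shows "E x = x" and "t \<in> {0..1} \<Longrightarrow> V x (t *\<^sub>R x) = x"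
proof -
  have lin: "E (t *\<^sub>R x) = t *\<^sub>R E x" for t x
    by (simp add: E_def scaleR_sum_right)
  have "(\<Sum>i\<in>UNIV. (x $ i) *\<^sub>R X i y) = V (E x) y" for x y
    unfolding E_def by (subst X_eq_V_X0) (simp add: V_linear)
  then have "\<forall>x. \<exists>\<gamma>. \<gamma> 0 = 0 \<and> \<gamma> 1 = x \<and>
       (\<forall>t\<in>{0..1}. (\<gamma> has_vector_derivative V (E x) (\<gamma> t)) (at t within {0..1}))"
    using canonical_coordinates unfolding is_exp_def by simp
  then obtain \<gamma> where \<gamma>: "\<And>x. \<gamma> x 0 = 0" "\<And>x. \<gamma> x 1 = x"
    "\<And>x t. t \<in> {0..1} \<Longrightarrow> (\<gamma> x has_vector_derivative V (E x) (\<gamma> x t)) (at t within {0..1})"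
    by metis
  have ray: "\<gamma> x t = t *\<^sub>R x" if t: "t \<in> {0..1}" for t
  proof -
    have "((\<lambda>s. \<gamma> x (t * s)) has_vector_derivative V (E (t *\<^sub>R x)) (\<gamma> x (t * s))) (at s within {0..1})"
      if s: "s \<in> {0..1}" for s
    proof -
      have "(\<lambda>s. t * s) ` {0..1} \<subseteq> {0..1}"
        using t by (auto simp: mult_le_one)
      moreover have "t * s \<in> {0..1}" using s t by (auto simp: mult_le_one)
      ultimately have "(\<gamma> x has_vector_derivative V (E x) (\<gamma> x (t * s))) (at (t * s) within (\<lambda>s. t * s) ` {0..1})"
        using \<gamma>(3) has_vector_derivative_within_subset by blast
      moreover have "((\<lambda>s. t * s) has_vector_derivative t) (at s within {0..1})"
        by (auto intro!: derivative_eq_intros)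
      ultimately show ?thesis
        using vector_diff_chain_within[of "\<lambda>s. t * s" t s "{0..1}" "\<gamma> x"] 
        by (simp add: o_def lin V_linear)
    qed
    from integral_curve_unique[of "\<lambda>s. \<gamma> x (t * s)" "E (t *\<^sub>R x)" "\<gamma> (t *\<^sub>R x)", OF this \<gamma>(3)] \<gamma>(1,2)
    show ?thesis by simp
  qed
  have V: "V (E x) (t *\<^sub>R x) = x" if t: "t \<in> {0..1}" for t
  proof -
    have "((\<lambda>t. t *\<^sub>R x) has_vector_derivative V (E x) (\<gamma> x t)) (at t within {0..1})"
      by (rule has_vector_derivative_transform[OF t _ \<gamma>(3)[OF t]]) (simp add: ray)
    moreover have "((\<lambda>t. t *\<^sub>R x) has_vector_derivative x) (at t within {0..1})"
      by (auto intro!: derivative_eq_intros)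
    ultimately have "V (E x) (\<gamma> x t) = x"
      by (rule vector_derivative_unique_unit_interval[OF t])
    then show ?thesis by (simp add: ray[OF t])
  qed
  from V[of 0] show E: "E x = x" by simp
  show "V x (t *\<^sub>R x) = x" if "t \<in> {0..1}"
    using V[OF that] by (simp add: E)
qed

lemma X_eq_V: "X i = V (axis i 1)"
proof -
  have "(\<Sum>j\<in>UNIV. axis i 1 $ j *\<^sub>R X j 0) = X i 0"
    by (subst sum.remove[of _ i]) (auto simp: axis_def intro!: sum.neutral)
  then show ?thesis
    using V_ray_aux(1)[of "axis i 1"] by (intro ext) (subst X_eq_V_X0, simp)
qed

lemma V_ray: "V x (t *\<^sub>R x) = x"
proof (cases "t = 0")
  case False
  have "V (t *\<^sub>R x) (1 *\<^sub>R (t *\<^sub>R x)) = t *\<^sub>R x"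
    by (rule V_ray_aux) auto
  with False show ?thesis by (simp add: V_linear)
qed simp

lemma ray_has_vector_derivative:
  "((\<lambda>t. t *\<^sub>R x) has_vector_derivative V x (t *\<^sub>R x)) (at t within S)"
  by (auto intro!: derivative_eq_intros simp: V_ray)

lemma left_ray_has_vector_derivative:
  "((\<lambda>t. y \<otimes> t *\<^sub>R x) has_vector_derivative V x (y \<otimes> t *\<^sub>R x)) (at t within S)"
  using left_mult_has_vector_derivative[OF ray_has_vector_derivative, of y] by (simp add: V_left_invariant)

lemma integral_curve_eq:
  assumes a: "\<And>t. (a has_vector_derivative V v (a t)) (at t)"
  shows "a 1 = a 0 \<otimes> v"
proof -
  have "a 1 = a 0 \<otimes> (1::real) *\<^sub>R v"
    by (rule integral_curve_unique[of a v "\<lambda>t. a 0 \<otimes> t *\<^sub>R v"])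
       (auto intro: left_ray_has_vector_derivative has_vector_derivative_at_within[OF a])
  then show ?thesis by simp
qed

text \<open>The straight curve from \<open>s *\<^sub>R x\<close> with velocity
  \<open>t *\<^sub>R x\<close> runs inside the line of \<open>x\<close>, where \<open>V_ray\<close>
  makes it an integral curve of \<open>V (t *\<^sub>R x)\<close>; its end point is therefore the
  product.\<close>

lemma ray_mult: "s *\<^sub>R x \<otimes> t *\<^sub>R x = (s + t) *\<^sub>R x"
proof -
  have *: "V (t *\<^sub>R x) (s *\<^sub>R x + r *\<^sub>R t *\<^sub>R x) = t *\<^sub>R x" for r
    using V_ray[of x "s + r * t"] by (simp add: V_linear scaleR_left.add)
  have "((\<lambda>r. s *\<^sub>R x + r *\<^sub>R t *\<^sub>R x) has_vector_derivative V (t *\<^sub>R x) (s *\<^sub>R x + r *\<^sub>R t *\<^sub>R x)) (at r)" for r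
    unfolding * by (auto intro!: derivative_eq_intros)
  from integral_curve_eq[OF this] show ?thesis by (simp add: scaleR_left.add)
qed

lemma inv_eq_uminus [simp]: "inv x = - x"
proof -
  have "x \<otimes> - x = 0"
    using ray_mult[of 1 x "-1"] by simp
  then show ?thesis by (metis inv_mult_left(1) zero_mult(2))
qed

lemma mult_uminus [simp]: "x \<otimes> (- x) = 0" "(- x) \<otimes> x = 0"
  "x \<otimes> (- x \<otimes> y) = y" "- x \<otimes> (x \<otimes> y) = y"
  using inv_mult[of x] inv_mult_left[of x] by simp_all

lemma uminus_mult: "- (x \<otimes> y) = - y \<otimes> - x"
proof -
  have "x \<otimes> y \<otimes> (- y \<otimes> - x) = 0"
    by (simp add: mult_assoc')
  also have "\<dots> = x \<otimes> y \<otimes> - (x \<otimes> y)"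
    by (rule mult_uminus(1)[symmetric])
  finally show ?thesis by (simp only: mult_left_cancel)
qed

end

section \<open>The Lie bracket and the grading\<close>

text \<open>Gronwall: with a bound \<open>K\<close> for \<open>T\<close>, the squared norm of
  \<open>e\<close> times \<open>exp (- 2 * K * t)\<close> does not increase.\<close>

lemma linear_ode_zero:
  fixes e :: "real \<Rightarrow> 'a::real_inner"
  assumes T: "bounded_linear T" and e: "\<And>t. (e has_vector_derivative T (e t)) (at t)" and "e 0 = 0"
  shows "e 1 = 0"
proof -
  obtain K where K: "\<And>x. norm (T x) \<le> norm x * K"
    using bounded_linear.bounded[OF T] by blast
  define \<phi> where "\<phi> t = (e t \<bullet> e t) * exp (- 2 * K * t)" for t
  have "\<phi> 1 \<le> \<phi> 0"
  proof (rule DERIV_nonpos_imp_nonincreasing[of 0 1 \<phi>])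
    fix t :: real
    have "(\<phi> has_real_derivative (2 * (e t \<bullet> T (e t)) - 2 * K * (e t \<bullet> e t)) * exp (- 2 * K * t)) (at t)"
      unfolding \<phi>_def has_real_derivative_iff_has_vector_derivative
      using e[of t] unfolding has_vector_derivative_def
      by (auto intro!: derivative_eq_intros simp: fun_eq_iff algebra_simps inner_commute)
    moreover have "e t \<bullet> T (e t) \<le> K * (e t \<bullet> e t)"
    proof -
      have "e t \<bullet> T (e t) \<le> norm (e t) * norm (T (e t))" by (rule norm_cauchy_schwarz)
      also have "\<dots> \<le> norm (e t) * (norm (e t) * K)" by (intro mult_left_mono K) simp
      finally show ?thesis by (simp add: power2_norm_eq_inner[symmetric] power2_eq_square mult_ac)
    qed
    ultimately show "\<exists>y. (\<phi> has_real_derivative y) (at t) \<and> y \<le> 0"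
      by (intro exI conjI) (auto simp: mult_nonpos_nonneg)
  qed simp
  then show ?thesis
    using assms(3) inner_ge_zero[of "e 1"] by (simp add: \<phi>_def mult_le_0_iff order_antisym)
qed

lemma vf_span_superset: "f \<in> S \<Longrightarrow> f \<in> vf_span S"
  unfolding vf_span_def
  by (rule CollectI, rule exI[of _ 1], rule exI[of _ "\<lambda>_. 1"], rule exI[of _ "\<lambda>_. f"]) auto

lemma has_vector_derivative_at_unique: "(f has_vector_derivative a) (at t) \<Longrightarrow> (f has_vector_derivative b) (at t) \<Longrightarrow> a = b"
  using vector_derivative_at by blast

context carnot_group
begin

section \<open>Conjugations and the bracket that they generate\<close>

lemma D_fst [simp]: "D (x, 0) (w, 0) = w"
proof -
  have "((\<lambda>y. y \<otimes> 0) has_derivative (\<lambda>w. D (x, 0) (w, 0))) (at x)"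
    by (rule mult_has_derivative[OF has_derivative_ident has_derivative_const])
  from has_derivative_unique[OF this[simplified] has_derivative_ident] show ?thesis by metis
qed

lemma D_split: "D (x, 0) (a, b) = a + V b x"
  using linear_add[OF linear_D, of "(x, 0)" "(a, 0)" "(0, b)"] by (simp add: V_def)

text \<open>In canonical coordinates this is both the inner automorphism and the adjoint action
  \<open>Ad h\<close> on the Lie algebra.\<close>

definition conj_by :: "real^'n \<Rightarrow> real^'n \<Rightarrow> real^'n" where
  "conj_by h y = h \<otimes> y \<otimes> - h"

lemma conj_by_mult: "conj_by h (x \<otimes> y) = conj_by h x \<otimes> conj_by h y"
  and conj_by_compose: "conj_by g (conj_by h y) = conj_by (g \<otimes> h) y"
  and conj_by_0 [simp]: "conj_by 0 y = y" "conj_by h 0 = 0"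
  by (simp_all add: conj_by_def mult_assoc' uminus_mult)

text \<open>With \<open>d\<close> the derivative at 0, the homomorphism property turns the image of
  the ray of \<open>y\<close> into an integral curve of \<open>V (d y)\<close> through 0. It ends at
  \<open>d y\<close>, so conjugation coincides with its own derivative.\<close>

lemma bounded_linear_conj_by: "bounded_linear (conj_by h)"
proof -
  have *: "((\<lambda>y. h \<otimes> y \<otimes> - h) has_derivative
    (\<lambda>w. D (h \<otimes> 0, - h) (D (h, 0) (0, w), 0))) (at 0)"
    by (rule mult_has_derivative[OF left_mult_has_derivative has_derivative_const])
  define d where "d = (\<lambda>w. D (h \<otimes> 0, - h) (D (h, 0) (0, w), 0))"
  have d: "(conj_by h has_derivative d) (at 0)"
    using * unfolding conj_by_def d_def by (simp add: fun_eq_iff)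
  have "conj_by h y = d y" for y
  proof -
    have "((\<lambda>r. conj_by h (r *\<^sub>R y)) has_vector_derivative V (d y) (conj_by h (t *\<^sub>R y))) (at t)" for t
    proof -
      have shift: "(\<lambda>r. conj_by h (r *\<^sub>R y)) = (\<lambda>r. conj_by h (t *\<^sub>R y) \<otimes> conj_by h ((r - t) *\<^sub>R y))"
        by (simp add: ray_mult flip: conj_by_mult)
      have "((\<lambda>r. conj_by h ((r - t) *\<^sub>R y)) has_vector_derivative d y) (at t)"
      proof -
        have "((\<lambda>r. (r - t) *\<^sub>R y) has_vector_derivative y) (at t)"
          by (auto intro!: derivative_eq_intros)
        from vector_derivative_diff_chain_within[OF this, of "conj_by h" d] d show ?thesis
          by (simp add: o_def has_derivative_at_withinI)
      qed
      from left_mult_has_vector_derivative[OF this, of "conj_by h (t *\<^sub>R y)"]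
      show ?thesis
        by (subst shift) (simp add: V_def)
    qed
    from integral_curve_eq[OF this] show ?thesis by simp
  qed
  then have "conj_by h = d" by auto
  with d show ?thesis by (metis has_derivative_bounded_linear)
qed

lemmas conj_by_linear = linear_add[OF bounded_linear.linear[OF bounded_linear_conj_by]]
  linear_scale[OF bounded_linear.linear[OF bounded_linear_conj_by]]

text \<open>The first Taylor coefficient of the frame at 0: \<open>V v w = v + B v w + ...\<close>,
  which is half the Lie bracket of \<open>w\<close> and \<open>v\<close>.\<close>

definition B :: "real^'n \<Rightarrow> real^'n \<Rightarrow> real^'n" where
  "B v w = frechet_derivative (V v) (at 0) w"

lemma V_differentiable: "V v differentiable (at x)"
proof -
  have "(\<lambda>z. D z (0, v)) \<circ> (\<lambda>x. (x, 0)) differentiable (at x)"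
    by (intro differentiable_chain_at differentiable_D differentiable_Pair) auto
  then show ?thesis by (simp add: o_def V_def[abs_def])
qed

lemma V_has_derivative_0: "(V v has_derivative B v) (at 0)"
  unfolding B_def using V_differentiable frechet_derivative_works by blast

lemma continuous_on_V [continuous_intros]: "continuous_on S g \<Longrightarrow> continuous_on S (\<lambda>x. V v (g x))"
proof -
  have "continuous_on UNIV (V v)"
    by (intro differentiable_imp_continuous_on differentiable_at_imp_differentiable_on) (simp add: V_differentiable)
  then show "continuous_on S g \<Longrightarrow> continuous_on S (\<lambda>x. V v (g x))"
    by (rule continuous_on_compose2) auto
qed

lemma bilinear_B: "bilinear B"
proof -
  have "B (u + v) = (\<lambda>w. B u w + B v w)" for u v
  proof -
    have "V (u + v) = (\<lambda>x. V u x + V v x)"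
      by (simp add: fun_eq_iff V_linear)
    then have "(V (u + v) has_derivative (\<lambda>w. B u w + B v w)) (at 0)"
      using has_derivative_add[OF V_has_derivative_0[of u] V_has_derivative_0[of v]] by simp
    with V_has_derivative_0 show ?thesis by (rule has_derivative_unique)
  qed
  moreover have "B (c *\<^sub>R u) = (\<lambda>w. c *\<^sub>R B u w)" for c u
  proof -
    have "V (c *\<^sub>R u) = (\<lambda>x. c *\<^sub>R V u x)"
      by (simp add: fun_eq_iff V_linear)
    then have "(V (c *\<^sub>R u) has_derivative (\<lambda>w. c *\<^sub>R B u w)) (at 0)"
      using has_derivative_scaleR_right[OF V_has_derivative_0[of u], of c] by simp
    with V_has_derivative_0 show ?thesis by (rule has_derivative_unique)
  qed
  moreover have "linear (B v)" for v
    using has_derivative_linear[OF V_has_derivative_0] .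
  ultimately show ?thesis
    unfolding bilinear_def by (auto intro: linearI)
qed

lemma V_ray_0_has_vector_derivative:
  "((\<lambda>t. V u (t *\<^sub>R w)) has_vector_derivative B u w) (at 0)"
proof -
  have "((\<lambda>t. t *\<^sub>R w) has_vector_derivative w) (at 0)"
    by (auto intro!: derivative_eq_intros)
  from vector_derivative_diff_chain_within[OF this, of "V u" "B u"] V_has_derivative_0 show ?thesis
    by (simp add: o_def has_derivative_at_withinI)
qed

text \<open>By \<open>V_ray\<close> the field \<open>V u\<close> is constant along the ray of
  \<open>u\<close>.\<close>

lemma B_diag: "B u u = 0"
  using has_vector_derivative_at_unique[OF V_ray_0_has_vector_derivative[of u u]] by (simp add: V_ray)

lemma B_antisym: "B u v = - B v u"
proof -
  have "B (u + v) (u + v) = B u v + B v u"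
    unfolding bilinear_ladd[OF bilinear_B] bilinear_radd[OF bilinear_B] by (simp add: B_diag)
  then have "B u v + B v u = 0" by (metis B_diag)
  then show ?thesis by (rule eq_neg_iff_add_eq_0[THEN iffD2])
qed

text \<open>The Lie bracket of \<open>V u\<close> and \<open>V v\<close> at 0 is
  \<open>B v u - B u v\<close>; antisymmetry of \<open>B\<close> reduces it to this
  expression.\<close>

definition bracket :: "real^'n \<Rightarrow> real^'n \<Rightarrow> real^'n" where
  "bracket u v = 2 *\<^sub>R B v u"

lemma lie_bracket_V_0: "lie_bracket (V u) (V v) 0 = bracket u v"
  using B_antisym[of u v] by (simp add: lie_bracket_def bracket_def scaleR_2 flip: B_def)

lemma bilinear_bracket: "bilinear bracket"
  unfolding bilinear_def bracket_def
  by (auto intro!: linearI simp: bilinear_ladd[OF bilinear_B] bilinear_radd[OF bilinear_B]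
      bilinear_lmul[OF bilinear_B] bilinear_rmul[OF bilinear_B] scaleR_add_right)

lemma bounded_bilinear_bracket: "bounded_bilinear bracket"
  using bilinear_bracket bilinear_conv_bounded_bilinear by blast

lemmas bracket_linear = bilinear_ladd[OF bilinear_bracket] bilinear_radd[OF bilinear_bracket]
  bilinear_lmul[OF bilinear_bracket] bilinear_rmul[OF bilinear_bracket] bilinear_lzero[OF bilinear_bracket]
  bilinear_rzero[OF bilinear_bracket] bilinear_lneg[OF bilinear_bracket] bilinear_rneg[OF bilinear_bracket]
  bilinear_lsub[OF bilinear_bracket] bilinear_rsub[OF bilinear_bracket]

text \<open>This is the identity saying that \<open>ad\<close> is the derivative of
  \<open>Ad\<close>. The derivative \<open>A v\<close> is found first in terms of the frame at the
  points \<open>v\<close> and \<open>- v\<close>; being homogeneous in \<open>v\<close>, it equals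
  its own derivative along the ray of \<open>v\<close>, where only \<open>B\<close>
  survives.\<close>

lemma conj_by_ray_has_vector_derivative:
  "((\<lambda>t. conj_by (t *\<^sub>R u) v) has_vector_derivative bracket u v) (at 0)"
proof -
  define A where "A v = V u (- v) - V u v" for v
  have A: "((\<lambda>t. conj_by (t *\<^sub>R u) v) has_vector_derivative A v) (at 0)" for v
  proof -
    \<comment> \<open>Inversion is negation, so right translation by \<open>v\<close> is left
      translation by \<open>- v\<close> between two negations; this gives the velocity of
      \<open>t *\<^sub>R u \<otimes> v\<close>.\<close>
    have "((\<lambda>t. - (- v \<otimes> t *\<^sub>R - u)) has_vector_derivative - V (- u) (- v \<otimes> 0 *\<^sub>R - u)) (at 0)"
      by (rule has_vector_derivative_minus[OF left_ray_has_vector_derivative])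
    then have 1: "((\<lambda>t. t *\<^sub>R u \<otimes> v) has_vector_derivative V u (- v)) (at 0)"
      by (simp add: uminus_mult V_linear)
    have 2: "((\<lambda>t. - (t *\<^sub>R u)) has_vector_derivative - u) (at 0)"
      by (auto intro!: derivative_eq_intros)
    from mult_has_vector_derivative[OF 1 2] show ?thesis
      by (simp add: conj_by_def A_def D_split V_linear)
  qed
  \<comment> \<open>Linearity of each conjugation passes to the derivative in
    \<open>t\<close>.\<close>
  have "A (s *\<^sub>R v) = s *\<^sub>R A v" for s
  proof -
    have "((\<lambda>t. s *\<^sub>R conj_by (t *\<^sub>R u) v) has_vector_derivative s *\<^sub>R A v) (at 0)"
      by (rule bounded_linear.has_vector_derivative[OF bounded_linear_scaleR_right A])
    with A[of "s *\<^sub>R v"] show ?thesis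
      by (auto simp: conj_by_linear intro: has_vector_derivative_at_unique)
  qed
  then have "((\<lambda>s. s *\<^sub>R A v) has_vector_derivative B u (- v) - B u v) (at 0)"
    using has_vector_derivative_diff[OF V_ray_0_has_vector_derivative[of u "- v"] V_ray_0_has_vector_derivative[of u v]]
    by (simp add: A_def)
  moreover have "((\<lambda>s. s *\<^sub>R A v) has_vector_derivative A v) (at 0)"
    by (auto intro!: derivative_eq_intros)
  ultimately have "A v = B u (- v) - B u v"
    using has_vector_derivative_at_unique by blast
  also have "\<dots> = bracket u v"
    using B_antisym[of u v] by (simp add: bracket_def bilinear_rneg[OF bilinear_B] scaleR_2)
  finally have "A v = bracket u v" .
  with A[of v] show ?thesis by simp
qed

text \<open>Conjugation by \<open>h\<close> turns conjugation by \<open>t *\<^sub>R u\<close> into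
  conjugation by \<open>t *\<^sub>R conj_by h u\<close>; the claim is the derivative of this at
  \<open>t = 0\<close>.\<close>

lemma conj_by_bracket: "conj_by h (bracket u v) = bracket (conj_by h u) (conj_by h v)"
proof -
  have "((\<lambda>t. conj_by h (conj_by (t *\<^sub>R u) v)) has_vector_derivative conj_by h (bracket u v)) (at 0)"
    by (rule bounded_linear.has_vector_derivative[OF bounded_linear_conj_by conj_by_ray_has_vector_derivative])
  moreover have "conj_by h (conj_by (t *\<^sub>R u) v) = conj_by (t *\<^sub>R conj_by h u) (conj_by h v)" for t
  proof -
    have "conj_by (t *\<^sub>R conj_by h u) (conj_by h v) = conj_by (conj_by h (t *\<^sub>R u) \<otimes> h) v"
      by (simp add: conj_by_compose conj_by_linear)
    also have "conj_by h (t *\<^sub>R u) \<otimes> h = h \<otimes> t *\<^sub>R u"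
      by (simp add: conj_by_def mult_assoc')
    finally show ?thesis by (simp add: conj_by_compose)
  qed
  ultimately show ?thesis
    using conj_by_ray_has_vector_derivative[of "conj_by h u" "conj_by h v"] has_vector_derivative_at_unique by auto
qed

lemma jacobi: "bracket w (bracket u v) = bracket (bracket w u) v + bracket u (bracket w v)"
proof -
  have "((\<lambda>t. bracket (conj_by (t *\<^sub>R w) u) (conj_by (t *\<^sub>R w) v)) has_vector_derivative
      (bracket (conj_by (0 *\<^sub>R w) u) (bracket w v) + bracket (bracket w u) (conj_by (0 *\<^sub>R w) v))) (at 0)"
    by (rule bounded_bilinear.has_vector_derivative[OF bounded_bilinear_bracket])
       (rule conj_by_ray_has_vector_derivative)+
  then have "((\<lambda>t. conj_by (t *\<^sub>R w) (bracket u v)) has_vector_derivative (bracket u (bracket w v) + bracket (bracket w u) v)) (at 0)"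
    by (simp add: conj_by_bracket)
  from has_vector_derivative_at_unique[OF this conj_by_ray_has_vector_derivative] show ?thesis by (simp add: add.commute)
qed

section \<open>The layers as coordinate subspaces and the grading of the bracket\<close>

definition W :: "nat \<Rightarrow> (real^'n) set" where
  "W j = {v. \<forall>i. wt i \<noteq> j \<longrightarrow> v $ i = 0}"

lemma subspace_W: "subspace (W j)"
  by (auto simp: subspace_def W_def)

lemma axis_in_W: "axis i 1 \<in> W (wt i)"
  by (auto simp: W_def axis_def)

lemma W_trivial: "j = 0 \<or> j > k \<Longrightarrow> W j = {0}"
proof -
  assume "j = 0 \<or> j > k"
  then have "wt i \<noteq> j" for i
    using wt_range[of i] by auto
  then show ?thesis by (auto simp: W_def vec_eq_iff)
qed

lemma vec_expansion: "(\<Sum>i\<in>UNIV. v $ i *\<^sub>R axis i 1) = (v :: real^'n)"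
  using basis_expansion[of v] by (simp add: scalar_mult_eq_scaleR)

lemma layer_eq: "layer X wt j = V ` W j"
proof (intro subset_antisym subsetI)
  fix f assume "f \<in> layer X wt j"
  then obtain m c F where f: "f = (\<lambda>x. \<Sum>l<(m::nat). c l *\<^sub>R F l x)"
    and F: "\<And>l. l < m \<Longrightarrow> F l \<in> X ` {i. wt i = j}"
    unfolding layer_def vf_span_def by blast
  from F have "\<forall>l. \<exists>i. l < m \<longrightarrow> wt i = j \<and> F l = X i" by blast
  then obtain i where i: "\<And>l. l < m \<Longrightarrow> wt (i l) = j" "\<And>l. l < m \<Longrightarrow> F l = X (i l)" by metis
  have "f = V (\<Sum>l<m. c l *\<^sub>R axis (i l) 1)"
    unfolding f by (rule ext) (simp add: V_linear i X_eq_V)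
  moreover have "(\<Sum>l<m. c l *\<^sub>R axis (i l) 1) \<in> W j"
    using i(1) axis_in_W by (intro subspace_sum subspace_scale subspace_W) auto
  ultimately show "f \<in> V ` W j" by blast
next
  fix f assume "f \<in> V ` W j"
  then obtain v where v: "v \<in> W j" "f = V v" by blast
  obtain g :: "nat \<Rightarrow> 'n" and m where g: "bij_betw g {..<m} {i. wt i = j}"
    using ex_bij_betw_nat_finite[of "{i. wt i = j}"] by (auto simp: lessThan_atLeast0)
  have "V v x = (\<Sum>l<m. v $ g l *\<^sub>R X (g l) x)" for x
  proof -
    have "V v x = (\<Sum>i\<in>UNIV. v $ i *\<^sub>R X i x)"
      by (subst vec_expansion[of v, symmetric]) (simp add: V_linear X_eq_V)
    also have "\<dots> = (\<Sum>i | wt i = j. v $ i *\<^sub>R X i x)"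
      using v(1) by (intro sum.mono_neutral_right) (auto simp: W_def)
    also have "\<dots> = (\<Sum>l<m. v $ g l *\<^sub>R X (g l) x)"
      by (rule sum.reindex_bij_betw[OF g, symmetric])
    finally show ?thesis .
  qed
  then have "f = (\<lambda>x. \<Sum>l<m. v $ g l *\<^sub>R X (g l) x)" using v by auto
  moreover have "\<forall>l<m. X (g l) \<in> X ` {i. wt i = j}"
    using bij_betwE[OF g] by auto
  ultimately show "f \<in> layer X wt j"
    unfolding layer_def vf_span_def
    by (intro CollectI exI[of _ m] exI[of _ "\<lambda>l. v $ g l"] exI[of _ "\<lambda>l. X (g l)"] conjI)
qed

text \<open>The stratification is a statement on vector fields; evaluating at 0, where
  \<open>V u\<close> takes the value \<open>u\<close>, turns it into one on vectors.\<close>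

lemma bracket_W1:
  assumes "u \<in> W 1" "v \<in> W j" "1 \<le> j"
  shows "bracket u v \<in> W (Suc j)"
proof -
  have in_space: "lie_bracket (V u) (V v) \<in> bracket_space (layer X wt 1) (layer X wt j)"
    unfolding bracket_space_def by (rule vf_span_superset) (use assms in \<open>auto simp: layer_eq\<close>)
  consider "j < k" | "j = k" | "j > k" by linarith
  then show ?thesis
  proof cases
    case 1
    then have "lie_bracket (V u) (V v) \<in> V ` W (Suc j)"
      using in_space stratified[of j] assms(3) layer_eq by simp
    then show ?thesis using lie_bracket_V_0[of u v] by auto
  next
    case 2
    then have "bracket u v = 0"
      using in_space stratified_top lie_bracket_V_0[of u v] by auto
    then show ?thesis by (simp add: subspace_0[OF subspace_W])
  next
    case 3
    then have "v = 0" using assms W_trivial[of j] by auto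
    then show ?thesis by (simp add: bracket_linear subspace_0[OF subspace_W])
  qed
qed

lemma W_Suc_subset_span:
  assumes "1 \<le> j"
  shows "W (Suc j) \<subseteq> span {bracket u v | u v. u \<in> W 1 \<and> v \<in> W j}"
proof
  fix w assume w: "w \<in> W (Suc j)"
  show "w \<in> span {bracket u v | u v. u \<in> W 1 \<and> v \<in> W j}"
  proof (cases "j < k")
    case True
    then have "V w \<in> bracket_space (layer X wt 1) (layer X wt j)"
      using w stratified[of j] assms layer_eq by auto
    then obtain m c F where f: "V w = (\<lambda>x. \<Sum>l<(m::nat). c l *\<^sub>R F l x)"
      and F: "\<And>l. l < m \<Longrightarrow> F l \<in> {lie_bracket U U' | U U'. U \<in> layer X wt 1 \<and> U' \<in> layer X wt j}"
      unfolding bracket_space_def vf_span_def by blast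
    have "w = (\<Sum>l<m. c l *\<^sub>R F l 0)"
      using fun_cong[OF f, of 0] by simp
    moreover have "F l 0 \<in> {bracket u v | u v. u \<in> W 1 \<and> v \<in> W j}" if "l < m" for l
      using F[OF that] by (force simp: layer_eq lie_bracket_V_0)
    ultimately show ?thesis
      by (simp only:) (rule span_sum, rule span_scale, rule span_base, simp)
  next
    case False
    then have "w = 0" using w W_trivial[of "Suc j"] by auto
    then show ?thesis by (simp add: span_0)
  qed
qed

text \<open>The stratification controls brackets with the first layer only. By induction on
  \<open>a\<close>, elements of \<open>W (Suc a)\<close> are combinations of
  \<open>bracket y z\<close> with \<open>y\<close> in the first layer, and the Jacobi identity
  leaves brackets with \<open>y\<close> and with \<open>z\<close>.\<close>

lemma bracket_W: "u \<in> W a \<Longrightarrow> v \<in> W b \<Longrightarrow> bracket u v \<in> W (a + b)"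
proof (induction a arbitrary: u v b)
  case 0
  then show ?case using W_trivial[of 0] by (auto simp: bracket_linear subspace_0[OF subspace_W])
next
  case (Suc a)
  show ?case
  proof (cases "b = 0 \<or> a = 0")
    case True
    then show ?thesis
    proof (cases "b = 0")
      case True
      then show ?thesis using Suc.prems W_trivial[of 0] by (auto simp: bracket_linear subspace_0[OF subspace_W])
    next
      case False
      with True Suc.prems bracket_W1[of u v b] show ?thesis by simp
    qed
  next
    case False
    then have b: "1 \<le> a" "1 \<le> b" by auto
    have "u \<in> span {bracket y z | y z. y \<in> W 1 \<and> z \<in> W a}"
      using W_Suc_subset_span[OF b(1)] Suc.prems by auto
    then show ?thesis
    proof (induction rule: span_induct_alt)
      case base
      then show ?case by (simp add: bracket_linear subspace_0[OF subspace_W])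
    next
      case (step c x y')
      then obtain y z where yz: "x = bracket y z" "y \<in> W 1" "z \<in> W a" by blast
      \<comment> \<open>The second term applies the induction hypothesis for \<open>z\<close> to
        \<open>bracket y v\<close>, which lies in layer \<open>Suc b\<close>; hence \<open>b\<close>
        is kept arbitrary in the induction.\<close>
      have "bracket (bracket y z) v = bracket y (bracket z v) - bracket z (bracket y v)"
        using jacobi[of y z v] by simp
      moreover have "bracket y (bracket z v) \<in> W (Suc a + b)"
        using bracket_W1[OF yz(2) Suc.IH[OF yz(3) Suc.prems(2)]] b by simp
      moreover have "bracket z (bracket y v) \<in> W (Suc a + b)"
        using Suc.IH[OF yz(3) bracket_W1[OF yz(2) Suc.prems(2) b(2)]] by simp
      ultimately have "bracket x v \<in> W (Suc a + b)"
        using subspace_diff[OF subspace_W] by (simp add: yz)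
      then show ?case
        using step.IH by (simp add: bracket_linear subspace_add[OF subspace_W] subspace_scale[OF subspace_W])
    qed
  qed
qed

end

section \<open>Dilations and Lebesgue measure\<close>

context carnot_group
begin

definition dil :: "real \<Rightarrow> real^'n \<Rightarrow> real^'n" where
  "dil = dilation wt"

lemma dil_nth [simp]: "dil r x $ i = r ^ wt i * x $ i"
  by (simp add: dil_def dilation_def)

lemma linear_dil: "linear (dil r)"
  by (rule linearI) (simp_all add: vec_eq_iff algebra_simps)

lemma bounded_linear_dil: "bounded_linear (dil r)"
  using linear_dil linear_conv_bounded_linear by blast

lemmas dil_linear [simp] = linear_add[OF linear_dil] linear_scale[OF linear_dil] linear_0[OF linear_dil]
  linear_neg[OF linear_dil] linear_diff[OF linear_dil]

lemma dil_dil: "dil r (dil s x) = dil (r * s) x"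
  by (simp add: vec_eq_iff power_mult_distrib)

lemma dil_1 [simp]: "dil 1 x = x"
  by (simp add: vec_eq_iff)

lemma dil_W: "v \<in> W j \<Longrightarrow> dil r v = r ^ j *\<^sub>R v"
  by (auto simp: W_def vec_eq_iff)

text \<open>On axis vectors a dilation is multiplication by \<open>r ^ wt i\<close>, and the grading
  makes the exponents add under the bracket; bilinearity does the rest.\<close>

lemma bracket_dil: "bracket (dil r u) (dil r v) = dil r (bracket u v)"
proof -
  have e: "bracket (dil r (axis i 1)) (dil r (axis j 1)) = dil r (bracket (axis i 1) (axis j 1))" for i j
    using dil_W[OF axis_in_W, of r i] dil_W[OF axis_in_W, of r j]
      dil_W[OF bracket_W[OF axis_in_W axis_in_W], of r i j]
    by (simp add: bracket_linear power_add)
  have "bracket (dil r (\<Sum>i\<in>UNIV. u $ i *\<^sub>R axis i 1)) (dil r (\<Sum>j\<in>UNIV. v $ j *\<^sub>R axis j 1))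
      = dil r (bracket (\<Sum>i\<in>UNIV. u $ i *\<^sub>R axis i 1) (\<Sum>j\<in>UNIV. v $ j *\<^sub>R axis j 1))"
    unfolding linear_sum[OF linear_dil] bilinear_sum[OF bilinear_bracket] dil_linear
    by (simp add: bracket_linear e case_prod_unfold)
  then show ?thesis unfolding vec_expansion .
qed

text \<open>
  \<open>t * D (- t v, t v) (0, w)\<close> is the derivative at \<open>s = 0\<close> of \<open>exp (- t v) exp (t (v + s w))\<close>.
  Splitting off the factors for time \<open>t\<close> shows that it is a cocycle over the conjugation by
  \<open>exp (- t v)\<close>; this yields the derivative of the exponential map without second derivatives.
\<close>

definition dexp :: "real^'n \<Rightarrow> real^'n \<Rightarrow> real \<Rightarrow> real^'n" where
  "dexp v w t = t *\<^sub>R D (- (t *\<^sub>R v), t *\<^sub>R v) (0, w)"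

lemma dexp_variation:
  "((\<lambda>s. - (t *\<^sub>R v) \<otimes> t *\<^sub>R (v + s *\<^sub>R w)) has_vector_derivative dexp v w t) (at 0)"
proof -
  have "((\<lambda>s. t *\<^sub>R (v + s *\<^sub>R w)) has_vector_derivative t *\<^sub>R w) (at 0)"
    by (auto intro!: derivative_eq_intros)
  from left_mult_has_vector_derivative[OF this, of "- (t *\<^sub>R v)"]
  show ?thesis
    using linear_scale[OF linear_D, of "(- (t *\<^sub>R v), t *\<^sub>R v)" t "(0, w)"] by (simp add: dexp_def)
qed

lemma dexp_cocycle: "dexp v w (t + \<tau>) = conj_by (- (\<tau> *\<^sub>R v)) (dexp v w t) + dexp v w \<tau>"
proof -
  let ?F = "\<lambda>t s. - (t *\<^sub>R v) \<otimes> t *\<^sub>R (v + s *\<^sub>R w)"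
  have "?F (t + \<tau>) s = conj_by (- (\<tau> *\<^sub>R v)) (?F t s) \<otimes> ?F \<tau> s" for s
  proof -
    have 1: "- ((t + \<tau>) *\<^sub>R v) = - (\<tau> *\<^sub>R v) \<otimes> - (t *\<^sub>R v)"
      using ray_mult[of "- \<tau>" v "- t"] by (simp add: algebra_simps)
    have 2: "(t + \<tau>) *\<^sub>R (v + s *\<^sub>R w) = t *\<^sub>R (v + s *\<^sub>R w) \<otimes> \<tau> *\<^sub>R (v + s *\<^sub>R w)"
      by (rule ray_mult[symmetric])
    show ?thesis
      unfolding 1 2 conj_by_def by (simp add: mult_assoc')
  qed
  moreover have "((\<lambda>s. conj_by (- (\<tau> *\<^sub>R v)) (?F t s) \<otimes> ?F \<tau> s) has_vector_derivative
      D (conj_by (- (\<tau> *\<^sub>R v)) (?F t 0), ?F \<tau> 0) (conj_by (- (\<tau> *\<^sub>R v)) (dexp v w t), dexp v w \<tau>)) (at 0)"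
    by (intro mult_has_vector_derivative bounded_linear.has_vector_derivative[OF bounded_linear_conj_by]
        dexp_variation)
  ultimately have "(?F (t + \<tau>) has_vector_derivative
      (conj_by (- (\<tau> *\<^sub>R v)) (dexp v w t) + dexp v w \<tau>)) (at 0)"
    by (simp add: D_split)
  from has_vector_derivative_at_unique[OF dexp_variation this] show ?thesis .
qed

lemma dexp_has_vector_derivative_0: "(dexp v w has_vector_derivative w) (at 0)"
proof -
  define g where "g t = D (- (t *\<^sub>R v), t *\<^sub>R v) (0, w)" for t
  have "(\<lambda>z. D z (0, w)) \<circ> (\<lambda>t. (- (t *\<^sub>R v), t *\<^sub>R v)) differentiable (at 0)"
    by (intro differentiable_chain_at differentiable_D differentiable_Pair differentiable_minus
        differentiable_scaleR) auto
  then obtain g' where g': "(g has_vector_derivative g') (at 0)"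
    unfolding g_def[abs_def] o_def using vector_derivative_works by blast
  have "((\<lambda>t. t *\<^sub>R g t) has_vector_derivative (0 *\<^sub>R g' + 1 *\<^sub>R g 0)) (at 0)"
    by (rule has_vector_derivative_scaleR[OF DERIV_ident g'])
  moreover have "g 0 = w" by (simp add: g_def flip: V_def)
  moreover have "dexp v w = (\<lambda>t. t *\<^sub>R g t)" by (simp add: fun_eq_iff dexp_def g_def)
  ultimately show ?thesis by simp
qed

text \<open>The cocycle identity differentiated at \<open>\<tau> = 0\<close>: the conjugation
  contributes \<open>- bracket v\<close>, the new factor contributes its initial velocity
  \<open>w\<close>.\<close>

lemma dexp_ode: "(dexp v w has_vector_derivative (w - bracket v (dexp v w t))) (at t)"
proof -
  have "((\<lambda>\<tau>. conj_by (\<tau> *\<^sub>R (- v)) (dexp v w t) + dexp v w \<tau>) has_vector_derivative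
      bracket (- v) (dexp v w t) + w) (at 0)"
    by (intro has_vector_derivative_add conj_by_ray_has_vector_derivative dexp_has_vector_derivative_0)
  then have "((\<lambda>\<tau>. dexp v w (t + \<tau>)) has_vector_derivative (w - bracket v (dexp v w t))) (at 0)"
    by (simp add: dexp_cocycle bracket_linear)
  moreover have "((\<lambda>r. r - t) has_vector_derivative 1) (at t)"
    by (auto intro!: derivative_eq_intros)
  ultimately have "((\<lambda>\<tau>. dexp v w (t + \<tau>)) \<circ> (\<lambda>r. r - t) has_vector_derivative
      1 *\<^sub>R (w - bracket v (dexp v w t))) (at t)"
    by (intro vector_diff_chain_at) simp_all
  then show ?thesis by (simp add: o_def)
qed

lemma dexp_dil: "dexp (dil r v) (dil r w) 1 = dil r (dexp v w 1)"
proof -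
  define e where "e t = dil r (dexp v w t) - dexp (dil r v) (dil r w) t" for t
  have "e 1 = 0"
  proof (rule linear_ode_zero)
    show "bounded_linear (\<lambda>x. - bracket (dil r v) x)"
      by (intro bounded_linear_minus bounded_bilinear.bounded_linear_right bounded_bilinear_bracket)
    show "(e has_vector_derivative - bracket (dil r v) (e t)) (at t)" for t
    proof -
      have "(e has_vector_derivative (dil r (w - bracket v (dexp v w t)) -
          (dil r w - bracket (dil r v) (dexp (dil r v) (dil r w) t)))) (at t)"
        unfolding e_def[abs_def]
        by (intro has_vector_derivative_diff dexp_ode bounded_linear.has_vector_derivative[OF bounded_linear_dil])
      then show ?thesis by (simp add: e_def bracket_linear bracket_dil)
    qed
    show "e 0 = 0" by (simp add: e_def dexp_def)
  qed
  then show ?thesis by (simp add: e_def)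
qed

text \<open>The inverse of the frame: \<open>V_inv w x\<close> gives the coefficients of
  \<open>w\<close> at \<open>x\<close>. It equals \<open>dexp x w 1\<close>, so
  \<open>dexp_dil\<close> is its law under dilations.\<close>

definition V_inv :: "real^'n \<Rightarrow> real^'n \<Rightarrow> real^'n" where
  "V_inv w x = D (- x, x) (0, w)"

lemma V_inv_V [simp]: "V_inv (V u x) x = u"
  using V_left_invariant[of "- x" x u] by (simp add: V_inv_def)

lemma V_V_inv [simp]: "V (V_inv w x) x = w"
proof -
  have "((\<lambda>y. x \<otimes> (- x \<otimes> y)) has_derivative (\<lambda>w. D (x, - x \<otimes> x) (0, D (- x, x) (0, w)))) (at x)"
    using has_derivative_compose[OF left_mult_has_derivative[of "- x" x]
        left_mult_has_derivative[of x "- x \<otimes> x"]] by simp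
  from has_derivative_unique[OF this[unfolded mult_uminus] has_derivative_ident]
  show ?thesis unfolding V_def V_inv_def by metis
qed

text \<open>Obtained by inverting the dilation law of \<open>V_inv\<close>. This infinitesimal
  equivariance yields the scaling of horizontal paths in \<open>hpath_dil\<close> and the constancy
  of the Jacobian along dilation orbits in \<open>cdet_V\<close>.\<close>

lemma V_dil: "V (dil r u) (dil r x) = dil r (V u x)"
proof -
  have "dil r u = dil r (dexp x (V u x) 1)"
    by (simp add: dexp_def flip: V_inv_def)
  also have "\<dots> = V_inv (dil r (V u x)) (dil r x)"
    by (simp add: dexp_dil[symmetric]) (simp add: dexp_def V_inv_def)
  finally show ?thesis by simp
qed

section \<open>Jacobians of the frame, of left translations and of dilations\<close>

lemma cdet_V: "cdet (\<lambda>w. V w x) = 1"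
proof -
  define f where "f x = cdet (\<lambda>w. V w x)" for x
  have inv: "f (dil r x) = f x" if "r > 0" for r
  proof -
    have "(\<lambda>w. V w (dil r x)) = (\<lambda>w. dil r (V (dil (1 / r) w) x))"
      using that by (simp add: fun_eq_iff V_dil[symmetric] dil_dil)
    then have "f (dil r x) = cdet (dil r) * (f x * cdet (dil (1 / r)))"
      unfolding f_def
      by (simp add: cdet_compose[OF linear_dil linear_compose[OF linear_dil linear_V, unfolded o_def]]
          cdet_compose[OF linear_V linear_dil])
    moreover have "cdet (dil r) * cdet (dil (1 / r)) = 1"
      using cdet_compose[OF linear_dil linear_dil, of r "1 / r"] that by (simp add: dil_dil)
    ultimately show ?thesis by (simp add: algebra_simps)
  qed
  have cf: "continuous_on UNIV f"
    unfolding f_def by (intro continuous_on_cdet continuous_on_V continuous_on_id)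
  have "continuous_on UNIV (\<lambda>r. dil r x)"
    unfolding dil_def dilation_def by (intro continuous_intros)
  then have "continuous_on UNIV (\<lambda>r. f (dil r x))"
    using continuous_on_compose2[OF cf] by auto
  then have "((\<lambda>r. f (dil r x)) \<longlongrightarrow> f (dil 0 x)) (at_right 0)"
    by (auto simp: continuous_on_def intro: filterlim_at_split[THEN iffD1, THEN conjunct2])
  moreover have "((\<lambda>r. f (dil r x)) \<longlongrightarrow> f x) (at_right 0)"
    by (rule tendsto_eventually) (auto simp: inv eventually_at_right_field intro: exI[of _ 1])
  ultimately have "f x = f (dil 0 x)"
    using tendsto_unique[of "at_right (0::real)"] by fastforce
  \<comment> \<open>This relies on all weights being at least 1, since
    \<open>0 ^ 0 = 1\<close>.\<close>
  also have "dil 0 x = 0"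
  proof -
    have "wt i \<noteq> 0" for i using wt_range[of i] by auto
    then show ?thesis by (simp add: vec_eq_iff)
  qed
  finally show ?thesis by (simp add: f_def)
qed

text \<open>Left invariance factors the frame at \<open>x \<otimes> y\<close> as this differential
  after the frame at \<open>y\<close>, and both frames have determinant 1.\<close>

lemma cdet_left_mult: "cdet (\<lambda>w. D (x, y) (0, w)) = 1"
proof -
  have "linear (\<lambda>w. D (x, y) (0, w))"
    using has_derivative_linear[OF left_mult_has_derivative] .
  from cdet_compose[OF this linear_V[of y]] show ?thesis
    by (simp add: V_left_invariant cdet_V)
qed

lemma emeasure_left_mult_image:
  assumes "open S" "bounded S" "open ((\<lambda>y. x \<otimes> y) ` S)"
  shows "emeasure lebesgue ((\<lambda>y. x \<otimes> y) ` S) = emeasure lebesgue S"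
  using emeasure_image_cdet[OF assms _ left_mult_has_derivative, of 1]
  by (simp add: cdet_left_mult inj_on_def)

lemma sum_wt: "(\<Sum>i\<in>UNIV. wt i) = homogeneous_dim wt k"
proof -
  have "(\<Sum>i\<in>UNIV. wt i) = (\<Sum>j=1..k. \<Sum>i | wt i = j. wt i)"
    using sum.group[of UNIV "{1..k}" wt wt] wt_range by (simp add: image_subset_iff)
  also have "\<dots> = homogeneous_dim wt k"
    unfolding homogeneous_dim_def by (rule sum.cong) auto
  finally show ?thesis .
qed

lemma homogeneous_dim_ge_1: "1 \<le> homogeneous_dim wt k"
  using member_le_sum[of undefined UNIV wt] wt_range[of undefined] by (simp add: sum_wt)

lemma prod_dil_weights: "(\<Prod>i\<in>UNIV. r ^ wt i) = r ^ homogeneous_dim wt k"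
  by (simp add: sum_wt flip: power_sum)

lemma emeasure_dil_image:
  assumes "open S" "bounded S" "r > 0"
  shows "emeasure lebesgue (dil r ` S) = ennreal (r ^ homogeneous_dim wt k) * emeasure lebesgue S"
proof (rule emeasure_image_cdet)
  have inj: "inj (dil r)"
    using assms(3) by (auto simp: inj_def vec_eq_iff)
  show "open (dil r ` S)"
    using open_surjective_linear_image[OF assms(1) linear_dil] linear_inj_imp_surj[OF linear_dil inj] by simp
  show "inj_on (dil r) S" using inj by (rule inj_on_subset) auto
  show "(dil r has_derivative dil r) (at x)" for x
    by (rule bounded_linear_imp_has_derivative[OF bounded_linear_dil])
  show "\<bar>cdet (dil r)\<bar> = r ^ homogeneous_dim wt k"
    using cdet_diagonal[of "\<lambda>i. r ^ wt i"] assms(3) prod_dil_weights[of r]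
    by (simp add: dil_def dilation_def[abs_def])
qed (use assms in auto)

end

section \<open>Horizontal paths\<close>

lemma DERIV_max_0_square: "((\<lambda>t::real. (max 0 t)\<^sup>2) has_real_derivative 2 * max 0 t) (at t)"
proof -
  consider "t < 0" | "t = 0" | "t > 0" by linarith
  then show ?thesis
  proof cases
    case 1
    have "((\<lambda>t::real. 0) has_real_derivative 0) (at t)" by simp
    then have "((\<lambda>t::real. (max 0 t)\<^sup>2) has_real_derivative 0) (at t)"
      by (rule has_field_derivative_transform_within_open[of _ _ _ "{..<0}"]) (use 1 in auto)
    with 1 show ?thesis by simp
  next
    case 2
    have "\<exists>g. (\<forall>z. (max 0 z)\<^sup>2 - (max 0 (0::real))\<^sup>2 = g z * (z - 0)) \<and> isCont g 0 \<and> g 0 = 0"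
    proof (intro exI[of _ "\<lambda>z. max 0 z"] conjI allI)
      show "isCont (\<lambda>z. max 0 z) (0::real)" by (intro continuous_intros)
    qed (simp_all add: max_def power2_eq_square)
    with 2 show ?thesis by (simp add: CARAT_DERIV)
  next
    case 3
    have "((\<lambda>t::real. t\<^sup>2) has_real_derivative 2 * t) (at t)"
      by (auto intro!: derivative_eq_intros)
    then have "((\<lambda>t::real. (max 0 t)\<^sup>2) has_real_derivative 2 * t) (at t)"
      by (rule has_field_derivative_transform_within_open[of _ _ _ "{0<..}"]) (use 3 in auto)
    with 3 show ?thesis by simp
  qed
qed

text \<open>A quadratic spline whose derivative is the tent of height 2 over the unit interval. The
  velocity vanishes at both ends, so reparametrised paths can be made to rest there.\<close>

definition smooth_step :: "real \<Rightarrow> real" where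
  "smooth_step t = 2 * (max 0 t)\<^sup>2 - 4 * (max 0 (t - 1/2))\<^sup>2 + 2 * (max 0 (t - 1))\<^sup>2"

definition smooth_step' :: "real \<Rightarrow> real" where
  "smooth_step' t = 4 * max 0 t - 8 * max 0 (t - 1/2) + 4 * max 0 (t - 1)"

lemma DERIV_smooth_step: "(smooth_step has_real_derivative smooth_step' t) (at t)"
proof -
  have "((\<lambda>t. (max 0 (t - a))\<^sup>2) has_real_derivative 2 * max 0 (t - a)) (at t)" for a
  proof -
    have "((\<lambda>t. t - a) has_real_derivative 1) (at t)"
      by (auto intro!: derivative_eq_intros)
    from DERIV_chain2[OF DERIV_max_0_square this] show ?thesis by simp
  qed
  from DERIV_add[OF DERIV_diff[OF DERIV_cmult[OF this[of 0], of 2] DERIV_cmult[OF this[of "1/2"], of 4]]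
      DERIV_cmult[OF this[of 1], of 2]]
  show ?thesis
    unfolding smooth_step_def[abs_def] smooth_step'_def by simp
qed

lemma continuous_on_smooth_step': "continuous_on S smooth_step'"
  unfolding smooth_step'_def[abs_def] by (intro continuous_intros)

lemma smooth_step'_nonneg: "0 \<le> smooth_step' t"
  by (auto simp: smooth_step'_def max_def)

lemma smooth_step_ends [simp]:
  "t \<le> 0 \<Longrightarrow> smooth_step t = 0" "t \<le> 0 \<Longrightarrow> smooth_step' t = 0"
  "t \<ge> 1 \<Longrightarrow> smooth_step t = 1" "t \<ge> 1 \<Longrightarrow> smooth_step' t = 0"
  by (auto simp: smooth_step_def smooth_step'_def max_def power2_eq_square algebra_simps)

lemma smooth_step_mono: "s \<le> t \<Longrightarrow> smooth_step s \<le> smooth_step t"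
  using DERIV_nonneg_imp_nondecreasing[of s t smooth_step] DERIV_smooth_step smooth_step'_nonneg by blast

lemma smooth_step_range: "smooth_step t \<in> {0..1}"
proof -
  have "smooth_step (min t 0) \<le> smooth_step t" "smooth_step t \<le> smooth_step (max t 1)"
    by (intro smooth_step_mono; simp)+
  then show ?thesis by simp
qed

lemma has_vector_derivative_imp_tendsto:
  assumes "(f has_vector_derivative f') (at 0)"
  shows "((\<lambda>h. (f h - f 0) /\<^sub>R h) \<longlongrightarrow> f') (at 0)"
proof -
  have "((\<lambda>h. norm (f h - f 0 - h *\<^sub>R f') / norm h) \<longlongrightarrow> 0) (at 0)"
    using assms by (simp add: has_vector_derivative_def has_derivative_at)
  moreover have "\<forall>\<^sub>F h in at 0. norm (f h - f 0 - h *\<^sub>R f') / norm h = norm ((f h - f 0) /\<^sub>R h - f')"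
  proof (rule eventually_at_topological[THEN iffD2], intro exI[of _ UNIV] conjI ballI impI)
    fix h :: real assume "h \<noteq> 0"
    then have "(f h - f 0) /\<^sub>R h - f' = (f h - f 0 - h *\<^sub>R f') /\<^sub>R h"
      by (simp add: scaleR_diff_right)
    then show "norm (f h - f 0 - h *\<^sub>R f') / norm h = norm ((f h - f 0) /\<^sub>R h - f')"
      by (simp add: divide_inverse_commute)
  qed auto
  ultimately show ?thesis
    unfolding Lim_null[of _ f'] by (subst tendsto_norm_zero_iff[symmetric]) (rule Lim_transform_eventually)
qed

lemma has_vector_derivative_in_subspace:
  fixes f :: "real \<Rightarrow> 'a::euclidean_space"
  assumes "(f has_vector_derivative f') (at 0)" "subspace T" "\<And>t. f t \<in> T"
  shows "f' \<in> T"
  by (rule Lim_in_closed_set[OF closed_subspace[OF assms(2)] _ _ has_vector_derivative_imp_tendsto[OF assms(1)]])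
     (use assms in \<open>auto intro!: always_eventually subspace_scale subspace_diff\<close>)

context carnot_group
begin

text \<open>
  The path rests outside the unit interval, so that paths can be concatenated without losing
  differentiability; \<open>L\<close> is the arc length.
\<close>

definition hpath :: "real^'n \<Rightarrow> real^'n \<Rightarrow> real \<Rightarrow> bool" where
  "hpath x y l \<longleftrightarrow> (\<exists>\<gamma> c L.
     (\<forall>t. (\<gamma> has_vector_derivative V (c t) (\<gamma> t)) (at t)) \<and> continuous_on UNIV c \<and>
     (\<forall>t. c t \<in> W 1) \<and> (\<forall>t. (L has_real_derivative norm (c t)) (at t)) \<and>
     (\<forall>t\<le>0. \<gamma> t = x \<and> c t = 0 \<and> L t = 0) \<and> (\<forall>t\<ge>1. \<gamma> t = y \<and> c t = 0 \<and> L t = l))"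

lemma hpathI:
  assumes "\<And>t. (\<gamma> has_vector_derivative V (c t) (\<gamma> t)) (at t)" "continuous_on UNIV c"
    "\<And>t. c t \<in> W 1" "\<And>t. (L has_real_derivative norm (c t)) (at t)"
    "\<And>t. t \<le> 0 \<Longrightarrow> \<gamma> t = x \<and> c t = 0 \<and> L t = 0"
    "\<And>t. t \<ge> 1 \<Longrightarrow> \<gamma> t = y \<and> c t = 0 \<and> L t = l"
  shows "hpath x y l"
  unfolding hpath_def using assms by blast

lemma hpathE:
  assumes "hpath x y l"
  obtains \<gamma> c L where "\<And>t. (\<gamma> has_vector_derivative V (c t) (\<gamma> t)) (at t)" "continuous_on UNIV c"
    "\<And>t. c t \<in> W 1" "\<And>t. (L has_real_derivative norm (c t)) (at t)"
    "\<And>t. t \<le> 0 \<Longrightarrow> \<gamma> t = x" "\<And>t. t \<le> 0 \<Longrightarrow> c t = 0" "\<And>t. t \<le> 0 \<Longrightarrow> L t = 0"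
    "\<And>t. t \<ge> 1 \<Longrightarrow> \<gamma> t = y" "\<And>t. t \<ge> 1 \<Longrightarrow> c t = 0" "\<And>t. t \<ge> 1 \<Longrightarrow> L t = l"
  using assms unfolding hpath_def by blast

text \<open>Reparametrising by \<open>\<alpha>\<close> brings the curve to rest at both ends. As
  \<open>\<alpha>\<close> never leaves the interval, the derivatives within \<open>{a..b}\<close>
  are enough for two-sided ones after composition.\<close>

lemma hpath_piece:
  assumes "a \<le> b"
    and \<gamma>: "\<And>t. t \<in> {a..b} \<Longrightarrow> (\<gamma> has_vector_derivative V (c t) (\<gamma> t)) (at t within {a..b})"
    and c: "continuous_on {a..b} c" "\<And>t. t \<in> {a..b} \<Longrightarrow> c t \<in> W 1"
    and L: "\<And>t. t \<in> {a..b} \<Longrightarrow> (L has_real_derivative norm (c t)) (at t within {a..b})"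
  shows "hpath (\<gamma> a) (\<gamma> b) (L b - L a)"
proof -
  define \<alpha> where "\<alpha> t = a + (b - a) * smooth_step t" for t
  define \<alpha>' where "\<alpha>' t = (b - a) * smooth_step' t" for t
  have \<alpha>: "(\<alpha> has_real_derivative \<alpha>' t) (at t)" for t
    unfolding \<alpha>_def[abs_def] \<alpha>'_def
    by (auto intro!: derivative_eq_intros DERIV_smooth_step)
  have nn: "0 \<le> \<alpha>' t" for t
    using assms(1) smooth_step'_nonneg by (simp add: \<alpha>'_def)
  have range: "\<alpha> t \<in> {a..b}" for t
  proof -
    have "(b - a) * smooth_step t \<le> (b - a) * 1"
      by (rule mult_left_mono) (use assms(1) smooth_step_range[of t] in auto)
    moreover have "0 \<le> (b - a) * smooth_step t"
      using assms(1) smooth_step_range[of t] by simp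
    ultimately show ?thesis by (simp add: \<alpha>_def)
  qed
  then have sub: "range \<alpha> \<subseteq> {a..b}" by auto
  have chain: "((\<lambda>t. f (\<alpha> t)) has_vector_derivative \<alpha>' t *\<^sub>R f') (at t)"
    if "(f has_vector_derivative f') (at (\<alpha> t) within {a..b})" for f :: "real \<Rightarrow> 'z::real_normed_vector" and f' t
    using vector_diff_chain_within[OF \<alpha>[unfolded has_real_derivative_iff_has_vector_derivative]
        has_vector_derivative_within_subset[OF that sub]] by (simp add: o_def)
  show ?thesis
  proof (rule hpathI[of "\<lambda>t. \<gamma> (\<alpha> t)" "\<lambda>t. \<alpha>' t *\<^sub>R c (\<alpha> t)" "\<lambda>t. L (\<alpha> t) - L a"])
    show "((\<lambda>t. \<gamma> (\<alpha> t)) has_vector_derivative V (\<alpha>' t *\<^sub>R c (\<alpha> t)) (\<gamma> (\<alpha> t))) (at t)" for t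
      using chain[OF \<gamma>[OF range]] by (simp add: V_linear)
    have "continuous_on UNIV \<alpha>"
      using \<alpha> by (auto intro!: DERIV_continuous continuous_at_imp_continuous_on)
    then show "continuous_on UNIV (\<lambda>t. \<alpha>' t *\<^sub>R c (\<alpha> t))"
      unfolding \<alpha>'_def
      by (intro continuous_on_scaleR continuous_on_mult continuous_on_const continuous_on_smooth_step'
          continuous_on_compose2[OF c(1) _ sub])
    show "\<alpha>' t *\<^sub>R c (\<alpha> t) \<in> W 1" for t
      by (intro subspace_scale subspace_W c range)
    show "((\<lambda>t. L (\<alpha> t) - L a) has_real_derivative norm (\<alpha>' t *\<^sub>R c (\<alpha> t))) (at t)" for t
    proof -
      have "((\<lambda>t. L (\<alpha> t)) has_real_derivative \<alpha>' t * norm (c (\<alpha> t))) (at t)"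
        using chain[OF L[OF range, unfolded has_real_derivative_iff_has_vector_derivative]]
        by (simp add: has_real_derivative_iff_has_vector_derivative)
      from DERIV_diff[OF this DERIV_const[of "L a"]] nn show ?thesis by simp
    qed
  qed (simp_all add: \<alpha>_def \<alpha>'_def)
qed

lemma hpath_nonneg: "hpath x y l \<Longrightarrow> 0 \<le> l"
proof (elim hpathE)
  fix \<gamma> c L
  assume *: "\<And>t. (L has_real_derivative norm (c t)) (at t)" "\<And>t. t \<le> 0 \<Longrightarrow> L t = 0"
    "\<And>t. t \<ge> 1 \<Longrightarrow> L t = l"
  have "L 0 \<le> L 1"
    by (rule DERIV_nonneg_imp_nondecreasing[of 0 1 L]) (simp, use *(1) norm_ge_zero in blast)
  with * show ?thesis by simp
qed

lemma hpath_trans: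
  assumes "hpath x y l" "hpath y z m"
  shows "hpath x z (l + m)"
proof -
  obtain \<gamma>1 c1 L1 where 1: "\<And>t. (\<gamma>1 has_vector_derivative V (c1 t) (\<gamma>1 t)) (at t)" "continuous_on UNIV c1"
    "\<And>t. c1 t \<in> W 1" "\<And>t. (L1 has_real_derivative norm (c1 t)) (at t)"
    "\<And>t. t \<le> 0 \<Longrightarrow> \<gamma>1 t = x" "\<And>t. t \<le> 0 \<Longrightarrow> c1 t = 0" "\<And>t. t \<le> 0 \<Longrightarrow> L1 t = 0"
    "\<And>t. t \<ge> 1 \<Longrightarrow> \<gamma>1 t = y" "\<And>t. t \<ge> 1 \<Longrightarrow> c1 t = 0" "\<And>t. t \<ge> 1 \<Longrightarrow> L1 t = l"
    using assms(1) by (rule hpathE) blast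
  obtain \<gamma>2 c2 L2 where 2: "\<And>t. (\<gamma>2 has_vector_derivative V (c2 t) (\<gamma>2 t)) (at t)" "continuous_on UNIV c2"
    "\<And>t. c2 t \<in> W 1" "\<And>t. (L2 has_real_derivative norm (c2 t)) (at t)"
    "\<And>t. t \<le> 0 \<Longrightarrow> \<gamma>2 t = y" "\<And>t. t \<le> 0 \<Longrightarrow> c2 t = 0" "\<And>t. t \<le> 0 \<Longrightarrow> L2 t = 0"
    "\<And>t. t \<ge> 1 \<Longrightarrow> \<gamma>2 t = z" "\<And>t. t \<ge> 1 \<Longrightarrow> c2 t = 0" "\<And>t. t \<ge> 1 \<Longrightarrow> L2 t = m"
    using assms(2) by (rule hpathE) blast
  have a1: "((\<lambda>t. 2 * t) has_vector_derivative 2) (at t)" "((\<lambda>t. 2 * t - 1) has_vector_derivative 2) (at t)" for t :: real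
    by (auto intro!: derivative_eq_intros)
  define c where "c t = 2 *\<^sub>R (c1 (2 * t) + c2 (2 * t - 1))" for t
  \<comment> \<open>At every time at least one of the two paths rests at \<open>y\<close> with
    control 0, so the sum minus \<open>y\<close> follows the other one. Controls and lengths add for
    the same reason, and no derivatives have to be glued at 1/2.\<close>
  define \<gamma> where "\<gamma> t = \<gamma>1 (2 * t) + \<gamma>2 (2 * t - 1) - y" for t
  have d: "(\<gamma> has_vector_derivative (2 *\<^sub>R V (c1 (2 * t)) (\<gamma>1 (2 * t)) + 2 *\<^sub>R V (c2 (2 * t - 1)) (\<gamma>2 (2 * t - 1)) - 0)) (at t)" for t
    unfolding \<gamma>_def[abs_def]
    by (intro has_vector_derivative_diff has_vector_derivative_add has_vector_derivative_const
        vector_diff_chain_at[OF a1(1) 1(1), unfolded o_def] vector_diff_chain_at[OF a1(2) 2(1), unfolded o_def])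
  have dL: "((\<lambda>t. L1 (2 * t) + L2 (2 * t - 1)) has_real_derivative
      (2 * norm (c1 (2 * t)) + 2 * norm (c2 (2 * t - 1)))) (at t)" for t
    unfolding has_real_derivative_iff_has_vector_derivative
    using has_vector_derivative_add[OF
        vector_diff_chain_at[OF a1(1) 1(4)[unfolded has_real_derivative_iff_has_vector_derivative], unfolded o_def]
        vector_diff_chain_at[OF a1(2) 2(4)[unfolded has_real_derivative_iff_has_vector_derivative], unfolded o_def]]
    by simp
  show ?thesis
  proof (rule hpathI[of \<gamma> c "\<lambda>t. L1 (2 * t) + L2 (2 * t - 1)"])
    fix t :: real
    consider "2 * t \<le> 1" | "2 * t \<ge> 1" by linarith
    then have "2 *\<^sub>R V (c1 (2 * t)) (\<gamma>1 (2 * t)) + 2 *\<^sub>R V (c2 (2 * t - 1)) (\<gamma>2 (2 * t - 1)) - 0 = V (c t) (\<gamma> t)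
      \<and> 2 * norm (c1 (2 * t)) + 2 * norm (c2 (2 * t - 1)) = norm (c t)"
      by cases (simp_all add: c_def \<gamma>_def 1 2 V_linear)
    then show "(\<gamma> has_vector_derivative V (c t) (\<gamma> t)) (at t)"
      "((\<lambda>t. L1 (2 * t) + L2 (2 * t - 1)) has_real_derivative norm (c t)) (at t)"
      using d[of t] dL[of t] by simp_all
    show "c t \<in> W 1"
      unfolding c_def by (intro subspace_scale subspace_add subspace_W 1 2)
  next
    show "continuous_on UNIV c"
      unfolding c_def by (intro continuous_intros continuous_on_compose2[OF 1(2)] continuous_on_compose2[OF 2(2)]) auto
  qed (simp_all add: c_def \<gamma>_def 1 2)
qed

lemma hpath_left: "hpath x y l \<Longrightarrow> hpath (z \<otimes> x) (z \<otimes> y) l"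
proof (elim hpathE)
  fix \<gamma> c L
  assume *: "\<And>t. (\<gamma> has_vector_derivative V (c t) (\<gamma> t)) (at t)" "continuous_on UNIV c"
    "\<And>t. c t \<in> W 1" "\<And>t. (L has_real_derivative norm (c t)) (at t)"
    "\<And>t. t \<le> 0 \<Longrightarrow> \<gamma> t = x" "\<And>t. t \<le> 0 \<Longrightarrow> c t = 0" "\<And>t. t \<le> 0 \<Longrightarrow> L t = 0"
    "\<And>t. t \<ge> 1 \<Longrightarrow> \<gamma> t = y" "\<And>t. t \<ge> 1 \<Longrightarrow> c t = 0" "\<And>t. t \<ge> 1 \<Longrightarrow> L t = l"
  show ?thesis
    by (rule hpathI[of "\<lambda>t. z \<otimes> \<gamma> t" c L])
       (use * left_mult_has_vector_derivative[OF *(1), of z] in \<open>simp_all add: V_left_invariant\<close>)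
qed

lemma hpath_dil: "hpath x y l \<Longrightarrow> r > 0 \<Longrightarrow> hpath (dil r x) (dil r y) (r * l)"
proof (elim hpathE)
  fix \<gamma> c L
  assume r: "r > 0"
  assume *: "\<And>t. (\<gamma> has_vector_derivative V (c t) (\<gamma> t)) (at t)" "continuous_on UNIV c"
    "\<And>t. c t \<in> W 1" "\<And>t. (L has_real_derivative norm (c t)) (at t)"
    "\<And>t. t \<le> 0 \<Longrightarrow> \<gamma> t = x" "\<And>t. t \<le> 0 \<Longrightarrow> c t = 0" "\<And>t. t \<le> 0 \<Longrightarrow> L t = 0"
    "\<And>t. t \<ge> 1 \<Longrightarrow> \<gamma> t = y" "\<And>t. t \<ge> 1 \<Longrightarrow> c t = 0" "\<And>t. t \<ge> 1 \<Longrightarrow> L t = l"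
  have c: "dil r (c t) = r *\<^sub>R c t" for t
    using dil_W[OF *(3)] by simp
  have "((\<lambda>t. dil r (\<gamma> t)) has_vector_derivative V (r *\<^sub>R c t) (dil r (\<gamma> t))) (at t)" for t
    using bounded_linear.has_vector_derivative[OF bounded_linear_dil[of r] *(1)[of t]] c
    by (simp flip: V_dil)
  moreover have "((\<lambda>t. r * L t) has_real_derivative norm (r *\<^sub>R c t)) (at t)" for t
    using DERIV_cmult[OF *(4), of r] r by simp
  ultimately show ?thesis
    by (intro hpathI[of "\<lambda>t. dil r (\<gamma> t)" "\<lambda>t. r *\<^sub>R c t" "\<lambda>t. r * L t"])
       (use * in \<open>auto intro!: continuous_intros subspace_scale[OF subspace_W]\<close>)
qed

lemma hpath_sym: "hpath x y l \<Longrightarrow> hpath y x l"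
proof (elim hpathE)
  fix \<gamma> c L
  assume *: "\<And>t. (\<gamma> has_vector_derivative V (c t) (\<gamma> t)) (at t)" "continuous_on UNIV c"
    "\<And>t. c t \<in> W 1" "\<And>t. (L has_real_derivative norm (c t)) (at t)"
    "\<And>t. t \<le> 0 \<Longrightarrow> \<gamma> t = x" "\<And>t. t \<le> 0 \<Longrightarrow> c t = 0" "\<And>t. t \<le> 0 \<Longrightarrow> L t = 0"
    "\<And>t. t \<ge> 1 \<Longrightarrow> \<gamma> t = y" "\<And>t. t \<ge> 1 \<Longrightarrow> c t = 0" "\<And>t. t \<ge> 1 \<Longrightarrow> L t = l"
  have a: "((\<lambda>t. 1 - t) has_vector_derivative - 1) (at t)" for t :: real
    by (auto intro!: derivative_eq_intros)
  have "((\<lambda>t. \<gamma> (1 - t)) has_vector_derivative V (- c (1 - t)) (\<gamma> (1 - t))) (at t)" for t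
    using vector_diff_chain_at[OF a *(1)] by (simp add: o_def V_linear)
  moreover have "((\<lambda>t. l - L (1 - t)) has_real_derivative norm (- c (1 - t))) (at t)" for t
  proof -
    have "((\<lambda>t. L (1 - t)) has_real_derivative - norm (c (1 - t))) (at t)"
      using vector_diff_chain_at[OF a *(4)[unfolded has_real_derivative_iff_has_vector_derivative]]
      by (simp add: o_def has_real_derivative_iff_has_vector_derivative)
    from DERIV_diff[OF DERIV_const this, of l] show ?thesis by simp
  qed
  moreover have "continuous_on UNIV (\<lambda>t. - c (1 - t))"
    by (intro continuous_intros continuous_on_compose2[OF *(2)]) auto
  ultimately show ?thesis
    by (intro hpathI[of "\<lambda>t. \<gamma> (1 - t)" "\<lambda>t. - c (1 - t)" "\<lambda>t. l - L (1 - t)"])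
       (use * in \<open>auto intro!: subspace_neg[OF subspace_W]\<close>)
qed

lemma hpath_cut:
  assumes "hpath x y l" "0 \<le> r" "r \<le> l"
  obtains z where "hpath x z (l - r)" "hpath z y r"
proof -
  obtain \<gamma> c L where *: "\<And>t. (\<gamma> has_vector_derivative V (c t) (\<gamma> t)) (at t)" "continuous_on UNIV c"
    "\<And>t. c t \<in> W 1" "\<And>t. (L has_real_derivative norm (c t)) (at t)"
    "\<And>t. t \<le> 0 \<Longrightarrow> \<gamma> t = x" "\<And>t. t \<le> 0 \<Longrightarrow> c t = 0" "\<And>t. t \<le> 0 \<Longrightarrow> L t = 0"
    "\<And>t. t \<ge> 1 \<Longrightarrow> \<gamma> t = y" "\<And>t. t \<ge> 1 \<Longrightarrow> c t = 0" "\<And>t. t \<ge> 1 \<Longrightarrow> L t = l"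
    using assms(1) by (rule hpathE) blast
  have "\<exists>\<tau>\<ge>0. \<tau> \<le> 1 \<and> L \<tau> = l - r"
    by (rule IVT') (use assms * in \<open>auto intro!: DERIV_continuous continuous_at_imp_continuous_on\<close>)
  then obtain \<tau> where \<tau>: "0 \<le> \<tau>" "\<tau> \<le> 1" "L \<tau> = l - r" by auto
  have piece: "hpath (\<gamma> a) (\<gamma> b) (L b - L a)" if "a \<le> b" for a b
    by (rule hpath_piece[of a b \<gamma> c L, OF that])
       (use * in \<open>auto intro: has_vector_derivative_at_within has_field_derivative_at_within continuous_on_subset\<close>)
  from piece[OF \<tau>(1)] piece[OF \<tau>(2)] show ?thesis
    by (intro that[of "\<gamma> \<tau>"]) (simp_all add: * \<tau>)
qed

lemma hpath_ray:
  assumes "u \<in> W 1" shows "hpath 0 u (norm u)"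
proof -
  have "hpath (0 *\<^sub>R u) (1 *\<^sub>R u) (1 * norm u - 0 * norm u)"
    by (rule hpath_piece[of 0 1 "\<lambda>t. t *\<^sub>R u" "\<lambda>_. u" "\<lambda>t. t * norm u"])
       (use assms in \<open>auto intro!: derivative_eq_intros ray_has_vector_derivative\<close>)
  then show ?thesis by simp
qed

lemma hpath_refl: "hpath x x 0"
  using hpath_left[OF hpath_ray[OF subspace_0[OF subspace_W]], of x] by simp

end

section \<open>The distance and its balls in terms of horizontal paths\<close>

context carnot_group
begin

text \<open>This makes the control recovered from a horizontal \<open>C^1\<close> curve
  continuous.\<close>

lemma continuous_on_V_inv [continuous_intros]:
  assumes "continuous_on S f" "continuous_on S g"
  shows "continuous_on S (\<lambda>x. V_inv (f x) (g x))"
proof -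
  have "V_inv w x = (\<Sum>i\<in>UNIV. w $ i *\<^sub>R D (- x, x) (0, axis i 1))" for w x
  proof -
    have "linear (\<lambda>w. D (- x, x) (0, w))"
      by (rule linear_compose[OF _ linear_D, unfolded o_def]) (auto intro!: linearI)
    from linear_sum[OF this, of "\<lambda>i. w $ i *\<^sub>R axis i 1" UNIV]
    show ?thesis
      unfolding V_inv_def vec_expansion by (simp add: linear_scale[OF \<open>linear (\<lambda>w. D (- x, x) (0, w))\<close>])
  qed
  moreover have "continuous_on UNIV (\<lambda>z. D z v)" for v
    by (intro differentiable_imp_continuous_on differentiable_at_imp_differentiable_on)
       (simp add: differentiable_D del: split_paired_All)
  then have "continuous_on S (\<lambda>x. D (- g x, g x) (0, axis i 1))" for i
    by (rule continuous_on_compose2) (auto intro!: continuous_intros assms)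
  ultimately show ?thesis
    by (auto intro!: continuous_intros assms)
qed

lemma axis_in_layer: "wt i = j \<Longrightarrow> axis i 1 \<in> W j"
  using axis_in_W by auto

lemma horizontal_space_eq: "horizontal_space X wt x = (\<lambda>c. V c x) ` W 1"
proof -
  have "span ((\<lambda>i. V (axis i 1) x) ` {i. wt i = 1}) = (\<lambda>c. V c x) ` span ((\<lambda>i. axis i 1) ` {i. wt i = 1})"
    by (simp add: linear_span_image[OF linear_V, symmetric] image_image)
  moreover have "span ((\<lambda>i. axis i 1) ` {i. wt i = 1}) = W 1"
  proof (intro subset_antisym subsetI)
    fix v assume "v \<in> W 1"
    then have "v = (\<Sum>i | wt i = 1. v $ i *\<^sub>R axis i 1)"
      by (subst vec_expansion[of v, symmetric], intro sum.mono_neutral_right) (auto simp: W_def)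
    also have "\<dots> \<in> span ((\<lambda>i. axis i 1) ` {i. wt i = 1})"
      by (intro span_sum span_scale span_base) auto
    finally show "v \<in> span ((\<lambda>i. axis i 1) ` {i. wt i = 1})" .
  next
    fix v :: "real^'n" assume "v \<in> span ((\<lambda>i. axis i 1) ` {i. wt i = 1})"
    then show "v \<in> W 1"
      using span_minimal[OF _ subspace_W, of "(\<lambda>i. axis i 1) ` {i. wt i = 1}" 1] axis_in_layer by blast
  qed
  ultimately show ?thesis
    by (simp add: horizontal_space_def X_eq_V)
qed

lemma horizontal_norm_V:
  assumes "c \<in> W 1" shows "horizontal_norm X wt x (V c x) = norm c"
proof -
  have sqrt_W: "sqrt (\<Sum>i | wt i = 1. (v $ i)\<^sup>2) = norm v" if "v \<in> W 1" for v
  proof -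
    have "(\<Sum>i | wt i = 1. (v $ i)\<^sup>2) = (\<Sum>i\<in>UNIV. (v $ i)\<^sup>2)"
      using that by (intro sum.mono_neutral_left) (auto simp: W_def)
    then show ?thesis by (simp add: norm_vec_def L2_set_def)
  qed
  have sum_V: "(\<Sum>i | wt i = 1. a i *\<^sub>R X i x) = V (\<Sum>i | wt i = 1. a i *\<^sub>R axis i 1) x" for a
    by (simp add: V_linear X_eq_V)
  have in_W: "(\<Sum>i | wt i = 1. a i *\<^sub>R axis i 1) \<in> W 1" for a
    by (intro subspace_sum subspace_scale subspace_W axis_in_layer) auto
  have nth: "(\<Sum>i | wt i = 1. a i *\<^sub>R axis i 1) $ j = a j" if "wt j = 1" for a j
  proof -
    have "(\<Sum>i | wt i = 1. a i *\<^sub>R axis i 1) $ j = (\<Sum>i | wt i = 1. if i = j then a i else 0)"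
      unfolding sum_component by (rule sum.cong) (auto simp: axis_def)
    with that show ?thesis by simp
  qed
  show ?thesis
    unfolding horizontal_norm_def
  proof (rule the_equality)
    have "c = (\<Sum>i | wt i = 1. c $ i *\<^sub>R axis i 1)"
    proof (rule vec_eq_iff[THEN iffD2, rule_format])
      fix j
      show "c $ j = (\<Sum>i | wt i = 1. c $ i *\<^sub>R axis i 1) $ j"
      proof (cases "wt j = 1")
        case False
        then show ?thesis using assms in_W[of "\<lambda>i. c $ i"] unfolding W_def by auto
      qed (rule nth[symmetric])
    qed
    then have "V c x = (\<Sum>i | wt i = 1. c $ i *\<^sub>R X i x)"
      unfolding sum_V by simp
    then show "\<exists>a. V c x = (\<Sum>i | wt i = 1. a i *\<^sub>R X i x) \<and> norm c = sqrt (\<Sum>i | wt i = 1. (a i)\<^sup>2)"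
      using sqrt_W[OF assms] by (intro exI[of _ "\<lambda>i. c $ i"]) simp
  next
    fix r assume "\<exists>a. V c x = (\<Sum>i | wt i = 1. a i *\<^sub>R X i x) \<and> r = sqrt (\<Sum>i | wt i = 1. (a i)\<^sup>2)"
    then obtain a where a: "V c x = (\<Sum>i | wt i = 1. a i *\<^sub>R X i x)" "r = sqrt (\<Sum>i | wt i = 1. (a i)\<^sup>2)"
      by blast
    from a(1) have c: "c = (\<Sum>i | wt i = 1. a i *\<^sub>R axis i 1)"
      unfolding sum_V by (metis V_inv_V)
    have "r = sqrt (\<Sum>i | wt i = 1. (c $ i)\<^sup>2)"
      unfolding a(2) c by (intro arg_cong[of _ _ sqrt] sum.cong refl) (simp only: nth mem_Collect_eq)
    then show "r = norm c" unfolding sqrt_W[OF assms] .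
  qed
qed

lemma nn_integral_speed:
  fixes c :: "real \<Rightarrow> real^'n"
  assumes "continuous_on UNIV c"
    and L: "\<And>t. t \<in> {0..1} \<Longrightarrow> (L has_real_derivative norm (c t)) (at t within {0..1})"
  shows "(\<integral>\<^sup>+t\<in>{0..1}. ennreal (norm (c t)) \<partial>lborel) = ennreal (L 1 - L 0)"
proof -
  have I: "((\<lambda>t. norm (c t)) has_integral (L 1 - L 0)) {0..1}"
    by (rule fundamental_theorem_of_calculus)
       (use L in \<open>auto simp: has_real_derivative_iff_has_vector_derivative\<close>)
  have m: "(\<lambda>t. norm (c t)) \<in> borel_measurable borel"
    by (intro borel_measurable_continuous_onI continuous_intros assms)
  have "integral\<^sup>N lborel (\<lambda>t. norm (c t) * indicator {0..1} t) = ennreal (L 1 - L 0)"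
  proof (rule nn_integral_has_integral_lborel)
    show "((\<lambda>t. norm (c t) * indicator {0..1} t) has_integral (L 1 - L 0)) UNIV"
      using I by (subst (asm) has_integral_restrict_UNIV[symmetric])
        (simp add: indicator_def of_bool_def if_distrib cong: if_cong)
  qed (use m in auto)
  then show ?thesis
    by (simp add: ennreal_mult' ennreal_indicator)
qed

text \<open>A strict bound on an infimum is witnessed by a curve. Its control is recovered by
  \<open>V_inv\<close> and its length is the increase of an antiderivative of the speed; conversely
  an \<open>hpath\<close> is itself an admissible curve. Balls are handled in this form from here
  on.\<close>

lemma cc_dist_less_iff: "cc_dist X wt x y < ennreal r \<longleftrightarrow> (\<exists>l<r. hpath x y l)"
proof
  assume "cc_dist X wt x y < ennreal r"
  then obtain \<gamma> where \<gamma>: "horizontal_curve X wt \<gamma>" "\<gamma> 0 = x" "\<gamma> 1 = y" "cc_length X wt \<gamma> < ennreal r"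
    unfolding cc_dist_def by (auto simp: INF_less_iff)
  then obtain G where G: "\<And>t. t \<in> {0..1} \<Longrightarrow> (\<gamma> has_vector_derivative G t) (at t)" "continuous_on {0..1} G"
    unfolding horizontal_curve_def C1_differentiable_on_def by blast
  have c\<gamma>: "continuous_on {0..1} \<gamma>"
    by (intro continuous_at_imp_continuous_on ballI has_vector_derivative_continuous[OF G(1)])
  define c where "c t = V_inv (G t) (\<gamma> t)" for t
  have G_eq: "G t = V (c t) (\<gamma> t)" for t by (simp add: c_def)
  have vd: "vector_derivative \<gamma> (at t) = V (c t) (\<gamma> t)" if "t \<in> {0..1}" for t
    using vector_derivative_at[OF G(1)[OF that]] G_eq by simp
  have cW: "c t \<in> W 1" if "t \<in> {0..1}" for t
  proof -
    have "V (c t) (\<gamma> t) \<in> (\<lambda>c. V c (\<gamma> t)) ` W 1"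
      using \<gamma>(1) that vd[OF that] unfolding horizontal_curve_def horizontal_space_eq by metis
    then show ?thesis by (metis V_inv_V imageE)
  qed
  have cc: "continuous_on {0..1} c"
    unfolding c_def by (intro continuous_on_V_inv G c\<gamma>)
  obtain L where L: "\<And>t. t \<in> {0..1} \<Longrightarrow> (L has_real_derivative norm (c t)) (at t within {0..1})"
    using antiderivative_continuous[OF continuous_on_norm[OF cc]]
    unfolding has_real_derivative_iff_has_vector_derivative by blast
  have hpath: "hpath x y (L 1 - L 0)"
    using hpath_piece[of 0 1 \<gamma> c L] \<gamma> G(1) G_eq cc cW L
    by (simp add: has_vector_derivative_at_within)
  \<comment> \<open>The control is known only over the unit interval; freezing it outside gives a
    control that is continuous on the whole line, as \<open>nn_integral_speed\<close> asks.\<close>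
  define e where "e t = c (max 0 (min 1 t))" for t
  have e: "continuous_on UNIV e" "\<And>t. t \<in> {0..1} \<Longrightarrow> e t = c t"
    unfolding e_def
    by (intro continuous_on_compose2[OF cc] continuous_intros) (auto simp: max_def min_def)
  have "cc_length X wt \<gamma> = (\<integral>\<^sup>+t\<in>{0..1}. ennreal (norm (e t)) \<partial>lborel)"
    unfolding cc_length_def
    by (intro nn_integral_cong) (auto simp: indicator_def vd e horizontal_norm_V[OF cW])
  also have "\<dots> = ennreal (L 1 - L 0)"
    by (rule nn_integral_speed) (use e L in auto)
  finally have "ennreal (L 1 - L 0) < ennreal r" using \<gamma>(4) by simp
  then have "L 1 - L 0 < r"
    using hpath_nonneg[OF hpath] by (simp add: ennreal_less_iff)
  with hpath show "\<exists>l<r. hpath x y l" by blast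
next
  assume "\<exists>l<r. hpath x y l"
  then obtain l where l: "l < r" "hpath x y l" by blast
  from l(2) have "\<exists>\<gamma>. horizontal_curve X wt \<gamma> \<and> \<gamma> 0 = x \<and> \<gamma> 1 = y \<and> cc_length X wt \<gamma> = ennreal l"
  proof (elim hpathE)
    fix \<gamma> c L
    assume *: "\<And>t. (\<gamma> has_vector_derivative V (c t) (\<gamma> t)) (at t)" "continuous_on UNIV c"
      "\<And>t. c t \<in> W 1" "\<And>t. (L has_real_derivative norm (c t)) (at t)"
      "\<And>t. t \<le> 0 \<Longrightarrow> \<gamma> t = x" "\<And>t. t \<le> 0 \<Longrightarrow> c t = 0" "\<And>t. t \<le> 0 \<Longrightarrow> L t = 0"
      "\<And>t. t \<ge> 1 \<Longrightarrow> \<gamma> t = y" "\<And>t. t \<ge> 1 \<Longrightarrow> c t = 0" "\<And>t. t \<ge> 1 \<Longrightarrow> L t = l"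
    have c\<gamma>: "continuous_on {0..1} \<gamma>"
      by (intro continuous_at_imp_continuous_on ballI has_vector_derivative_continuous[OF *(1)])
    have V_sum: "V (c t) (\<gamma> t) = (\<Sum>i\<in>UNIV. c t $ i *\<^sub>R V (axis i 1) (\<gamma> t))" for t
      by (subst vec_expansion[of "c t", symmetric]) (simp only: V_linear)
    have "continuous_on {0..1} (\<lambda>t. V (c t) (\<gamma> t))"
      unfolding V_sum by (intro continuous_intros c\<gamma> continuous_on_subset[OF *(2)]) auto
    then have "\<gamma> C1_differentiable_on {0..1}"
      unfolding C1_differentiable_on_def
      by (intro exI[of _ "\<lambda>t. V (c t) (\<gamma> t)"] conjI ballI *(1))
    moreover have vd: "vector_derivative \<gamma> (at t) = V (c t) (\<gamma> t)" for t
      by (rule vector_derivative_at[OF *(1)])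
    ultimately have "horizontal_curve X wt \<gamma>"
      unfolding horizontal_curve_def horizontal_space_eq using *(3) by auto
    moreover have "cc_length X wt \<gamma> = ennreal (L 1 - L 0)"
      unfolding cc_length_def vd horizontal_norm_V[OF *(3)]
      by (rule nn_integral_speed) (use * in \<open>auto intro: has_field_derivative_at_within\<close>)
    ultimately show ?thesis using * by (intro exI[of _ \<gamma>]) simp
  qed
  then have "cc_dist X wt x y \<le> ennreal l"
    unfolding cc_dist_def by (auto intro!: INF_lower2)
  also have "\<dots> < ennreal r"
    using l hpath_nonneg by (simp add: ennreal_less_iff)
  finally show "cc_dist X wt x y < ennreal r" .
qed

lemma mem_cc_ball: "y \<in> cc_ball X wt x r \<longleftrightarrow> (\<exists>l<r. hpath x y l)"
  by (simp add: cc_ball_def cc_dist_less_iff)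

lemma cc_ball_eq_image:
  assumes "r > 0"
  shows "cc_ball X wt x r = (\<lambda>y. x \<otimes> y) ` dil r ` cc_ball X wt 0 1"
proof (intro subset_antisym subsetI)
  fix y assume "y \<in> cc_ball X wt x r"
  then obtain l where l: "l < r" "hpath x y l" by (auto simp: mem_cc_ball)
  have "hpath 0 (dil (1 / r) (- x \<otimes> y)) (1 / r * l)"
    using hpath_dil[OF hpath_left[OF l(2), of "- x"], of "1 / r"] assms by simp
  then have "dil (1 / r) (- x \<otimes> y) \<in> cc_ball X wt 0 1"
    using l assms by (auto simp: mem_cc_ball intro!: exI[of _ "l / r"])
  moreover have "y = x \<otimes> dil r (dil (1 / r) (- x \<otimes> y))"
    using assms by (simp add: dil_dil)
  ultimately show "y \<in> (\<lambda>y. x \<otimes> y) ` dil r ` cc_ball X wt 0 1" by blast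
next
  fix y assume "y \<in> (\<lambda>y. x \<otimes> y) ` dil r ` cc_ball X wt 0 1"
  then obtain u l where "y = x \<otimes> dil r u" "l < 1" "hpath 0 u l" by (auto simp: mem_cc_ball)
  then show "y \<in> cc_ball X wt x r"
    using hpath_left[OF hpath_dil[of 0 u l r], of x] assms
    by (auto simp: mem_cc_ball intro!: exI[of _ "r * l"])
qed

text \<open>On the Euclidean unit ball the frame is bounded by \<open>M\<close>, so a path from 0 of
  length below \<open>1 / M\<close> cannot reach the unit sphere. A dilation brings paths of length
  below 1 into this regime.\<close>

lemma bounded_unit_cc_ball: "bounded (cc_ball X wt 0 1)"
proof -
  have "\<exists>K. \<forall>x\<in>cball 0 1. norm (V (axis i 1) x) \<le> K" for i
  proof -
    have "compact ((\<lambda>x. V (axis i 1) x) ` cball 0 1)"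
      by (intro compact_continuous_image continuous_intros) auto
    then show ?thesis
      using compact_imp_bounded bounded_iff by (metis image_eqI)
  qed
  then obtain K where "\<And>i x. x \<in> cball 0 1 \<Longrightarrow> norm (V (axis i 1) x) \<le> K i"
    by metis
  then have K: "\<And>i x. norm x \<le> 1 \<Longrightarrow> norm (V (axis i 1) x) \<le> K i"
    by simp
  define M where "M = 1 + (\<Sum>i\<in>UNIV. \<bar>K i\<bar>)"
  have M: "M > 0" unfolding M_def by (smt (verit) sum_nonneg abs_ge_zero)
  have VM: "norm (V c x) \<le> M * norm c" if "norm x \<le> 1" for c x
  proof -
    have "norm (V c x) = norm (\<Sum>i\<in>UNIV. c $ i *\<^sub>R V (axis i 1) x)"
      by (subst vec_expansion[of c, symmetric]) (simp only: V_linear)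
    also have "\<dots> \<le> (\<Sum>i\<in>UNIV. norm c * \<bar>K i\<bar>)"
    proof (rule sum_norm_le)
      fix i
      have "norm (V (axis i 1) x) \<le> \<bar>K i\<bar>" using K[OF that, of i] by linarith
      then show "norm (c $ i *\<^sub>R V (axis i 1) x) \<le> norm c * \<bar>K i\<bar>"
        using component_le_norm_cart[of c i] by (simp add: mult_mono)
    qed
    also have "\<dots> \<le> M * norm c"
      by (simp add: M_def sum_distrib_left[symmetric] algebra_simps)
    finally show ?thesis .
  qed
  have small: "norm y < 1" if "hpath 0 y l" "M * l < 1" for y l
    using that(1)
  proof (elim hpathE)
    fix \<gamma> c L
    assume *: "\<And>t. (\<gamma> has_vector_derivative V (c t) (\<gamma> t)) (at t)"
      "\<And>t. (L has_real_derivative norm (c t)) (at t)"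
      "\<And>t. t \<le> 0 \<Longrightarrow> \<gamma> t = 0" "\<And>t. t \<le> 0 \<Longrightarrow> L t = 0"
      "\<And>t. t \<ge> 1 \<Longrightarrow> \<gamma> t = y" "\<And>t. t \<ge> 1 \<Longrightarrow> L t = l"
    have c\<gamma>: "continuous_on A \<gamma>" for A
      by (intro continuous_at_imp_continuous_on ballI has_vector_derivative_continuous[OF *(1)])
    have cL: "continuous_on A L" for A
      using *(2) by (auto intro!: DERIV_continuous continuous_at_imp_continuous_on)
    have Lmono: "L a \<le> L b" if "a \<le> b" for a b
      by (rule DERIV_nonneg_imp_nondecreasing[OF that]) (use *(2) norm_ge_zero in blast)
    show "norm y < 1"
    proof (rule ccontr)
      assume "\<not> norm y < 1"
      then have "\<exists>t\<ge>0. t \<le> 1 \<and> norm (\<gamma> t) = 1"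
        using * by (intro IVT' continuous_intros c\<gamma>) auto
      then have ne: "{t \<in> {0..1}. norm (\<gamma> t) = 1} \<noteq> {}" by auto
      have "closed {t \<in> {0..1}. norm (\<gamma> t) = 1}"
        by (rule continuous_closed_preimage_constant) (intro continuous_intros c\<gamma>, simp)
      then have "compact {t \<in> {0..1}. norm (\<gamma> t) = 1}"
        by (simp add: compact_eq_bounded_closed bounded_subset[of "{0..1}"] subset_iff)
      \<comment> \<open>The first time on the unit sphere; up to then the path stays in the region
        where the bound \<open>VM\<close> holds.\<close>
      then obtain \<tau> where \<tau>: "\<tau> \<in> {0..1}" "norm (\<gamma> \<tau>) = 1"
        and min: "\<And>t. t \<in> {0..1} \<Longrightarrow> norm (\<gamma> t) = 1 \<Longrightarrow> \<tau> \<le> t"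
        using compact_attains_inf[OF _ ne] by blast
      have le: "norm (\<gamma> t) \<le> 1" if "0 \<le> t" "t < \<tau>" for t
      proof (rule ccontr)
        assume "\<not> norm (\<gamma> t) \<le> 1"
        then have "\<exists>s\<ge>0. s \<le> t \<and> norm (\<gamma> s) = 1"
          using * that by (intro IVT' continuous_intros c\<gamma>) auto
        then obtain s where "0 \<le> s" "s \<le> t" "norm (\<gamma> s) = 1" by blast
        with min[of s] that \<tau> show False by auto
      qed
      have "0 < \<tau>" using \<tau> *(3)[of 0] by (cases "\<tau> = 0") auto
      have "norm (\<gamma> \<tau> - \<gamma> 0) \<le> M * L \<tau> - M * L 0"
      proof (rule differentiable_bound_general[OF \<open>0 < \<tau>\<close> c\<gamma>])
        show "continuous_on {0..\<tau>} (\<lambda>t. M * L t)" by (intro continuous_intros cL)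
        show "((\<lambda>t. M * L t) has_vector_derivative M * norm (c t)) (at t)" for t
          using DERIV_cmult[OF *(2)] by (simp add: has_real_derivative_iff_has_vector_derivative)
        show "norm (V (c t) (\<gamma> t)) \<le> M * norm (c t)" if "0 < t" "t < \<tau>" for t
          by (rule VM) (use le that in auto)
      qed (rule *(1))
      also have "\<dots> \<le> M * l"
        using Lmono[of \<tau> 1] \<tau> M * by simp
      finally show False using \<tau> * that(2) by simp
    qed
  qed
  \<comment> \<open>With this factor a path of length \<open>l < 1\<close> becomes one with
    \<open>M * (r * l) = l / 2 < 1\<close>.\<close>
  define r where "r = 1 / (2 * M)"
  have r: "r > 0" using M by (simp add: r_def)
  have "cc_ball X wt 0 1 \<subseteq> dil (1 / r) ` ball 0 1"
  proof
    fix y assume "y \<in> cc_ball X wt 0 1"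
    then obtain l where l: "l < 1" "hpath 0 y l" by (auto simp: mem_cc_ball)
    have "norm (dil r y) < 1"
    proof (rule small)
      show "hpath 0 (dil r y) (r * l)" using hpath_dil[OF l(2) r] by simp
      show "M * (r * l) < 1" using l M by (simp add: r_def)
    qed
    moreover have "y = dil (1 / r) (dil r y)" using r by (simp add: dil_dil)
    ultimately show "y \<in> dil (1 / r) ` ball 0 1" by auto
  qed
  moreover have "bounded (dil (1 / r) ` ball 0 1)"
    by (intro bounded_linear_image bounded_ball bounded_linear_dil)
  ultimately show ?thesis by (rule bounded_subset[rotated])
qed

end

section \<open>Carnot-Caratheodory balls\<close>

context carnot_group
begin

text \<open>Horizontal directions transported by reachable elements. Since conjugation is linear,
  the whole line of such a direction is reachable: go along \<open>h\<close>, then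
  \<open>s *\<^sub>R v\<close>, then back along the inverse of \<open>h\<close>.\<close>

definition ad_orbit :: "(real^'n) set" where
  "ad_orbit = {conj_by h v | h v l. hpath 0 h l \<and> v \<in> W 1}"

lemma conj_by_ray_span_ad_orbit:
  assumes "u \<in> W 1" "z \<in> span ad_orbit"
  shows "conj_by u z \<in> span ad_orbit"
  using assms(2)
proof (induction rule: span_induct_alt)
  case base
  then show ?case by (simp add: span_0)
next
  case (step c x y)
  then obtain h v l where x: "x = conj_by h v" "hpath 0 h l" "v \<in> W 1"
    unfolding ad_orbit_def by blast
  have "hpath 0 (u \<otimes> h) (norm u + l)"
    using hpath_trans[OF hpath_ray[OF assms(1)]] hpath_left[OF x(2), of u] by simp
  then have "conj_by u x \<in> ad_orbit"
    unfolding ad_orbit_def using x conj_by_compose by blast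
  with step.IH show ?case
    by (simp add: conj_by_linear span_add span_scale span_base)
qed

text \<open>The bracket is the derivative at 0 of conjugates that stay in the span, and a
  finite-dimensional subspace is closed.\<close>

lemma bracket_span_ad_orbit:
  assumes "u \<in> W 1" "z \<in> span ad_orbit"
  shows "bracket u z \<in> span ad_orbit"
  by (rule has_vector_derivative_in_subspace[OF conj_by_ray_has_vector_derivative subspace_span])
     (intro conj_by_ray_span_ad_orbit subspace_scale subspace_W assms)

lemma span_ad_orbit: "span ad_orbit = UNIV"
proof -
  have W: "W (Suc j) \<subseteq> span ad_orbit" for j
  proof (induction j)
    case 0
    have "v \<in> ad_orbit" if "v \<in> W 1" for v
      unfolding ad_orbit_def using that hpath_refl[of 0] conj_by_0(1)[of v, symmetric] by blast
    then show ?case by (auto intro: span_base)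
  next
    case (Suc j)
    have "W (Suc (Suc j)) \<subseteq> span {bracket u v | u v. u \<in> W 1 \<and> v \<in> W (Suc j)}"
      by (rule W_Suc_subset_span) simp
    also have "\<dots> \<subseteq> span ad_orbit"
      by (rule span_minimal[OF _ subspace_span]) (use Suc bracket_span_ad_orbit in auto)
    finally show ?case .
  qed
  have "axis i 1 \<in> span ad_orbit" for i
    using W[of "wt i - 1"] axis_in_W[of i] wt_range[of i] by auto
  then have "v \<in> span ad_orbit" for v
    by (subst vec_expansion[of v, symmetric]) (intro span_sum span_scale)
  then show ?thesis by auto
qed

text \<open>A product of rays in the directions of the list, with lengths given by linear
  functionals. When these are the coordinates of \<open>y\<close> in a basis, the derivative at 0 is
  the identity.\<close>

fun prod_curve :: "(real^'n \<Rightarrow> real^'n \<Rightarrow> real) \<Rightarrow> (real^'n) list \<Rightarrow> real^'n \<Rightarrow> real^'n" where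
  "prod_curve \<kappa> [] y = 0"
| "prod_curve \<kappa> (b # bs) y = (\<kappa> b y *\<^sub>R b) \<otimes> prod_curve \<kappa> bs y"

lemma prod_curve_0:
  assumes "\<And>b. linear (\<kappa> b)"
  shows "prod_curve \<kappa> bs 0 = 0"
  by (induction bs) (simp_all add: linear_0[OF assms])

lemma prod_curve_has_derivative:
  assumes "\<And>b. bounded_linear (\<kappa> b)"
  shows "(prod_curve \<kappa> bs has_derivative (\<lambda>y. \<Sum>b\<leftarrow>bs. \<kappa> b y *\<^sub>R b)) (at 0)"
proof (induction bs)
  case (Cons b bs)
  have 0: "\<kappa> b 0 = 0" "prod_curve \<kappa> bs 0 = 0"
    using assms linear_0 prod_curve_0[of \<kappa> bs] bounded_linear.linear by blast+
  have "((\<lambda>y. \<kappa> b y *\<^sub>R b) has_derivative (\<lambda>y. \<kappa> b y *\<^sub>R b)) (at 0)"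
    by (intro bounded_linear_imp_has_derivative bounded_linear_scaleR_const assms)
  from mult_has_derivative[OF this Cons] show ?case
    by (simp add: 0 D_split)
qed simp

lemma continuous_on_prod_curve:
  assumes "\<And>b. bounded_linear (\<kappa> b)"
  shows "continuous_on S (prod_curve \<kappa> bs)"
proof (induction bs)
  case (Cons b bs)
  then show ?case
    by (simp, intro continuous_on_mult_group[OF continuous_on_scaleR[OF linear_continuous_on continuous_on_const]] assms)
qed simp

lemma hpath_scaled_ad_orbit:
  assumes "b \<in> ad_orbit"
  obtains m v where "0 \<le> m" "\<And>s. hpath 0 (s *\<^sub>R b) (m + \<bar>s\<bar> * norm (v :: real^'n))"
proof -
  obtain h v l where b: "b = conj_by h v" "hpath 0 h l" "v \<in> W 1"
    using assms unfolding ad_orbit_def by blast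
  \<comment> \<open>The path \<open>h\<close> is run once forwards and once, translated, backwards:
    this is the part \<open>2 * l\<close> independent of \<open>s\<close>.\<close>
  have "hpath 0 (s *\<^sub>R b) (2 * l + \<bar>s\<bar> * norm v)" for s
  proof -
    have "hpath 0 (- h) l"
      using hpath_sym[OF hpath_left[OF b(2), of "- h"]] by simp
    from hpath_left[OF this, of "h \<otimes> s *\<^sub>R v"]
    have 1: "hpath (h \<otimes> s *\<^sub>R v) (s *\<^sub>R b) l"
      unfolding b(1) conj_by_linear[symmetric] by (simp add: conj_by_def)
    have "hpath h (h \<otimes> s *\<^sub>R v) (\<bar>s\<bar> * norm v)"
      using hpath_left[OF hpath_ray[OF subspace_scale[OF subspace_W b(3)]], of h s] by simp
    from hpath_trans[OF hpath_trans[OF b(2) this] 1] show ?thesis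
      by (simp add: algebra_simps)
  qed
  then show ?thesis
    using hpath_nonneg[OF b(2)] by (intro that[of "2 * l" v]) auto
qed

lemma prod_curve_reach:
  assumes "\<And>b. bounded_linear (\<kappa> b)" "set bs \<subseteq> ad_orbit"
  shows "\<exists>L. \<forall>y\<in>ball 0 1. \<exists>l\<le>L. hpath 0 (prod_curve \<kappa> bs y) l"
  using assms(2)
proof (induction bs)
  case Nil
  then show ?case using hpath_refl by auto
next
  case (Cons b bs)
  then have "\<exists>L. \<forall>y\<in>ball 0 1. \<exists>l\<le>L. hpath 0 (prod_curve \<kappa> bs y) l"
    by simp
  then obtain L where L: "\<And>y. y \<in> ball 0 1 \<Longrightarrow> \<exists>l\<le>L. hpath 0 (prod_curve \<kappa> bs y) l"
    by blast
  obtain m v where mv: "0 \<le> m" "\<And>s. hpath 0 (s *\<^sub>R b) (m + \<bar>s\<bar> * norm (v :: real^'n))"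
    using hpath_scaled_ad_orbit[of b] Cons.prems by auto
  obtain K where K: "\<And>y. norm (\<kappa> b y) \<le> norm y * K" "0 \<le> K"
    using bounded_linear.nonneg_bounded[OF assms(1)] by blast
  show ?case
  proof (rule exI[of _ "m + K * norm v + L"], rule ballI)
    fix y :: "real^'n" assume y: "y \<in> ball 0 1"
    then obtain l where l: "l \<le> L" "hpath 0 (prod_curve \<kappa> bs y) l" using L by blast
    have "norm y * K \<le> 1 * K"
      by (rule mult_right_mono) (use y K in auto)
    then have "\<bar>\<kappa> b y\<bar> \<le> K" using K(1)[of y] by simp
    then have "\<bar>\<kappa> b y\<bar> * norm v \<le> K * norm v" by (rule mult_right_mono) simp
    moreover have "hpath 0 (prod_curve \<kappa> (b # bs) y) (m + \<bar>\<kappa> b y\<bar> * norm v + l)"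
      using hpath_trans[OF mv(2)[of "\<kappa> b y"]] hpath_left[OF l(2), of "\<kappa> b y *\<^sub>R b"] by simp
    ultimately show "\<exists>l\<le>m + K * norm v + L. hpath 0 (prod_curve \<kappa> (b # bs) y) l"
      using l(1) by (intro exI[of _ "m + \<bar>\<kappa> b y\<bar> * norm v + l"]) simp
  qed
qed

text \<open>A basis is extracted from \<open>ad_orbit\<close>, so the product of rays has the
  identity as derivative at 0. Sussmann's open mapping theorem, which needs continuity and a right
  inverse of the derivative at one point, shows that the reached points fill a neighbourhood of
  0.\<close>

lemma open_reachable:
  obtains U L where "open U" "0 \<in> U" "\<And>y. y \<in> U \<Longrightarrow> \<exists>l\<le>L. hpath 0 y l"
proof -
  obtain A where A: "A \<subseteq> ad_orbit" "independent A" "ad_orbit \<subseteq> span A"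
    using maximal_independent_subset by metis
  have sp: "span A = UNIV"
    using span_minimal[OF A(3) subspace_span] span_ad_orbit by auto
  have fin: "finite A" using A(2) by (rule independent_imp_finite)
  then obtain bs where bs: "set bs = A" "distinct bs"
    using finite_distinct_list by blast
  define \<kappa> where "\<kappa> b y = representation A y b" for b y
  have \<kappa>: "bounded_linear (\<kappa> b)" for b
  proof -
    have "linear (\<kappa> b)"
      by (rule linearI) (simp_all add: \<kappa>_def representation_add representation_scale A(2) sp)
    then show ?thesis using linear_conv_bounded_linear by blast
  qed
  have "(\<Sum>b\<leftarrow>bs. \<kappa> b y *\<^sub>R b) = y" for y
    using sum_representation_eq[OF A(2) _ fin order_refl, of y] bs
    by (simp add: \<kappa>_def sp sum_list_distinct_conv_sum_set)
  then have "(prod_curve \<kappa> bs has_derivative (\<lambda>y. y)) (at 0)"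
    using prod_curve_has_derivative[of \<kappa> bs, OF \<kappa>] by simp
  then have "prod_curve \<kappa> bs 0 \<in> interior (prod_curve \<kappa> bs ` ball 0 1)"
    by (rule sussmann_open_mapping[OF open_UNIV continuous_on_prod_curve[of \<kappa>, OF \<kappa>] UNIV_I _ bounded_linear_ident])
       (auto simp: interior_open)
  then have "0 \<in> interior (prod_curve \<kappa> bs ` ball 0 1)"
    using prod_curve_0[of \<kappa> bs, OF bounded_linear.linear[OF \<kappa>]] by simp
  moreover obtain L where "\<forall>y\<in>ball 0 1. \<exists>l\<le>L. hpath 0 (prod_curve \<kappa> bs y) l"
    using prod_curve_reach[of \<kappa> bs, OF \<kappa>] bs A(1) by blast
  ultimately show ?thesis
    using interior_subset by (intro that[of "interior (prod_curve \<kappa> bs ` ball 0 1)" L]) blast+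
qed

section \<open>Openness, boundedness and volume of arbitrary balls\<close>

lemma open_left_mult_image: "open S \<Longrightarrow> open ((\<lambda>y. x \<otimes> y) ` S)"
proof -
  assume S: "open S"
  have "(\<lambda>y. x \<otimes> y) ` S = (\<lambda>y. - x \<otimes> y) -` S"
    by (force simp: image_iff intro: bexI[of _ "- x \<otimes> _"])
  moreover have "open ((\<lambda>y. - x \<otimes> y) -` S)"
    by (rule open_vimage[OF S]) (intro continuous_intros)
  ultimately show ?thesis by simp
qed

lemma open_dil_image: "open S \<Longrightarrow> r > 0 \<Longrightarrow> open (dil r ` S)"
proof -
  assume S: "open S" "r > 0"
  have "dil r ` S = dil (1 / r) -` S"
    using S(2) by (force simp: image_iff dil_dil intro: bexI[of _ "dil (1 / r) _"])
  moreover have "open (dil (1 / r) -` S)"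
    by (rule open_vimage[OF S(1)]) (intro linear_continuous_on bounded_linear_dil)
  ultimately show ?thesis by simp
qed

lemma open_unit_cc_ball: "open (cc_ball X wt 0 1)"
proof -
  obtain U L where U: "open U" "0 \<in> U" "\<And>y. y \<in> U \<Longrightarrow> \<exists>l\<le>L. hpath 0 y l"
    by (rule open_reachable) blast
  define M where "M = \<bar>L\<bar> + 1"
  show ?thesis
  proof (subst open_subopen, intro ballI)
    fix y assume "y \<in> cc_ball X wt 0 1"
    then obtain l where l: "l < 1" "hpath 0 y l" by (auto simp: mem_cc_ball)
    \<comment> \<open>Every point of \<open>U\<close> is reached with length below \<open>M\<close>;
      dilated by \<open>r\<close>, this stays below the length \<open>1 - l\<close> left over at
      \<open>y\<close>.\<close>
    define r where "r = (1 - l) / M"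
    have r: "r > 0" using l by (simp add: r_def M_def)
    have "y \<otimes> dil r u \<in> cc_ball X wt 0 1" if u: "u \<in> U" for u
    proof -
      obtain m where m: "m \<le> L" "hpath 0 u m" using U(3)[OF u] by blast
      have "hpath 0 (y \<otimes> dil r u) (l + r * m)"
        using hpath_trans[OF l(2)] hpath_left[OF hpath_dil[OF m(2) r], of y] by simp
      moreover have "r * m < r * M"
        by (rule mult_strict_left_mono) (use m r in \<open>auto simp: M_def\<close>)
      then have "r * m < 1 - l" by (simp add: r_def M_def)
      ultimately show ?thesis by (auto simp: mem_cc_ball intro!: exI[of _ "l + r * m"])
    qed
    then have "(\<lambda>z. y \<otimes> z) ` dil r ` U \<subseteq> cc_ball X wt 0 1" by auto
    moreover have "open ((\<lambda>z. y \<otimes> z) ` dil r ` U)"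
      by (intro open_left_mult_image open_dil_image U r)
    moreover have "y \<in> (\<lambda>z. y \<otimes> z) ` dil r ` U"
      using U(2) by (intro image_eqI[of _ _ "dil r 0"] imageI) simp_all
    ultimately show "\<exists>T. open T \<and> y \<in> T \<and> T \<subseteq> cc_ball X wt 0 1" by blast
  qed
qed

lemma open_cc_ball: "r > 0 \<Longrightarrow> open (cc_ball X wt x r)"
  by (subst cc_ball_eq_image) (simp_all add: open_left_mult_image open_dil_image open_unit_cc_ball)

lemma bounded_left_mult_image: "bounded S \<Longrightarrow> bounded ((\<lambda>y. x \<otimes> y) ` S)"
proof -
  assume "bounded S"
  then have "compact (closure S)" by (simp add: compact_closure)
  then have "compact ((\<lambda>y. x \<otimes> y) ` closure S)"
    by (intro compact_continuous_image continuous_intros)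
  then show ?thesis
    using bounded_subset[OF compact_imp_bounded] closure_subset by (metis image_mono)
qed

lemma bounded_dil_image: "bounded S \<Longrightarrow> bounded (dil r ` S)"
  by (intro bounded_linear_image bounded_linear_dil)

lemma bounded_cc_ball: "r > 0 \<Longrightarrow> bounded (cc_ball X wt x r)"
  by (subst cc_ball_eq_image) (simp_all add: bounded_left_mult_image bounded_dil_image bounded_unit_cc_ball)

lemma emeasure_translated_dilated:
  assumes "open S" "bounded S" "r > 0"
  shows "emeasure lebesgue ((\<lambda>y. x \<otimes> y) ` dil r ` S) = ennreal (r ^ homogeneous_dim wt k) * emeasure lebesgue S"
proof -
  have "emeasure lebesgue ((\<lambda>y. x \<otimes> y) ` dil r ` S) = emeasure lebesgue (dil r ` S)"
    by (intro emeasure_left_mult_image open_left_mult_image open_dil_image bounded_dil_image assms)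
  also have "\<dots> = ennreal (r ^ homogeneous_dim wt k) * emeasure lebesgue S"
    by (rule emeasure_dil_image[OF assms])
  finally show ?thesis .
qed

lemma emeasure_cc_ball:
  obtains \<beta> where "\<beta> > 0" "\<And>x r. r > 0 \<Longrightarrow>
    emeasure lebesgue (cc_ball X wt x r) = ennreal (\<beta> * r ^ homogeneous_dim wt k)"
proof -
  let ?U = "cc_ball X wt 0 1"
  define \<beta> where "\<beta> = measure lebesgue ?U"
  have lm: "?U \<in> lmeasurable"
    by (rule lmeasurable_open[OF bounded_unit_cc_ball open_unit_cc_ball])
  have "0 \<in> ?U"
    using hpath_refl[of 0] by (auto simp: mem_cc_ball intro!: exI[of _ 0])
  then have "\<beta> \<noteq> 0"
    using open_not_negligible[OF open_unit_cc_ball] lm by (auto simp: \<beta>_def negligible_iff_measure)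
  then have "\<beta> > 0" by (simp add: \<beta>_def zero_less_measure_iff)
  moreover have "emeasure lebesgue ?U = ennreal \<beta>"
    using lm by (simp add: \<beta>_def emeasure_eq_measure2)
  moreover have "emeasure lebesgue (cc_ball X wt x r) = ennreal (\<beta> * r ^ homogeneous_dim wt k)"
    if "r > 0" for x r
    unfolding cc_ball_eq_image[OF that]
      emeasure_translated_dilated[OF open_unit_cc_ball bounded_unit_cc_ball that]
      \<open>emeasure lebesgue ?U = ennreal \<beta>\<close>
    using that \<open>\<beta> > 0\<close> by (simp add: ennreal_mult' mult.commute)
  ultimately show ?thesis
    using that by blast
qed

end

section \<open>A fractional Poincare-Sobolev inequality from chains of balls\<close>

lemma mean_dist_le:
  fixes f :: "'a \<Rightarrow> real"
  assumes f: "integrable M f" and D: "D \<in> sets M" "emeasure M D = ennreal d" "0 < d"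
  shows "ennreal \<bar>c - (LINT z:D|M. f z) / d\<bar> \<le> ennreal (1 / d) * (\<integral>\<^sup>+z\<in>D. ennreal \<bar>c - f z\<bar> \<partial>M)"
proof -
  have mD: "measure M D = d" using D by (simp add: measure_def)
  have fD: "set_integrable M D f"
    using integrable_mult_indicator[OF D(1) f] by (simp add: set_integrable_def)
  have cD: "set_integrable M D (\<lambda>_. c)"
    using D by (simp add: set_integrable_def integrable_indicator_iff)
  have "(LINT z:D|M. c - f z) = c * d - (LINT z:D|M. f z)"
    using set_integral_diff(2)[OF cD fD] D mD by (simp add: set_lebesgue_integral_def)
  then have "c - (LINT z:D|M. f z) / d = (1 / d) * (LINT z:D|M. c - f z)"
    using D by (simp add: field_simps)
  then have "ennreal \<bar>c - (LINT z:D|M. f z) / d\<bar> = ennreal (1 / d) * ennreal (norm (LINT z:D|M. c - f z))"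
    using D by (simp add: abs_mult ennreal_mult flip: ennreal_mult)
  also have "ennreal (norm (LINT z:D|M. c - f z)) \<le> (\<integral>\<^sup>+z. ennreal (norm (indicator D z *\<^sub>R (c - f z))) \<partial>M)"
    unfolding set_lebesgue_integral_def
    by (rule integral_norm_bound_ennreal) (use set_integral_diff(1)[OF cD fD] in \<open>simp add: set_integrable_def\<close>)
  also have "\<dots> = (\<integral>\<^sup>+z\<in>D. ennreal \<bar>c - f z\<bar> \<partial>M)"
    by (intro nn_integral_cong) (auto simp: indicator_def)
  finally show ?thesis by (simp add: mult_left_mono)
qed

lemma mean_mean_dist_le:
  fixes f :: "'a \<Rightarrow> real"
  assumes f: "integrable M f" and D: "D \<in> sets M" "emeasure M D = ennreal d" "0 < d"
    and D': "D' \<in> sets M" "emeasure M D' = ennreal d'" "0 < d'"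
  shows "ennreal \<bar>(LINT z:D|M. f z) / d - (LINT z:D'|M. f z) / d'\<bar>
    \<le> ennreal (1 / d) * (\<integral>\<^sup>+y\<in>D. ennreal (1 / d') * (\<integral>\<^sup>+z\<in>D'. ennreal \<bar>f y - f z\<bar> \<partial>M) \<partial>M)"
proof -
  let ?c = "(LINT z:D'|M. f z) / d'"
  have "ennreal \<bar>(LINT z:D|M. f z) / d - ?c\<bar> \<le> ennreal (1 / d) * (\<integral>\<^sup>+y\<in>D. ennreal \<bar>?c - f y\<bar> \<partial>M)"
    using mean_dist_le[OF f D, of ?c] by (simp add: abs_minus_commute)
  also have "\<dots> \<le> ennreal (1 / d) * (\<integral>\<^sup>+y\<in>D. ennreal (1 / d') * (\<integral>\<^sup>+z\<in>D'. ennreal \<bar>f y - f z\<bar> \<partial>M) \<partial>M)"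
    by (intro mult_left_mono nn_integral_mono mult_right_mono)
       (use mean_dist_le[OF f D'] in \<open>simp_all add: abs_minus_commute\<close>)
  finally show ?thesis .
qed

text \<open>Otherwise telescoping would bound the distance from \<open>m 0\<close> to the limit by
  half of itself. The total 1/2 instead of 1 yields the contradiction although only weak
  inequalities survive the limit.\<close>

lemma ex_large_increment:
  fixes m w :: "nat \<Rightarrow> real"
  assumes lim: "m \<longlonglongrightarrow> t" and w: "\<And>n. (\<Sum>j<n. w j) \<le> 1 / 2" and "t \<noteq> m 0"
  shows "\<exists>j. \<bar>t - m 0\<bar> * w j \<le> \<bar>m j - m (Suc j)\<bar>"
proof (rule ccontr)
  define T where "T = \<bar>t - m 0\<bar>"
  assume "\<not> ?thesis"
  then have less: "\<bar>m j - m (Suc j)\<bar> \<le> T * w j" for j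
    by (simp add: T_def not_le less_imp_le)
  have "\<bar>m n - m 0\<bar> \<le> T / 2" for n
  proof -
    have "m n - m 0 = (\<Sum>j<n. m (Suc j) - m j)"
      by (rule sum_lessThan_telescope[symmetric])
    then have "\<bar>m n - m 0\<bar> \<le> (\<Sum>j<n. \<bar>m (Suc j) - m j\<bar>)"
      by (simp add: sum_abs)
    also have "\<dots> \<le> (\<Sum>j<n. T * w j)"
      by (intro sum_mono) (use less in \<open>simp add: abs_minus_commute\<close>)
    also have "\<dots> \<le> T * (1 / 2)"
      unfolding sum_distrib_left[symmetric] by (intro mult_left_mono w) (simp add: T_def)
    finally show ?thesis by simp
  qed
  moreover have "(\<lambda>n. \<bar>m n - m 0\<bar>) \<longlonglongrightarrow> T"
    unfolding T_def by (intro tendsto_intros lim)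
  ultimately have "T \<le> T / 2"
    by (intro LIMSEQ_le_const2) auto
  with assms(3) show False by (simp add: T_def)
qed

text \<open>The condition \<open>p < Q / (Q - s)\<close> says \<open>\<theta> > 0\<close>. The
  powers of \<open>r j\<close> combine to \<open>r j powr \<theta>\<close>, which decays like
  \<open>2 powr (- j * \<theta>)\<close>; \<open>\<delta>\<close> is chosen so that dividing by the
  weight costs exactly the square root of this decay. The factor \<open>(1 - \<delta>) / 2\<close>
  normalises the weights to total 1/2.\<close>

lemma frac_sobolev_series:
  fixes Q s p R A :: real
  assumes "0 < s" "s < Q" "1 \<le> p" "p < Q / (Q - s)" "R > 0" "A > 0"
  defines "\<theta> \<equiv> Q - (Q - s) * p" and "r \<equiv> \<lambda>j::nat. R / 2 ^ j"
  defines "\<delta> \<equiv> 2 powr (- \<theta> / (2 * p))"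
  defines "w \<equiv> \<lambda>j::nat. (1 - \<delta>) / 2 * \<delta> ^ j"
  shows "\<And>j. 0 < w j" "\<And>n. (\<Sum>j<n. w j) \<le> 1 / 2"
    and "(\<lambda>j. (A * r j powr (s - Q) / w j) powr p * r j powr Q) sums
          ((2 * A / (1 - \<delta>)) powr p / (1 - 2 powr (- \<theta> / 2)) * R powr \<theta>)"
    and "0 < (2 * A / (1 - \<delta>)) powr p / (1 - 2 powr (- \<theta> / 2))"
proof -
  have \<theta>: "\<theta> > 0"
    using assms(1-4) by (simp add: \<theta>_def field_simps)
  have p: "p > 0" using assms by simp
  have \<delta>: "0 < \<delta>" "\<delta> < 1"
    using \<theta> p by (simp_all add: \<delta>_def powr_less_one)
  have \<mu>: "2 powr (- \<theta> / 2) < 1" "0 < 2 powr (- \<theta> / 2)"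
    using \<theta> by (simp_all add: powr_less_one)
  show w: "0 < w j" for j using \<delta> by (simp add: w_def)
  show "(\<Sum>j<n. w j) \<le> 1 / 2" for n
  proof -
    have "(\<Sum>j<n. w j) = (1 - \<delta>) / 2 * (\<Sum>j<n. \<delta> ^ j)"
      by (simp add: w_def sum_distrib_left)
    also have "\<dots> = (1 - \<delta> ^ n) / 2"
      by (simp add: one_diff_power_eq)
    finally show ?thesis using \<delta> by simp
  qed
  show "0 < (2 * A / (1 - \<delta>)) powr p / (1 - 2 powr (- \<theta> / 2))"
    using \<delta> \<mu> \<open>A > 0\<close> by (intro divide_pos_pos powr_gt_zero[THEN iffD2]) auto
  have term_eq: "(A * r j powr (s - Q) / w j) powr p * r j powr Q
      = (2 * A / (1 - \<delta>)) powr p * R powr \<theta> * (2 powr (- \<theta> / 2)) ^ j" for j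
  proof -
    have r: "r j = R * 2 powr (- real j)"
      by (simp add: r_def powr_minus powr_realpow divide_inverse)
    have rj: "r j > 0" using assms by (simp add: r_def)
    have "A * r j powr (s - Q) / w j = (2 * A / (1 - \<delta>)) * (r j powr (s - Q) / \<delta> ^ j)"
      by (simp add: w_def)
    also have "\<dots> powr p = (2 * A / (1 - \<delta>)) powr p * (r j powr (s - Q) / \<delta> ^ j) powr p"
      by (rule powr_mult)
    also have "(r j powr (s - Q) / \<delta> ^ j) powr p = r j powr ((s - Q) * p) / \<delta> powr (real j * p)"
      using \<delta> by (simp add: powr_divide powr_powr powr_realpow[symmetric])
    finally have 1: "(A * r j powr (s - Q) / w j) powr p * r j powr Q
      = (2 * A / (1 - \<delta>)) powr p * (r j powr \<theta> / \<delta> powr (real j * p))"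
      by (simp add: \<theta>_def powr_add[symmetric] algebra_simps)
    have "r j powr \<theta> = R powr \<theta> * 2 powr (- real j * \<theta>)"
      unfolding r using assms by (simp add: powr_mult powr_powr)
    moreover have "\<delta> powr (real j * p) = 2 powr (- real j * \<theta> / 2)"
      unfolding \<delta>_def powr_powr using p by (simp add: field_simps)
    ultimately have "r j powr \<theta> / \<delta> powr (real j * p) = R powr \<theta> * 2 powr (- real j * \<theta> - - real j * \<theta> / 2)"
      by (simp only: powr_diff times_divide_eq_right)
    also have "- real j * \<theta> - - real j * \<theta> / 2 = (- \<theta> / 2) * real j" by (simp add: field_simps)
    also have "2 powr ((- \<theta> / 2) * real j) = (2 powr (- \<theta> / 2)) ^ j"
      by (simp only: powr_powr[symmetric] powr_realpow[OF \<mu>(2)])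
    finally show ?thesis unfolding 1 by simp
  qed
  have "(\<lambda>j. (2 * A / (1 - \<delta>)) powr p * R powr \<theta> * (2 powr (- \<theta> / 2)) ^ j) sums
      ((2 * A / (1 - \<delta>)) powr p * R powr \<theta> * (1 / (1 - 2 powr (- \<theta> / 2))))"
    by (intro sums_mult geometric_sums) (use \<mu> in simp)
  then show "(\<lambda>j. (A * r j powr (s - Q) / w j) powr p * r j powr Q) sums
          ((2 * A / (1 - \<delta>)) powr p / (1 - 2 powr (- \<theta> / 2)) * R powr \<theta>)"
    unfolding term_eq by (simp add: mult_ac)
qed

text \<open>With \<open>i\<close> a partial integral and \<open>\<Gamma>\<close> the full one, this
  trades the power \<open>p\<close> for an expression linear in \<open>i\<close>, to which Fubini
  applies.\<close>

lemma powr_le_powr_mult: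
  fixes i p \<Gamma> :: real
  assumes "0 \<le> i" "i \<le> \<Gamma>" "1 \<le> p"
  shows "i powr p \<le> \<Gamma> powr (p - 1) * i"
proof (cases "i = 0")
  case False
  then have "i powr p = i powr (p - 1) * i"
    using assms by (simp add: powr_diff)
  also have "\<dots> \<le> \<Gamma> powr (p - 1) * i"
    by (intro mult_right_mono powr_mono2) (use assms in auto)
  finally show ?thesis .
qed simp

text \<open>The geometry enters through \<open>chain\<close>, used for each fixed \<open>x\<close>,
  and through \<open>upper\<close>, used for fixed \<open>y\<close> after exchanging the integrals.
  The constant \<open>A\<close> collects the two normalisations
  \<open>1 / (\<beta> * r_j powr Q)\<close> and \<open>2 powr Q / (\<beta> * r_j powr Q)\<close> of
  consecutive means and the kernel bound \<open>(K * r_j) powr (Q + s)\<close>; what remains is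
  \<open>r_j powr (s - Q)\<close>.\<close>

lemma frac_poincare_chain:
  fixes M :: "'a measure" and f :: "'a \<Rightarrow> real" and q :: "'a \<Rightarrow> 'a \<Rightarrow> real" and Q s p K \<beta> \<nu> R \<Gamma> :: real
  assumes sf: "sigma_finite_measure M" and B: "B \<in> sets M" and f: "integrable M f"
    and qm: "(\<lambda>z. q (fst z) (snd z)) \<in> borel_measurable (M \<Otimes>\<^sub>M M)"
    and q: "\<And>x y. 0 \<le> q x y" "\<And>x y. q x y = 0 \<Longrightarrow> x = y"
    and par: "0 < s" "s < Q" "1 \<le> p" "p < Q / (Q - s)" "0 < K" "0 < \<beta>" "0 < \<nu>" "0 < R"
    and chain: "\<And>x. x \<in> B \<Longrightarrow> \<exists>D. D 0 = B \<and> (\<forall>j::nat. D j \<in> sets M \<and> D j \<subseteq> B \<and>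
      emeasure M (D j) = ennreal (\<beta> * (R / 2 ^ j) powr Q) \<and>
      (\<forall>y\<in>D j. q x y \<le> K * (R / 2 ^ j)) \<and>
      (\<forall>y\<in>D j. \<forall>z\<in>D (Suc j). q y z \<le> K * (R / 2 ^ j)))"
    and upper: "\<And>y j. y \<in> B \<Longrightarrow> emeasure M {x \<in> B. q x y \<le> K * (R / 2 ^ j)} \<le> ennreal (\<nu> * (R / 2 ^ j) powr Q)"
  defines "g \<equiv> \<lambda>x. \<integral>\<^sup>+y\<in>B. ennreal (\<bar>f x - f y\<bar> / q x y powr (Q + s)) \<partial>M"
    and "\<theta> \<equiv> Q - (Q - s) * p"
  assumes G: "(\<integral>\<^sup>+x\<in>B. g x \<partial>M) = ennreal \<Gamma>" and "0 \<le> \<Gamma>"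
  defines "A \<equiv> 2 powr Q * K powr (Q + s) / \<beta>\<^sup>2"
  defines "C \<equiv> (2 * A / (1 - 2 powr (- \<theta> / (2 * p)))) powr p / (1 - 2 powr (- \<theta> / 2))"
  shows "(\<integral>\<^sup>+x\<in>B. ennreal (\<bar>f x - (LINT z:B|M. f z) / measure M B\<bar> powr p) \<partial>M)
    \<le> ennreal (\<nu> * C * R powr \<theta> * \<Gamma> powr p)"
proof -
  interpret S: sigma_finite_measure M by (rule sf)
  interpret P: pair_sigma_finite M M ..
  define r where "r j = R / 2 ^ j" for j :: nat
  have r: "r j > 0" for j using par by (simp add: r_def)
  have r_Suc: "r (Suc j) = r j / 2" for j by (simp add: r_def)
  have Apos: "A > 0" using par by (simp add: A_def)
  define w where "w j = (1 - 2 powr (- \<theta> / (2 * p))) / 2 * (2 powr (- \<theta> / (2 * p))) ^ j" for j :: nat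
  note series = frac_sobolev_series[OF par(1-4) par(8) Apos, folded \<theta>_def, folded r_def w_def C_def]
  have [measurable]: "f \<in> borel_measurable M" using f by simp
  note B [measurable] qm [measurable]
  have hm [measurable]: "(\<lambda>z. ennreal (\<bar>f (fst z) - f (snd z)\<bar> / q (fst z) (snd z) powr (Q + s)) * indicator B (snd z))
      \<in> borel_measurable (M \<Otimes>\<^sub>M M)"
    by measurable
  have gm [measurable]: "g \<in> borel_measurable M"
    unfolding g_def using S.borel_measurable_nn_integral_fst[OF hm] by simp
  \<comment> \<open>The sets \<open>D j\<close> depend on \<open>x\<close> through a choice. The set
    of points with \<open>q x y \<le> K * r j\<close> contains \<open>D j\<close> and depends
    measurably on \<open>x\<close>.\<close>
  define I where "I j x = (\<integral>\<^sup>+y. g y * indicator B y * (if q x y \<le> K * r j then 1 else 0) \<partial>M)" for j x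
  have Im [measurable]: "I j \<in> borel_measurable M" for j
  proof -
    have "(\<lambda>z. g (snd z) * indicator B (snd z) * (if q (fst z) (snd z) \<le> K * r j then 1 else 0)) \<in> borel_measurable (M \<Otimes>\<^sub>M M)"
      by measurable
    from S.borel_measurable_nn_integral_fst[OF this] show ?thesis
      unfolding I_def[abs_def] by simp
  qed
  have I_le: "I j x \<le> ennreal \<Gamma>" for j x
    unfolding I_def G[symmetric] by (intro nn_integral_mono) (auto simp: indicator_def)
  have I_integral: "(\<integral>\<^sup>+x\<in>B. I j x \<partial>M) \<le> ennreal (\<nu> * r j powr Q * \<Gamma>)" for j
  proof -
    have "(\<integral>\<^sup>+x\<in>B. I j x \<partial>M) =
        (\<integral>\<^sup>+x. (\<integral>\<^sup>+y. g y * indicator B y * (if q x y \<le> K * r j then 1 else 0) * indicator B x \<partial>M) \<partial>M)"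
      unfolding I_def by (intro nn_integral_cong) (auto simp: indicator_def)
    \<comment> \<open>After the exchange the inner integral measures the points \<open>x\<close>
      close to a fixed \<open>y\<close>, which \<open>upper\<close> bounds.\<close>
    also have "\<dots> = (\<integral>\<^sup>+y. (\<integral>\<^sup>+x. g y * indicator B y * (if q x y \<le> K * r j then 1 else 0) * indicator B x \<partial>M) \<partial>M)"
      by (rule P.Fubini'[symmetric]) measurable
    also have "\<dots> \<le> (\<integral>\<^sup>+y. g y * indicator B y * ennreal (\<nu> * r j powr Q) \<partial>M)"
    proof (intro nn_integral_mono)
      fix y assume "y \<in> space M"
      show "(\<integral>\<^sup>+x. g y * indicator B y * (if q x y \<le> K * r j then 1 else 0) * indicator B x \<partial>M)
          \<le> g y * indicator B y * ennreal (\<nu> * r j powr Q)"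
      proof (cases "y \<in> B")
        case True
        have m: "{x \<in> B. q x y \<le> K * r j} \<in> sets M"
        proof -
          have "(\<lambda>x. q x y) \<in> borel_measurable M"
            using measurable_compose[OF measurable_Pair1'[of y M M] qm] True sets.sets_into_space[OF B]
              measurable_compose[OF measurable_Pair2'[of y M M] qm] by auto
          then have "{x \<in> space M. q x y \<le> K * r j} \<inter> B \<in> sets M" by measurable
          moreover have "{x \<in> space M. q x y \<le> K * r j} \<inter> B = {x \<in> B. q x y \<le> K * r j}"
            using sets.sets_into_space[OF B] by auto
          ultimately show ?thesis by simp
        qed
        have "(\<integral>\<^sup>+x. g y * indicator B y * (if q x y \<le> K * r j then 1 else 0) * indicator B x \<partial>M)
            = (\<integral>\<^sup>+x. g y * indicator {x \<in> B. q x y \<le> K * r j} x \<partial>M)"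
          using True by (intro nn_integral_cong) (auto simp: indicator_def)
        also have "\<dots> = g y * emeasure M {x \<in> B. q x y \<le> K * r j}"
          by (rule nn_integral_cmult_indicator[OF m])
        also have "\<dots> \<le> g y * ennreal (\<nu> * r j powr Q)"
          using upper[OF True, of j] by (intro mult_left_mono) (simp_all add: r_def)
        finally show ?thesis using True by simp
      qed simp
    qed
    also have "\<dots> = ennreal \<Gamma> * ennreal (\<nu> * r j powr Q)"
      by (simp add: nn_integral_multc G)
    finally show ?thesis
      using par r[of j] \<open>0 \<le> \<Gamma>\<close> by (simp add: ennreal_mult'[symmetric] mult_ac)
  qed
  have local_bound: "(\<integral>\<^sup>+z\<in>D. ennreal \<bar>f y - f z\<bar> \<partial>M) \<le> ennreal ((K * \<rho>) powr (Q + s)) * g y"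
    if "y \<in> B" "D \<subseteq> B" "\<And>z. z \<in> D \<Longrightarrow> q y z \<le> K * \<rho>" for y D \<rho>
  proof -
    have "(\<integral>\<^sup>+z\<in>D. ennreal \<bar>f y - f z\<bar> \<partial>M)
        \<le> (\<integral>\<^sup>+z. ennreal ((K * \<rho>) powr (Q + s)) * (ennreal (\<bar>f y - f z\<bar> / q y z powr (Q + s)) * indicator B z) \<partial>M)"
    proof (intro nn_integral_mono)
      fix z assume "z \<in> space M"
      show "ennreal \<bar>f y - f z\<bar> * indicator D z
        \<le> ennreal ((K * \<rho>) powr (Q + s)) * (ennreal (\<bar>f y - f z\<bar> / q y z powr (Q + s)) * indicator B z)"
      \<comment> \<open>Off the diagonal \<open>q y z\<close> is positive and the kernel bound can
        be multiplied out. On the diagonal the difference of values vanishes on both sides.\<close>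
      proof (cases "z \<in> D \<and> y \<noteq> z")
        case True
        then have qz: "0 < q y z" using q(1)[of y z] q(2)[of y z] by force
        have "q y z powr (Q + s) \<le> (K * \<rho>) powr (Q + s)"
          using that(3)[of z] True q(1) par by (intro powr_mono2) auto
        then have "\<bar>f y - f z\<bar> * q y z powr (Q + s) \<le> \<bar>f y - f z\<bar> * (K * \<rho>) powr (Q + s)"
          by (rule mult_left_mono) simp
        then have "\<bar>f y - f z\<bar> \<le> (K * \<rho>) powr (Q + s) * (\<bar>f y - f z\<bar> / q y z powr (Q + s))"
          using qz by (simp add: field_simps)
        then have "ennreal \<bar>f y - f z\<bar> \<le> ennreal ((K * \<rho>) powr (Q + s)) * ennreal (\<bar>f y - f z\<bar> / q y z powr (Q + s))"
          by (simp add: ennreal_mult[symmetric] ennreal_leI)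
        then show ?thesis using True that(2) by (auto simp: indicator_def)
      qed (auto simp: indicator_def)
    qed
    also have "\<dots> = ennreal ((K * \<rho>) powr (Q + s)) * g y"
      unfolding g_def
      by (rule nn_integral_cmult)
         (use sets.sets_into_space[OF B] that(1) in \<open>auto intro!: measurable_Pair2[OF hm, of y, simplified]\<close>)
    finally show ?thesis .
  qed
  have pointwise: "ennreal (\<bar>f x - (LINT z:B|M. f z) / measure M B\<bar> powr p)
      \<le> (\<Sum>j. ennreal ((A * r j powr (s - Q) / w j) powr p * \<Gamma> powr (p - 1)) * I j x)"
    if x: "x \<in> B" "g x \<noteq> \<infinity>" for x
  proof -
    obtain D where D0: "D 0 = B" and D: "\<And>j::nat. D j \<in> sets M" "\<And>j. D j \<subseteq> B"
      "\<And>j. emeasure M (D j) = ennreal (\<beta> * r j powr Q)"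
      "\<And>j y. y \<in> D j \<Longrightarrow> q x y \<le> K * r j"
      "\<And>j y z. y \<in> D j \<Longrightarrow> z \<in> D (Suc j) \<Longrightarrow> q y z \<le> K * r j"
      using chain[OF x(1)] unfolding r_def by blast
    have d: "\<beta> * r j powr Q > 0" for j using par r[of j] by simp
    define m where "m j = (LINT z:D j|M. f z) / (\<beta> * r j powr Q)" for j
    have m0: "m 0 = (LINT z:B|M. f z) / measure M B"
      unfolding m_def D0[symmetric] using D(3)[of 0] d[of 0] by (simp add: measure_def)
    have incr: "\<bar>m j - m (Suc j)\<bar> \<le> A * r j powr (s - Q) * enn2real (I j x)" for j
    proof -
      have "ennreal \<bar>m j - m (Suc j)\<bar> \<le> ennreal (1 / (\<beta> * r j powr Q)) *
          (\<integral>\<^sup>+y\<in>D j. ennreal (1 / (\<beta> * r (Suc j) powr Q)) * (\<integral>\<^sup>+z\<in>D (Suc j). ennreal \<bar>f y - f z\<bar> \<partial>M) \<partial>M)"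
        unfolding m_def by (rule mean_mean_dist_le[OF f D(1,3) d D(1,3) d])
      \<comment> \<open>The inner mean over \<open>D (Suc j)\<close> is estimated by
        \<open>g y\<close>; then the domain \<open>D j\<close> is enlarged to that of
        \<open>I j x\<close>.\<close>
      also have "\<dots> \<le> ennreal (1 / (\<beta> * r j powr Q)) *
          (\<integral>\<^sup>+y. ennreal (1 / (\<beta> * r (Suc j) powr Q)) * (ennreal ((K * r j) powr (Q + s)) *
            (g y * indicator B y * (if q x y \<le> K * r j then 1 else 0))) \<partial>M)"
      proof (intro mult_left_mono nn_integral_mono)
        fix y
        have "(\<integral>\<^sup>+z\<in>D (Suc j). ennreal \<bar>f y - f z\<bar> \<partial>M) \<le> ennreal ((K * r j) powr (Q + s)) * g y" if "y \<in> D j"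
          by (rule local_bound) (use that D in auto)
        then show "ennreal (1 / (\<beta> * r (Suc j) powr Q)) * (\<integral>\<^sup>+z\<in>D (Suc j). ennreal \<bar>f y - f z\<bar> \<partial>M) * indicator (D j) y
          \<le> ennreal (1 / (\<beta> * r (Suc j) powr Q)) * (ennreal ((K * r j) powr (Q + s)) *
            (g y * indicator B y * (if q x y \<le> K * r j then 1 else 0)))"
          using D(2)[of j] D(4)[of y j] by (cases "y \<in> D j") (auto simp: indicator_def intro!: mult_left_mono)
      qed simp
      also have "\<dots> = ennreal (1 / (\<beta> * r j powr Q)) * (ennreal (1 / (\<beta> * r (Suc j) powr Q)) *
          (ennreal ((K * r j) powr (Q + s)) * I j x))"
      proof -
        have "(\<lambda>y. g y * indicator B y * (if q x y \<le> K * r j then 1 else 0)) \<in> borel_measurable M"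
        proof -
          have "(\<lambda>y. q x y) \<in> borel_measurable M"
            using measurable_compose[OF measurable_Pair1'[of x M M] qm] x sets.sets_into_space[OF B] by auto
          then show ?thesis by measurable
        qed
        then show ?thesis unfolding I_def by (simp add: nn_integral_cmult)
      qed
      also have "\<dots> = ennreal (1 / (\<beta> * r j powr Q) * (1 / (\<beta> * r (Suc j) powr Q)) * (K * r j) powr (Q + s) * enn2real (I j x))"
      proof -
        have "I j x = ennreal (enn2real (I j x))"
          using I_le[of j x] by (metis ennreal_enn2real_if ennreal_less_top infinity_ennreal_def leD top.not_eq_extremum)
        moreover have "0 \<le> 1 / (\<beta> * r j powr Q)" "0 \<le> 1 / (\<beta> * r (Suc j) powr Q)" "0 \<le> (K * r j) powr (Q + s)"
          using d[of j] d[of "Suc j"] by auto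
        ultimately show ?thesis
          by (metis (no_types, lifting) ennreal_mult' mult.assoc enn2real_nonneg mult_nonneg_nonneg)
      qed
      also have "1 / (\<beta> * r j powr Q) * (1 / (\<beta> * r (Suc j) powr Q)) * (K * r j) powr (Q + s) = A * r j powr (s - Q)"
      proof -
        have a: "r (Suc j) powr Q = r j powr Q / 2 powr Q"
          unfolding r_Suc by (simp add: powr_divide)
        have b: "(K * r j) powr (Q + s) = K powr (Q + s) * (r j powr Q * r j powr s)"
          by (simp add: powr_mult powr_add)
        have c: "r j powr (s - Q) = r j powr s / r j powr Q" by (simp add: powr_diff)
        have "r j powr Q > 0" using r[of j] by simp
        then show ?thesis
          unfolding a b c A_def using par(6) by (simp add: field_simps power2_eq_square)
      qed
      finally show ?thesis
        by (subst (asm) ennreal_le_iff) (use Apos r[of j] in auto)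
    qed
    \<comment> \<open>Finiteness of \<open>g x\<close> gives a rate: the mean of
      \<open>\<bar>f x - f z\<bar>\<close> over \<open>D j\<close> is at most a constant times
      \<open>r j powr s\<close>, because dividing by the measure costs \<open>r j powr Q\<close> out
      of the kernel bound.\<close>
    have lim: "m \<longlonglongrightarrow> f x"
    proof -
      define c where "c = K powr (Q + s) / \<beta> * enn2real (g x)"
      have bnd: "\<bar>f x - m j\<bar> \<le> c * r j powr s" for j
      proof -
        have "ennreal \<bar>f x - m j\<bar> \<le> ennreal (1 / (\<beta> * r j powr Q)) * (\<integral>\<^sup>+z\<in>D j. ennreal \<bar>f x - f z\<bar> \<partial>M)"
          unfolding m_def by (rule mean_dist_le[OF f D(1,3) d])
        also have "\<dots> \<le> ennreal (1 / (\<beta> * r j powr Q)) * (ennreal ((K * r j) powr (Q + s)) * g x)"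
          by (rule mult_left_mono[OF local_bound[OF x(1) D(2) D(4)] zero_le])
        also have "\<dots> = ennreal (1 / (\<beta> * r j powr Q) * ((K * r j) powr (Q + s) * enn2real (g x)))"
        proof -
          have "g x = ennreal (enn2real (g x))"
            using x(2) by (simp add: ennreal_enn2real_if)
          moreover have "0 \<le> 1 / (\<beta> * r j powr Q)" "0 \<le> (K * r j) powr (Q + s)"
            using d[of j] by auto
          ultimately show ?thesis
            by (metis (no_types, lifting) ennreal_mult' enn2real_nonneg mult_nonneg_nonneg)
        qed
        also have "1 / (\<beta> * r j powr Q) * ((K * r j) powr (Q + s) * enn2real (g x)) = c * r j powr s"
          using r[of j] par by (simp add: c_def powr_mult powr_add)
        finally show ?thesis
          by (subst (asm) ennreal_le_iff) (use par in \<open>auto simp: c_def\<close>)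
      qed
      have lim0: "(\<lambda>j. c * r j powr s) \<longlonglongrightarrow> 0"
      proof -
        have "r \<longlonglongrightarrow> 0"
          unfolding r_def[abs_def] using LIMSEQ_divide_realpow_zero[of 2 R] by simp
        then have "(\<lambda>j. r j powr s) \<longlonglongrightarrow> 0 powr s"
          using par r by (intro tendsto_powr') (auto intro!: always_eventually intro: less_imp_le)
        from tendsto_mult_left[OF this, of c] show ?thesis by simp
      qed
      have "(\<lambda>j. f x - m j) \<longlonglongrightarrow> 0"
        by (rule Lim_null_comparison[OF _ lim0], rule always_eventually) (simp add: bnd)
      from tendsto_diff[OF tendsto_const[of "f x"] this] show ?thesis by simp
    qed
    show ?thesis
    proof (cases "f x = m 0")
      case True
      then show ?thesis unfolding m0[symmetric] by simp
    next
      case False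
      obtain j where j: "\<bar>f x - m 0\<bar> * w j \<le> \<bar>m j - m (Suc j)\<bar>"
        using ex_large_increment[OF lim series(2) False] by blast
      define i where "i = enn2real (I j x)"
      have i: "0 \<le> i" "i \<le> \<Gamma>" "I j x = ennreal i"
      proof -
        have "I j x < \<infinity>" using I_le[of j x] by (rule le_less_trans) simp
        then show "I j x = ennreal i" by (simp add: i_def)
        then show "i \<le> \<Gamma>" using I_le[of j x] \<open>0 \<le> \<Gamma>\<close> by simp
      qed (simp add: i_def)
      have "\<bar>f x - m 0\<bar> * w j \<le> A * r j powr (s - Q) * i"
        using j incr[of j] by (simp add: i_def)
      then have "\<bar>f x - m 0\<bar> \<le> A * r j powr (s - Q) / w j * i"
        using series(1)[of j] by (simp add: field_simps)
      then have "\<bar>f x - m 0\<bar> powr p \<le> (A * r j powr (s - Q) / w j * i) powr p"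
        using par by (intro powr_mono2) auto
      also have "\<dots> = (A * r j powr (s - Q) / w j) powr p * i powr p"
        by (rule powr_mult)
      also have "\<dots> \<le> (A * r j powr (s - Q) / w j) powr p * (\<Gamma> powr (p - 1) * i)"
        by (intro mult_left_mono powr_le_powr_mult i par) simp
      finally have "ennreal (\<bar>f x - m 0\<bar> powr p)
          \<le> ennreal ((A * r j powr (s - Q) / w j) powr p * \<Gamma> powr (p - 1)) * I j x"
        unfolding i(3) by (subst ennreal_mult'[symmetric]) (simp_all add: ennreal_leI mult.assoc)
      \<comment> \<open>The selected index depends on \<open>x\<close>; the sum over all indices
        dominates it uniformly.\<close>
      also have "\<dots> \<le> (\<Sum>j. ennreal ((A * r j powr (s - Q) / w j) powr p * \<Gamma> powr (p - 1)) * I j x)"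
        using sum_le_suminf[of "\<lambda>j. ennreal ((A * r j powr (s - Q) / w j) powr p * \<Gamma> powr (p - 1)) * I j x" "{j}"]
        by simp
      finally show ?thesis unfolding m0 .
    qed
  qed
  have fin: "AE x in M. x \<in> B \<longrightarrow> g x \<noteq> \<infinity>"
  proof -
    have "AE x in M. g x * indicator B x \<noteq> \<infinity>"
      by (rule nn_integral_noteq_infinite) (use G in auto)
    then show ?thesis by eventually_elim (auto simp: indicator_def)
  qed
  have "(\<integral>\<^sup>+x\<in>B. ennreal (\<bar>f x - (LINT z:B|M. f z) / measure M B\<bar> powr p) \<partial>M)
    \<le> (\<integral>\<^sup>+x. (\<Sum>j. ennreal ((A * r j powr (s - Q) / w j) powr p * \<Gamma> powr (p - 1)) * (I j x * indicator B x)) \<partial>M)"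
    by (rule nn_integral_mono_AE, use fin in eventually_elim) (use pointwise in \<open>auto simp: indicator_def\<close>)
  also have "\<dots> = (\<Sum>j. \<integral>\<^sup>+x. ennreal ((A * r j powr (s - Q) / w j) powr p * \<Gamma> powr (p - 1)) * (I j x * indicator B x) \<partial>M)"
    by (rule nn_integral_suminf) measurable
  also have "\<dots> = (\<Sum>j. ennreal ((A * r j powr (s - Q) / w j) powr p * \<Gamma> powr (p - 1)) * (\<integral>\<^sup>+x\<in>B. I j x \<partial>M))"
    by (intro suminf_cong nn_integral_cmult) measurable
  also have "\<dots> \<le> (\<Sum>j. ennreal (\<nu> * \<Gamma> powr p * ((A * r j powr (s - Q) / w j) powr p * r j powr Q)))"
  proof (intro suminf_le)
    fix j
    have "ennreal ((A * r j powr (s - Q) / w j) powr p * \<Gamma> powr (p - 1)) * (\<integral>\<^sup>+x\<in>B. I j x \<partial>M)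
      \<le> ennreal ((A * r j powr (s - Q) / w j) powr p * \<Gamma> powr (p - 1)) * ennreal (\<nu> * r j powr Q * \<Gamma>)"
      by (intro mult_left_mono I_integral) simp
    also have "\<dots> = ennreal (((A * r j powr (s - Q) / w j) powr p * \<Gamma> powr (p - 1)) * (\<nu> * r j powr Q * \<Gamma>))"
      by (rule ennreal_mult'[symmetric]) simp
    also have "((A * r j powr (s - Q) / w j) powr p * \<Gamma> powr (p - 1)) * (\<nu> * r j powr Q * \<Gamma>)
        = \<nu> * (\<Gamma> powr (p - 1) * \<Gamma>) * ((A * r j powr (s - Q) / w j) powr p * r j powr Q)"
      by simp
    also have "\<Gamma> powr (p - 1) * \<Gamma> = \<Gamma> powr p"
      using \<open>0 \<le> \<Gamma>\<close> par by (cases "\<Gamma> = 0") (simp_all add: powr_diff)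
    finally show "ennreal ((A * r j powr (s - Q) / w j) powr p * \<Gamma> powr (p - 1)) * (\<integral>\<^sup>+x\<in>B. I j x \<partial>M)
      \<le> ennreal (\<nu> * \<Gamma> powr p * ((A * r j powr (s - Q) / w j) powr p * r j powr Q))" .
  qed auto
  also have "\<dots> = ennreal (\<nu> * \<Gamma> powr p * (C * R powr \<theta>))"
    by (rule suminf_ennreal_eq[OF _ sums_mult[OF series(3)]]) (use par in auto)
  finally show ?thesis by (simp add: mult_ac)
qed

section \<open>Homogeneous norms and chains of balls\<close>

lemma sigma_finite_lebesgue: "sigma_finite_measure (lebesgue :: 'a::euclidean_space measure)"
proof -
  obtain A :: "'a set set" where "countable A" "A \<subseteq> sets lborel" "\<Union>A = space lborel" "\<forall>a\<in>A. emeasure lborel a \<noteq> \<infinity>"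
    using sigma_finite_lborel unfolding sigma_finite_measure_def by blast
  then show ?thesis
    unfolding sigma_finite_measure_def by (intro exI[of _ A]) (auto simp: subset_iff)
qed

lemma ennpowr_le:
  assumes "u \<le> ennreal v" "0 \<le> v" "0 \<le> a"
  shows "ennpowr u a \<le> ennreal (v powr a)"
proof -
  have "u < \<infinity>" using assms(1) by (rule le_less_trans) simp
  moreover have "enn2real u \<le> v"
    using assms by (simp add: enn2real_leI)
  ultimately show ?thesis
    unfolding ennpowr_def using assms(3) by (auto intro!: ennreal_leI powr_mono2)
qed

context carnot_group
begin

text \<open>The centre \<open>z j\<close> is the point of a path from \<open>x0\<close> to
  \<open>x\<close> at which length \<open>R / 2 ^ j\<close> remains, or \<open>x0\<close> if the
  path is shorter than that. The length used up plus the radius never exceeds \<open>R\<close>, and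
  \<open>x\<close> is within \<open>R / 2 ^ j\<close> of the centre, hence the factor 2.\<close>

lemma cc_ball_chain:
  assumes "x \<in> cc_ball X wt x0 R"
  obtains z where "z 0 = x0"
    "\<And>j::nat. cc_ball X wt (z j) (R / 2 ^ j) \<subseteq> cc_ball X wt x0 R"
    "\<And>j. cc_ball X wt (z j) (R / 2 ^ j) \<subseteq> cc_ball X wt x (2 * (R / 2 ^ j))"
proof -
  obtain L where L: "L < R" "hpath x0 x L" using assms by (auto simp: mem_cc_ball)
  have "\<exists>z l l'. (j = 0 \<longrightarrow> z = x0) \<and> hpath x0 z l \<and> hpath z x l' \<and> l + R / 2 ^ j \<le> R \<and> l' \<le> R / 2 ^ j" for j :: nat
  proof (cases "L \<le> R / 2 ^ j")
    case True
    have "0 \<le> R" using L hpath_nonneg by fastforce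
    then have "R / 2 ^ j \<le> R" by (simp add: divide_le_eq mult_le_cancel_left1)
    with True show ?thesis
      using hpath_refl L(2) by (intro exI[of _ x0] exI[of _ 0] exI[of _ L]) auto
  next
    case False
    have "0 \<le> R / 2 ^ j" using L hpath_nonneg by fastforce
    with False obtain z where "hpath x0 z (L - R / 2 ^ j)" "hpath z x (R / 2 ^ j)"
      using hpath_cut[OF L(2), of "R / 2 ^ j"] by auto
    with False L(1) show ?thesis
      by (intro exI[of _ z] exI[of _ "L - R / 2 ^ j"] exI[of _ "R / 2 ^ j"]) auto
  qed
  then obtain z l l' where z: "\<And>j::nat. j = 0 \<Longrightarrow> z j = x0" "\<And>j. hpath x0 (z j) (l j)" "\<And>j. hpath (z j) x (l' j)"
    "\<And>j. l j + R / 2 ^ j \<le> R" "\<And>j. l' j \<le> R / 2 ^ j"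
    by metis
  show ?thesis
  proof (rule that[of z])
    show "cc_ball X wt (z j) (R / 2 ^ j) \<subseteq> cc_ball X wt x0 R" for j
    proof
      fix y assume "y \<in> cc_ball X wt (z j) (R / 2 ^ j)"
      then obtain m where m: "m < R / 2 ^ j" "hpath (z j) y m" by (auto simp: mem_cc_ball)
      have "hpath x0 y (l j + m)" by (rule hpath_trans[OF z(2) m(2)])
      moreover have "l j + m < R" using m(1) z(4)[of j] by linarith
      ultimately show "y \<in> cc_ball X wt x0 R" unfolding mem_cc_ball by blast
    qed
    show "cc_ball X wt (z j) (R / 2 ^ j) \<subseteq> cc_ball X wt x (2 * (R / 2 ^ j))" for j
    proof
      fix y assume "y \<in> cc_ball X wt (z j) (R / 2 ^ j)"
      then obtain m where m: "m < R / 2 ^ j" "hpath (z j) y m" by (auto simp: mem_cc_ball)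
      have "hpath x y (l' j + m)" by (rule hpath_trans[OF hpath_sym[OF z(3)] m(2)])
      moreover have "l' j + m < 2 * (R / 2 ^ j)" using m(1) z(5)[of j] by linarith
      ultimately show "y \<in> cc_ball X wt x (2 * (R / 2 ^ j))" unfolding mem_cc_ball by blast
    qed
  qed (simp add: z)
qed

lemma cc_ball_mono: "r \<le> r' \<Longrightarrow> cc_ball X wt x r \<subseteq> cc_ball X wt x r'"
  unfolding mem_cc_ball subset_iff by (meson less_le_trans)

section \<open>Comparison of the homogeneous norm with balls and volumes\<close>

context
  fixes nrm :: "real^'n \<Rightarrow> real"
  assumes nrm: "homogeneous_norm G wt nrm"
begin

lemma nrm_props:
  "continuous_on UNIV nrm" "0 \<le> nrm x" "nrm x = 0 \<longleftrightarrow> x = 0" "nrm (- x) = nrm x"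
  "r > 0 \<Longrightarrow> nrm (dil r x) = r * nrm x"
  using nrm unfolding homogeneous_norm_def dil_def[symmetric] by auto

text \<open>Let \<open>m\<close> be the minimum of \<open>nrm\<close> on the Euclidean unit sphere.
  A point outside the Euclidean unit ball is dilated onto the sphere by some factor
  \<open>r \<le> 1\<close>, so its norm is at least \<open>m\<close>; a dilation passes from level
  \<open>m\<close> to level 1.\<close>

lemma bounded_unit_nrm_ball: "bounded {x. nrm x < 1}"
proof -
  have "\<exists>u\<in>sphere 0 1. \<forall>x\<in>sphere 0 1. nrm u \<le> nrm x"
    by (intro continuous_attains_inf continuous_on_subset[OF nrm_props(1)]) auto
  then obtain u where u: "norm u = 1" "\<And>x. norm x = 1 \<Longrightarrow> nrm u \<le> nrm x" by auto
  define m where "m = nrm u"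
  have m: "m > 0"
    using nrm_props(2)[of u] nrm_props(3)[of u] u(1) by (auto simp: m_def less_le)
  have less: "norm x < 1" if "nrm x < m" for x
  proof (rule ccontr)
    assume "\<not> norm x < 1"
    moreover have "dil 0 x = 0"
    proof -
      have "wt i \<noteq> 0" for i using wt_range[of i] by auto
      then show ?thesis by (simp add: vec_eq_iff)
    qed
    moreover have "continuous_on {0..1} (\<lambda>r. dil r x)"
      unfolding dil_def dilation_def by (intro continuous_intros)
    ultimately have "\<exists>r\<ge>0. r \<le> 1 \<and> norm (dil r x) = 1"
      by (intro IVT' continuous_intros) auto
    then obtain r where r: "0 \<le> r" "r \<le> 1" "norm (dil r x) = 1" by blast
    then have "r \<noteq> 0" using \<open>dil 0 x = 0\<close> by auto
    then have "m \<le> r * nrm x"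
      using u(2)[OF r(3)] r nrm_props(5)[of r x] by (simp add: m_def)
    also have "\<dots> \<le> 1 * nrm x" by (intro mult_right_mono r nrm_props)
    finally show False using that by simp
  qed
  have "{x. nrm x < 1} \<subseteq> dil (1 / m) ` ball 0 1"
  proof
    fix x assume "x \<in> {x. nrm x < 1}"
    then have "nrm (dil m x) < m" using m by (simp add: nrm_props)
    then have "dil m x \<in> ball 0 1" using less by simp
    moreover have "x = dil (1 / m) (dil m x)" using m by (simp add: dil_dil)
    ultimately show "x \<in> dil (1 / m) ` ball 0 1" by blast
  qed
  then show ?thesis
    by (rule bounded_subset[OF bounded_dil_image[OF bounded_ball]])
qed

lemma nrm_le_on_cc_ball:
  obtains K where "K > 0"
    "\<And>x y z r. y \<in> cc_ball X wt x (2 * r) \<Longrightarrow> z \<in> cc_ball X wt x (2 * r) \<Longrightarrow> r > 0 \<Longrightarrow> nrm (- z \<otimes> y) \<le> K * r"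
proof -
  have "compact (nrm ` closure (cc_ball X wt 0 1))"
    using bounded_unit_cc_ball
    by (intro compact_continuous_image continuous_on_subset[OF nrm_props(1)]) (auto simp: compact_closure)
  then obtain K0 where K0: "\<And>u. u \<in> closure (cc_ball X wt 0 1) \<Longrightarrow> norm (nrm u) \<le> K0"
    using compact_imp_bounded bounded_iff by (metis image_eqI)
  show ?thesis
  \<comment> \<open>Two points of a ball of radius \<open>2 * r\<close> are joined through its
    centre by a path of length below \<open>4 * r\<close>. The summand 1 keeps the constant
    positive.\<close>
  proof (rule that[of "4 * (\<bar>K0\<bar> + 1)"])
    fix x y z r
    assume *: "y \<in> cc_ball X wt x (2 * r)" "z \<in> cc_ball X wt x (2 * r)" "r > 0"
    then obtain l m where lm: "l < 2 * r" "hpath x y l" "m < 2 * r" "hpath x z m" by (auto simp: mem_cc_ball)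
    then have "hpath z y (m + l)" "m + l < 4 * r"
      using hpath_trans[OF hpath_sym[OF lm(4)] lm(2)] by auto
    then have "y \<in> cc_ball X wt z (4 * r)" by (auto simp: mem_cc_ball)
    then obtain u where u: "u \<in> cc_ball X wt 0 1" "y = z \<otimes> dil (4 * r) u"
      using cc_ball_eq_image[of "4 * r" z] *(3) by auto
    have "nrm (- z \<otimes> y) = 4 * r * nrm u"
      using *(3) by (simp add: u(2) nrm_props)
    also have "\<dots> \<le> 4 * r * (\<bar>K0\<bar> + 1)"
      using K0[OF subsetD[OF closure_subset u(1)]] *(3) by (intro mult_left_mono) auto
    finally show "nrm (- z \<otimes> y) \<le> 4 * (\<bar>K0\<bar> + 1) * r" by (simp add: mult_ac)
  qed simp
qed

lemma emeasure_nrm_ball_le: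
  obtains \<nu> where "\<nu> > 0"
    "\<And>y \<rho> S. \<rho> > 0 \<Longrightarrow> S \<subseteq> {x. nrm (- y \<otimes> x) \<le> \<rho>} \<Longrightarrow> emeasure lebesgue S \<le> ennreal (\<nu> * \<rho> ^ homogeneous_dim wt k)"
proof -
  let ?Q = "homogeneous_dim wt k"
  let ?S = "{x. nrm x < 1}"
  have S: "open ?S" using open_Collect_less[OF nrm_props(1) continuous_on_const[of UNIV 1]] by simp
  have "?S \<in> lmeasurable" by (rule lmeasurable_open[OF bounded_unit_nrm_ball S])
  then have e: "emeasure lebesgue ?S = ennreal (measure lebesgue ?S)"
    by (simp add: emeasure_eq_measure2)
  show ?thesis
  \<comment> \<open>Doubling the radius passes from the closed norm ball to an open one, which costs
    \<open>2 ^ ?Q\<close>; the summand 1 makes the constant positive.\<close>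
  proof (rule that[of "2 ^ ?Q * (measure lebesgue ?S + 1)"])
    fix y \<rho> T assume \<rho>: "\<rho> > (0::real)" and T: "T \<subseteq> {x. nrm (- y \<otimes> x) \<le> \<rho>}"
    have "T \<subseteq> (\<lambda>x. y \<otimes> x) ` dil (2 * \<rho>) ` ?S"
    proof
      fix x assume "x \<in> T"
      then have "nrm (dil (1 / (2 * \<rho>)) (- y \<otimes> x)) < 1"
        using T \<rho> by (auto simp: nrm_props)
      moreover have "x = y \<otimes> dil (2 * \<rho>) (dil (1 / (2 * \<rho>)) (- y \<otimes> x))"
        using \<rho> by (simp add: dil_dil)
      ultimately show "x \<in> (\<lambda>x. y \<otimes> x) ` dil (2 * \<rho>) ` ?S" by blast
    qed
    moreover have "open ((\<lambda>x. y \<otimes> x) ` dil (2 * \<rho>) ` ?S)"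
      using \<rho> by (intro open_left_mult_image open_dil_image S) simp
    ultimately have "emeasure lebesgue T \<le> emeasure lebesgue ((\<lambda>x. y \<otimes> x) ` dil (2 * \<rho>) ` ?S)"
      by (intro emeasure_mono) simp_all
    also have "\<dots> = ennreal ((2 * \<rho>) ^ ?Q) * ennreal (measure lebesgue ?S)"
      using emeasure_translated_dilated[OF S bounded_unit_nrm_ball, of "2 * \<rho>" y] \<rho> unfolding e by simp
    also have "\<dots> \<le> ennreal (2 ^ ?Q * (measure lebesgue ?S + 1) * \<rho> ^ ?Q)"
      using \<rho> by (simp add: ennreal_mult'[symmetric] power_mult_distrib algebra_simps)
    finally show "emeasure lebesgue T \<le> ennreal (2 ^ ?Q * (measure lebesgue ?S + 1) * \<rho> ^ ?Q)" .
  qed (simp add: add_nonneg_pos)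
qed

lemma measurable_nrm_diff:
  "(\<lambda>z. nrm (- snd z \<otimes> fst z)) \<in> borel_measurable (lebesgue \<Otimes>\<^sub>M lebesgue)"
proof -
  have "(\<lambda>z. nrm (- snd z \<otimes> fst z)) \<in> borel_measurable (borel :: ((real^'n) \<times> (real^'n)) measure)"
    by (intro borel_measurable_continuous_onI continuous_on_compose2[OF nrm_props(1)] continuous_intros) auto
  moreover have "(\<lambda>x. x) \<in> lebesgue \<rightarrow>\<^sub>M (borel :: (real^'n) measure)"
    by (intro measurable_completion) simp
  then have "(\<lambda>z. (fst z, snd z)) \<in> (lebesgue \<Otimes>\<^sub>M lebesgue) \<rightarrow>\<^sub>M (borel \<Otimes>\<^sub>M borel :: ((real^'n) \<times> (real^'n)) measure)"
    by (intro measurable_Pair measurable_compose[OF measurable_fst] measurable_compose[OF measurable_snd])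
  ultimately show ?thesis
    unfolding borel_prod using measurable_compose by fastforce
qed

end

end

theorem corollary4p12:
  fixes G :: "(real^'n::finite) monoid" (structure)
    and X :: "'n \<Rightarrow> real^'n \<Rightarrow> real^'n"
    and wt :: "'n \<Rightarrow> nat"
    and k Q :: nat
    and nrm :: "real^'n \<Rightarrow> real"
    and s p :: real
  assumes "carnot_group G X wt k"
    and "Q = homogeneous_dim wt k"
    and "homogeneous_norm G wt nrm"
    and "0 < s" and "s < 1"
    and "1 \<le> p" and "p < real Q / (real Q - s)"
  shows "\<exists>C>0. \<forall>x0 R. R > 0 \<longrightarrow> (\<forall>f. L1_loc f \<longrightarrow>
     (let B = cc_ball X wt x0 R in
        ennpowr ((\<integral>\<^sup>+x\<in>B. ennreal (\<bar>f x - average B f\<bar> powr p) \<partial>lebesgue)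
                   / emeasure lebesgue B) (1 / p)
        \<le> ennreal (C * (1 - s) * R powr (real Q + s))
            * ((\<integral>\<^sup>+x\<in>B. (\<integral>\<^sup>+y\<in>B.
                   ennreal (\<bar>f x - f y\<bar> / nrm (inv y \<otimes> x) powr (real Q + s)) \<partial>lebesgue) \<partial>lebesgue)
               / (emeasure lebesgue B)\<^sup>2)))"
proof -
  interpret carnot_group G X wt k by (rule assms(1))
  have Q: "s < real Q" "real Q > 0" using assms(2,5) homogeneous_dim_ge_1 by auto
  obtain \<beta> where \<beta>: "\<beta> > 0" "\<And>x r. r > 0 \<Longrightarrow> emeasure lebesgue (cc_ball X wt x r) = ennreal (\<beta> * r ^ Q)"
    using emeasure_cc_ball unfolding assms(2) by blast
  obtain K where K: "K > 0" "\<And>x y z r. y \<in> cc_ball X wt x (2 * r) \<Longrightarrow> z \<in> cc_ball X wt x (2 * r) \<Longrightarrow>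
      r > 0 \<Longrightarrow> nrm (- z \<otimes> y) \<le> K * r"
    by (rule nrm_le_on_cc_ball[OF assms(3)]) blast
  obtain \<nu>0 where \<nu>0: "\<nu>0 > 0" "\<And>y \<rho> S. \<rho> > 0 \<Longrightarrow> S \<subseteq> {x. nrm (- y \<otimes> x) \<le> \<rho>} \<Longrightarrow>
      emeasure lebesgue S \<le> ennreal (\<nu>0 * \<rho> ^ Q)"
    by (rule emeasure_nrm_ball_le[OF assms(3), folded assms(2)]) blast
  \<comment> \<open>The points with norm distance at most \<open>K * r_j\<close> form a norm ball of
    radius \<open>K * r_j\<close>; its volume bound is expressed in terms of
    \<open>r_j\<close>.\<close>
  define \<nu> where "\<nu> = \<nu>0 * K ^ Q"
  have \<nu>: "\<nu> > 0" using \<nu>0 K by (simp add: \<nu>_def)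
  define \<theta> where "\<theta> = real Q - (real Q - s) * p"
  define A where "A = 2 powr real Q * K powr (real Q + s) / \<beta>\<^sup>2"
  define C where "C = (2 * A / (1 - 2 powr (- \<theta> / (2 * p)))) powr p / (1 - 2 powr (- \<theta> / 2))"
  have A: "A > 0" using K \<beta> by (simp add: A_def)
  have C: "C > 0"
    using frac_sobolev_series(4)[OF assms(4) Q(1) assms(6,7) zero_less_one A]
    unfolding C_def \<theta>_def .
  \<comment> \<open>After division by the volume and the root, the left side is at most
    \<open>(\<nu> * C / \<beta>) powr (1 / p) * R powr (s - Q) * \<Gamma>\<close>, since
    \<open>(\<theta> - Q) / p = s - Q\<close>. The right side is
    \<open>c * (1 - s) / \<beta>\<^sup>2 * R powr (s - Q) * \<Gamma>\<close>; \<open>c\<close>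
    equates the two. The constant may depend on \<open>s\<close>, hence the division by
    \<open>1 - s\<close>.\<close>
  define c where "c = (\<nu> * C / \<beta>) powr (1 / p) * \<beta>\<^sup>2 / (1 - s)"
  have c: "c > 0" using \<nu> C \<beta> assms(5) by (simp add: c_def)
  show ?thesis
  proof (intro exI[of _ c] conjI c allI impI)
    fix x0 :: "real^'n" and R :: real and f :: "real^'n \<Rightarrow> real"
    assume R: "0 < R" and f: "L1_loc f"
    define B where "B = cc_ball X wt x0 R"
    define h where "h x = (\<integral>\<^sup>+y\<in>B. ennreal (\<bar>f x - f y\<bar> / nrm (- y \<otimes> x) powr (real Q + s)) \<partial>lebesgue)" for x
    define b where "b = \<beta> * R ^ Q"
    have b: "b > 0" using \<beta> R by (simp add: b_def)
    have eB: "emeasure lebesgue B = ennreal b" unfolding B_def b_def by (rule \<beta>(2)[OF R])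
    have BS: "B \<in> sets lebesgue" unfolding B_def by (simp add: open_cc_ball R)
    \<comment> \<open>Cutting off outside the ball makes the locally integrable \<open>f\<close>
      integrable; both sides of the inequality see only values on \<open>B\<close>.\<close>
    define F where "F x = indicator B x *\<^sub>R f x" for x
    have F_eq: "F x = f x" if "x \<in> B" for x using that by (simp add: F_def)
    have F: "integrable lebesgue F"
    proof -
      have "set_integrable lebesgue (closure B) f"
        using f bounded_cc_ball[OF R] unfolding L1_loc_def B_def by (simp add: compact_closure)
      then have "set_integrable lebesgue B f"
        by (rule set_integrable_subset[OF _ BS closure_subset])
      then show ?thesis unfolding set_integrable_def F_def .
    qed
    have avg: "average B f = (LINT z:B|lebesgue. F z) / measure lebesgue B"
      unfolding average_def
      by (intro arg_cong2[of _ _ _ _ "(/)"] set_lebesgue_integral_cong BS) (simp_all add: F_eq)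
    have lhs: "(\<integral>\<^sup>+x\<in>B. ennreal (\<bar>f x - average B f\<bar> powr p) \<partial>lebesgue)
      = (\<integral>\<^sup>+x\<in>B. ennreal (\<bar>F x - (LINT z:B|lebesgue. F z) / measure lebesgue B\<bar> powr p) \<partial>lebesgue)"
      unfolding avg by (intro nn_integral_cong) (simp add: F_eq indicator_def)
    have hF: "(\<integral>\<^sup>+x\<in>B. h x \<partial>lebesgue)
      = (\<integral>\<^sup>+x\<in>B. (\<integral>\<^sup>+y\<in>B. ennreal (\<bar>F x - F y\<bar> / nrm (- y \<otimes> x) powr (real Q + s)) \<partial>lebesgue) \<partial>lebesgue)"
    proof (intro nn_integral_cong)
      fix x
      show "h x * indicator B x = (\<integral>\<^sup>+y\<in>B. ennreal (\<bar>F x - F y\<bar> / nrm (- y \<otimes> x) powr (real Q + s)) \<partial>lebesgue) * indicator B x"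
      proof (cases "x \<in> B")
        case True
        then have "h x = (\<integral>\<^sup>+y\<in>B. ennreal (\<bar>F x - F y\<bar> / nrm (- y \<otimes> x) powr (real Q + s)) \<partial>lebesgue)"
          unfolding h_def by (intro nn_integral_cong) (auto simp: F_eq split: split_indicator)
        then show ?thesis by simp
      qed simp
    qed
    have main: "ennpowr ((\<integral>\<^sup>+x\<in>B. ennreal (\<bar>f x - average B f\<bar> powr p) \<partial>lebesgue) / emeasure lebesgue B) (1 / p)
        \<le> ennreal (c * (1 - s) * R powr (real Q + s)) * ((\<integral>\<^sup>+x\<in>B. h x \<partial>lebesgue) / (emeasure lebesgue B)\<^sup>2)"
    \<comment> \<open>The coefficient in front is strictly positive, so an infinite double integral
      makes the right side infinite.\<close>
    proof (cases "(\<integral>\<^sup>+x\<in>B. h x \<partial>lebesgue) = \<infinity>")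
      case True
      have "(emeasure lebesgue B)\<^sup>2 = ennreal (b\<^sup>2)"
        unfolding eB using b by (simp add: ennreal_power)
      then have "ennreal (c * (1 - s) * R powr (real Q + s)) * ((\<integral>\<^sup>+x\<in>B. h x \<partial>lebesgue) / (emeasure lebesgue B)\<^sup>2) = \<infinity>"
        unfolding True using c assms(5) R by (simp add: ennreal_top_divide ennreal_mult_top)
      then show ?thesis by simp
    next
      case False
      define \<Gamma> where "\<Gamma> = enn2real (\<integral>\<^sup>+x\<in>B. h x \<partial>lebesgue)"
      have \<Gamma>: "(\<integral>\<^sup>+x\<in>B. h x \<partial>lebesgue) = ennreal \<Gamma>" "0 \<le> \<Gamma>"
        using False by (simp_all add: \<Gamma>_def less_top[symmetric])
      have pw: "(R / 2 ^ j) powr real Q = (R / 2 ^ j) ^ Q" "0 < R / 2 ^ j" for j :: nat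
        using R by (simp_all add: powr_realpow)
      have I: "(\<integral>\<^sup>+x\<in>B. ennreal (\<bar>f x - average B f\<bar> powr p) \<partial>lebesgue)
        \<le> ennreal (\<nu> * C * R powr \<theta> * \<Gamma> powr p)"
        unfolding lhs C_def A_def \<theta>_def
      proof (rule frac_poincare_chain[where q = "\<lambda>x y. nrm (- y \<otimes> x)" and K = K,
            OF sigma_finite_lebesgue BS F measurable_nrm_diff[OF assms(3)] _ _ assms(4) Q(1) assms(6,7) K(1) \<beta>(1) \<nu> R])
        show "0 \<le> nrm (- y \<otimes> x)" for x y by (rule nrm_props[OF assms(3)])
        show "x = y" if "nrm (- y \<otimes> x) = 0" for x y
        proof -
          have "- y \<otimes> x = 0" using that nrm_props(3)[OF assms(3)] by simp
          then have "y \<otimes> (- y \<otimes> x) = y" by simp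
          then show ?thesis by simp
        qed
        show "\<exists>D. D 0 = B \<and> (\<forall>j::nat. D j \<in> sets lebesgue \<and> D j \<subseteq> B \<and>
            emeasure lebesgue (D j) = ennreal (\<beta> * (R / 2 ^ j) powr real Q) \<and>
            (\<forall>y\<in>D j. nrm (- y \<otimes> x) \<le> K * (R / 2 ^ j)) \<and>
            (\<forall>y\<in>D j. \<forall>z\<in>D (Suc j). nrm (- z \<otimes> y) \<le> K * (R / 2 ^ j)))" if x: "x \<in> B" for x
        proof -
          obtain z where z: "z 0 = x0" "\<And>j::nat. cc_ball X wt (z j) (R / 2 ^ j) \<subseteq> B"
            "\<And>j. cc_ball X wt (z j) (R / 2 ^ j) \<subseteq> cc_ball X wt x (2 * (R / 2 ^ j))"
            using cc_ball_chain[OF x[unfolded B_def]] unfolding B_def by blast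
          have x_in: "x \<in> cc_ball X wt x (2 * (R / 2 ^ j))" for j :: nat
            using hpath_refl[of x] R by (auto simp: mem_cc_ball intro!: exI[of _ 0])
          \<comment> \<open>Two radii of step \<open>Suc j\<close> make one radius of step
            \<open>j\<close>, so consecutive balls of the chain and the point \<open>x\<close> lie
            in one ball about \<open>x\<close>, where \<open>K\<close> controls all mutual norm
            distances.\<close>
          have Suc: "cc_ball X wt (z (Suc j)) (R / 2 ^ Suc j) \<subseteq> cc_ball X wt x (2 * (R / 2 ^ j))" for j
            by (rule order_trans[OF z(3) cc_ball_mono]) (use R in \<open>simp add: field_simps\<close>)
          show ?thesis
          proof (intro exI[of _ "\<lambda>j. cc_ball X wt (z j) (R / 2 ^ j)"] conjI allI ballI)
            fix j :: nat
            show "cc_ball X wt (z j) (R / 2 ^ j) \<in> sets lebesgue"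
              using pw(2)[of j] by (simp add: open_cc_ball)
            show "emeasure lebesgue (cc_ball X wt (z j) (R / 2 ^ j)) = ennreal (\<beta> * (R / 2 ^ j) powr real Q)"
              unfolding pw(1) by (rule \<beta>(2)[OF pw(2)])
            fix y assume y: "y \<in> cc_ball X wt (z j) (R / 2 ^ j)"
            show "nrm (- y \<otimes> x) \<le> K * (R / 2 ^ j)"
              by (rule K(2)[OF x_in subsetD[OF z(3) y] pw(2)])
            fix u assume "u \<in> cc_ball X wt (z (Suc j)) (R / 2 ^ Suc j)"
            then show "nrm (- u \<otimes> y) \<le> K * (R / 2 ^ j)"
              by (intro K(2)[OF subsetD[OF z(3) y] subsetD[OF Suc] pw(2)])
          qed (use z in \<open>auto simp: B_def\<close>)
        qed
        show "emeasure lebesgue {x \<in> B. nrm (- y \<otimes> x) \<le> K * (R / 2 ^ j)} \<le> ennreal (\<nu> * (R / 2 ^ j) powr real Q)" for y and j :: nat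
        proof -
          have "emeasure lebesgue {x \<in> B. nrm (- y \<otimes> x) \<le> K * (R / 2 ^ j)} \<le> ennreal (\<nu>0 * (K * (R / 2 ^ j)) ^ Q)"
            by (rule \<nu>0(2)[of _ _ y]) (use K(1) R in auto)
          also have "\<nu>0 * (K * (R / 2 ^ j)) ^ Q = \<nu> * (R / 2 ^ j) powr real Q"
            unfolding pw(1) \<nu>_def power_mult_distrib by (simp only: mult.assoc)
          finally show ?thesis .
        qed
        show "0 \<le> \<Gamma>" by (rule \<Gamma>(2))
        show "(\<integral>\<^sup>+x\<in>B. (\<integral>\<^sup>+y\<in>B. ennreal (\<bar>F x - F y\<bar> / nrm (- y \<otimes> x) powr (real Q + s)) \<partial>lebesgue) \<partial>lebesgue) = ennreal \<Gamma>"
          unfolding hF[symmetric] by (rule \<Gamma>(1))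
      qed
      define v where "v = \<nu> * C * R powr \<theta> * \<Gamma> powr p / b"
      have v0: "0 \<le> v" using \<nu> C b by (simp add: v_def)
      have "(\<integral>\<^sup>+x\<in>B. ennreal (\<bar>f x - average B f\<bar> powr p) \<partial>lebesgue) / emeasure lebesgue B
          \<le> ennreal (\<nu> * C * R powr \<theta> * \<Gamma> powr p) / ennreal b"
        unfolding eB by (rule divide_right_mono_ennreal[OF I])
      also have "\<dots> = ennreal v"
        using \<nu> C b by (simp add: v_def divide_ennreal)
      finally have "ennpowr ((\<integral>\<^sup>+x\<in>B. ennreal (\<bar>f x - average B f\<bar> powr p) \<partial>lebesgue) / emeasure lebesgue B) (1 / p)
          \<le> ennreal (v powr (1 / p))"
        by (rule ennpowr_le) (use v0 assms(6) in auto)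
      also have "v powr (1 / p) = (\<nu> * C / \<beta>) powr (1 / p) * (R powr (s - real Q) * \<Gamma>)"
      proof -
        have v: "v = \<nu> * C / \<beta> * (R powr (s - real Q) * \<Gamma>) powr p"
        proof -
          have "R powr \<theta> / R ^ Q = R powr ((s - real Q) * p)"
            using R by (simp add: powr_realpow[symmetric] powr_diff[symmetric] \<theta>_def algebra_simps)
          moreover have "v = \<nu> * C / \<beta> * ((R powr \<theta> / R ^ Q) * \<Gamma> powr p)"
            by (simp add: v_def b_def)
          ultimately show ?thesis by (simp add: powr_mult powr_powr)
        qed
        have "v powr (1 / p) = (\<nu> * C / \<beta>) powr (1 / p) * ((R powr (s - real Q) * \<Gamma>) powr p) powr (1 / p)"
          unfolding v by (rule powr_mult)
        also have "((R powr (s - real Q) * \<Gamma>) powr p) powr (1 / p) = R powr (s - real Q) * \<Gamma>"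
          unfolding powr_powr using assms(6) \<Gamma>(2) by simp
        finally show ?thesis .
      qed
      also have "(\<nu> * C / \<beta>) powr (1 / p) * (R powr (s - real Q) * \<Gamma>)
          = c * (1 - s) * R powr (real Q + s) * (\<Gamma> / b\<^sup>2)"
      proof -
        have e1: "R powr (real Q + s) = R powr (s - real Q) * (R ^ Q)\<^sup>2"
          using R by (simp add: powr_realpow[symmetric] power2_eq_square powr_add[symmetric])
        have e2: "c * (1 - s) = (\<nu> * C / \<beta>) powr (1 / p) * \<beta>\<^sup>2"
          using assms(5) by (simp add: c_def)
        show ?thesis
          unfolding e1 e2 b_def power_mult_distrib using \<beta>(1) R by simp
      qed
      also have "ennreal \<dots> = ennreal (c * (1 - s) * R powr (real Q + s)) * (ennreal \<Gamma> / ennreal (b\<^sup>2))"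
      proof -
        have *: "ennreal \<Gamma> / ennreal (b\<^sup>2) = ennreal (\<Gamma> / b\<^sup>2)"
          using \<Gamma>(2) b by (intro divide_ennreal) auto
        show ?thesis
          unfolding * by (rule ennreal_mult) (use c assms(5) \<Gamma>(2) in auto)
      qed
      also have "ennreal (b\<^sup>2) = (emeasure lebesgue B)\<^sup>2"
        unfolding eB using b by (simp add: ennreal_power)
      finally show ?thesis unfolding \<Gamma>(1) .
    qed
    show "let B = cc_ball X wt x0 R in
        ennpowr ((\<integral>\<^sup>+x\<in>B. ennreal (\<bar>f x - average B f\<bar> powr p) \<partial>lebesgue)
                   / emeasure lebesgue B) (1 / p)
        \<le> ennreal (c * (1 - s) * R powr (real Q + s))
            * ((\<integral>\<^sup>+x\<in>B. (\<integral>\<^sup>+y\<in>B.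
                   ennreal (\<bar>f x - f y\<bar> / nrm (inv y \<otimes> x) powr (real Q + s)) \<partial>lebesgue) \<partial>lebesgue)
               / (emeasure lebesgue B)\<^sup>2)"
      unfolding Let_def inv_eq_uminus using main unfolding h_def B_def .
  qed
qed

end
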